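(* Let $G$ be drawn from the stochastic block model described in the context with $\pi_i\equiv1/r$, assume $r_0>1$, let $\tau=\mu_2^2/\mu_1$, and let $\ell\sim\kappa\log_\alpha(n)$ with $\kappa<1/12$. Let $D^{(\ell)}$ be the distance matrix of $G$. If $\gamma=\Omega(\tau^\ell)$, then there exists a perturbation of $G$ by an adversary of strength at most $\gamma$, producing a graph with distance matrix $\tilde D^{(\ell)}$, such that $\tilde D^{(\ell)}$ has an eigenvalue of size $\Omega(\mu_2^\ell)$ whose associated eigenvector is asymptotically perpendicular to the eigenvectors of $D^{(\ell)}$ associated with its $r_0$ largest eigenvalues.
   Context: Stochastic block model: $r$ fixed, $W$ symmetric nonnegative $r\times r$, $\pi$ a probability vector on $[r]$; each vertex $v$ ($|V|=n$) gets an independent type $\sigma(v)\sim\pi$ and each pair $u,v$ is joined independently with probability $\min(W_{\sigma(u)\sigma(v)}/n,1)$. $M=\mathrm{diag}(\pi)W$ has real eigenvalues $\mu_1\ge|\mu_2|\ge\dots\ge|\mu_r|$; standing assumptions: $\mu_1>1$, $M$ positive regular, $\sum_iM_{ij}=\alpha$ for all $j$ (so $\mu_1=\alpha$). $r_0$ is defined by $\mu_{r_0+1}^2\le\mu_1<\mu_{r_0}^2$. Distance matrix: $D^{(\ell)}_{ij}=1$ iff the graph distance between $i$ and $j$ equals $\ell$. An adversary of strength $\gamma$ may arbitrarily add and remove edges, provided at most $\gamma$ vertices are endpoints of altered edges. *)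

theory Defs
  imports
    "HOL-Probability.Product_PMF"
    "HOL-Library.Landau_Symbols"
    "HOL-Library.Extended_Nat"
    "Jordan_Normal_Form.Char_Poly"
begin

text \<open>A simple graph on the vertex set \<open>{..<n}\<close> is given by its set of edges, each edge being a
  two-element set of vertices.\<close>

definition is_graph :: "nat \<Rightarrow> nat set set \<Rightarrow> bool" where
  "is_graph n E \<longleftrightarrow> (\<forall>e\<in>E. e \<subseteq> {..<n} \<and> card e = 2)"

text \<open>The relational power \<open>{(u, v). {u, v} \<in> E} ^^ k\<close> consists of the pairs joined by a walk
  with \<open>k\<close> edges; vertices in different components are at distance \<open>\<infinity>\<close>.\<close>

definition graph_dist :: "nat set set \<Rightarrow> nat \<Rightarrow> nat \<Rightarrow> enat" where
  "graph_dist E i j = (INF k \<in> {k. (i, j) \<in> {(u, v). {u, v} \<in> E} ^^ k}. enat k)"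

definition distance_matrix :: "nat \<Rightarrow> nat set set \<Rightarrow> nat \<Rightarrow> real mat" where
  "distance_matrix n E l =
     Matrix.mat n n (\<lambda>(i, j). if graph_dist E i j = enat l then 1 else 0)"

text \<open>Law of the edge set of the stochastic block model on \<open>n\<close> vertices with type distribution
  \<open>p\<close> and symmetric connectivity matrix \<open>W\<close>; types are numbered from \<open>0\<close>. The values \<open>0\<close> and
  \<open>False\<close> passed to \<^const>\<open>Pi_pmf\<close> are those taken outside the index sets.\<close>

definition sbm :: "nat \<Rightarrow> nat pmf \<Rightarrow> real mat \<Rightarrow> nat set set pmf" where
  "sbm n p W =
     do {
       \<sigma> \<leftarrow> Pi_pmf {..<n} 0 (\<lambda>_. p);
       b \<leftarrow> Pi_pmf {(u, v). u < v \<and> v < n} False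
              (\<lambda>(u, v). bernoulli_pmf (min (W $$ (\<sigma> u, \<sigma> v) / real n) 1));
       return_pmf {{u, v} | u v. u < v \<and> v < n \<and> b (u, v)}
     }"

definition mean_matrix :: "nat \<Rightarrow> nat pmf \<Rightarrow> real mat \<Rightarrow> real mat" where
  "mean_matrix r p W = mat_diag r (pmf p) * W"

definition positive_regular :: "nat \<Rightarrow> real mat \<Rightarrow> bool" where
  "positive_regular r M \<longleftrightarrow> (\<exists>k>0. \<forall>i<r. \<forall>j<r. (M ^\<^sub>m k) $$ (i, j) > 0)"

text \<open>\<open>\<mu> 1, \<dots>, \<mu> r\<close> are the eigenvalues of \<open>M\<close> with algebraic multiplicity, in order of
  non-increasing absolute value.\<close>

definition ordered_eigenvalues :: "nat \<Rightarrow> real mat \<Rightarrow> (nat \<Rightarrow> real) \<Rightarrow> bool" where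
  "ordered_eigenvalues r M \<mu> \<longleftrightarrow>
     char_poly M = (\<Prod>k\<in>{1..r}. [:- \<mu> k, 1:]) \<and>
     (\<forall>j k. 1 \<le> j \<and> j \<le> k \<and> k \<le> r \<longrightarrow> \<bar>\<mu> k\<bar> \<le> \<bar>\<mu> j\<bar>)"

text \<open>\<open>u 1, \<dots>, u n\<close> is an orthonormal basis of eigenvectors of the \<open>n \<times> n\<close> matrix \<open>A\<close>, listed in
  order of non-increasing absolute value of the eigenvalues.\<close>

definition ordered_eigenbasis :: "nat \<Rightarrow> real mat \<Rightarrow> (nat \<Rightarrow> real vec) \<Rightarrow> bool" where
  "ordered_eigenbasis n A u \<longleftrightarrow>
     (\<forall>j\<in>{1..n}. \<forall>k\<in>{1..n}. scalar_prod (u j) (u k) = (if j = k then 1 else 0)) \<and>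
     (\<exists>ev. (\<forall>k\<in>{1..n}. eigenvector A (u k) (ev k)) \<and>
          (\<forall>j k. 1 \<le> j \<and> j \<le> k \<and> k \<le> n \<longrightarrow> \<bar>ev k\<bar> \<le> \<bar>ev j\<bar>))"

text \<open>The graph \<open>E'\<close> can be obtained from \<open>E\<close> by an adversary of strength \<open>g\<close>: at most \<open>g\<close> vertices
  are endpoints of added or removed edges.\<close>

definition adversarial_perturbation ::
    "nat \<Rightarrow> nat \<Rightarrow> nat set set \<Rightarrow> nat set set \<Rightarrow> bool" where
  "adversarial_perturbation n g E E' \<longleftrightarrow>
     is_graph n E' \<and> card (\<Union> ((E - E') \<union> (E' - E))) \<le> g"

end

theory Submission
  imports Defs "Jordan_Normal_Form.Schur_Decomposition" "HOL-Real_Asymp.Real_Asymp"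
begin

text \<open>The adversary chooses a vertex \<open>v\<close> and joins to it \<open>k\<close> vertices \<open>L\<close> that are isolated in the
  graph, with \<open>k\<close> of order \<open>\<tau> ^ l\<close>. If \<open>s\<close> is the indicator of the sphere \<open>S\<close> of radius \<open>l - 1\<close>
  around \<open>v\<close> and \<open>t\<close> that of \<open>L\<close>, this adds \<open>t s\<^sup>T + s t\<^sup>T\<close> to the distance matrix \<open>D\<close> and changes
  no other entry. So \<open>t / sqrt k + s / sqrt |S|\<close> is an approximate eigenvector of the new matrix for
  \<open>\<theta> = sqrt (k |S|)\<close>, which is of order \<open>\<mu> 2 ^ l\<close>, up to an error of norm at most
  \<open>\<eta> = |D s| / sqrt |S|\<close>. If \<open>x\<close> and \<open>u\<close> are unit eigenvectors of the new and the old matrix for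
  \<open>\<lambda>\<close> and \<open>e \<noteq> 0\<close>, then \<open>(\<lambda> - e) (x \<bullet> u) = (t \<bullet> x) (s \<bullet> u)\<close> and \<open>e (s \<bullet> u) = D s \<bullet> u\<close>, so
  \<open>|x \<bullet> u| \<le> \<eta> \<theta> / (|e| |\<lambda> - e|)\<close>. Trying \<open>k = 4 ^ i k0\<close> for \<open>i \<le> r\<^sub>0\<close>, one of the scales
  \<open>2 ^ i \<theta>\<close> is separated from the absolute values of the \<open>r\<^sub>0\<close> leading eigenvalues by a constant
  factor, and it remains to see that with high probability \<open>|S|\<close> is of order \<open>\<alpha> ^ l\<close> for some \<open>v\<close>
  with \<open>\<eta>\<close> at most \<open>\<alpha> ^ (l / 2)\<close> up to powers of \<open>l\<close>, while the \<open>r\<^sub>0\<close>-th eigenvalue of \<open>D\<close> is at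
  least \<open>\<rho> ^ l\<close> up to a constant for some \<open>\<rho> > sqrt \<alpha>\<close>. For the latter, functions of the types
  are test vectors, on which \<open>D\<close> acts approximately as \<open>M ^ l\<close>. All of this follows from first and
  second moments of numbers of paths: a configuration of paths in which every vertex but the first
  is reached by a fresh edge has probability \<open>(\<alpha> / n) ^ k\<close>, and \<open>\<kappa> < 1 / 12\<close> makes configurations
  with a cycle negligible.\<close>

section \<open>The stochastic block model with its types\<close>


text \<open>Only lower bounds for the leading eigenvalues of \<open>D\<close> are proved, so nothing
  prevents one of them from lying close to \<theta>. This is why the number of leaves depends on the
  graph: \<open>r\<^sub>0\<close> values can spoil at most \<open>r\<^sub>0\<close> of the
  \<open>r\<^sub>0 + 1\<close> scales. Leaves are taken isolated to keep the change of
  \<open>D\<close> exact, as joining vertices with neighbours of their own would shorten other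
  distances. The radius \<open>l - 1\<close> puts leaf and sphere at distance exactly
  \<open>l\<close>. Once a scale is separated, the overlap is at most a constant times
  \<open>\<eta> / |e|\<close>, and the condition \<open>\<mu> 1 < (\<mu> r\<^sub>0)\<^sup>2\<close>
  says precisely that the leading eigenvalues outgrow \<eta>. No coupling with a branching process
  is needed: all types have the same mean degree \<alpha>, so constants are eigenfunctions of the
  type operator and tree-like configurations have probability exactly a power of \<alpha> / n.
  Eigenbases are not unique, but the ordered absolute eigenvalues are, so one scale serves all
  bases.\<close>

definition pairs :: "nat \<Rightarrow> nat set set" where
  "pairs n = {e. e \<subseteq> {..<n} \<and> card e = 2}"

lemma finite_pairs [simp]: "finite (pairs n)"
  by (rule finite_subset[of _ "Pow {..<n}"]) (auto simp: pairs_def)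

lemma pairs_Min_Max:
  assumes "e \<in> pairs n"
  shows "Min e < Max e" "Max e < n" "{Min e, Max e} = e"
proof -
  obtain a b where e: "e = {a, b}" "a \<noteq> b" "a < n" "b < n"
    using assms unfolding pairs_def card_2_iff by auto
  then show "Min e < Max e" "Max e < n" "{Min e, Max e} = e"
    by (auto simp: min_def max_def)
qed

lemma doubleton_in_pairs: "{x, y} \<in> pairs n \<longleftrightarrow> x < n \<and> y < n \<and> x \<noteq> y"
  by (auto simp: pairs_def card_2_iff doubleton_eq_iff)

text \<open>\<open>w \<le> real n\<close> makes the truncation at 1 vacuous, so that given the types
  an edge has probability exactly \<open>W / n\<close>. \<open>row_sum\<close> is the condition on
  the column sums of \<open>M\<close> with \<open>M = W / r\<close> and symmetry inserted: the mean
  degree \<alpha> is the same for every type. The bound \<open>w\<close> serves for edges whose two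
  ends are already exposed.\<close>

locale block_model =
  fixes r n :: nat and W :: "real mat" and p :: "nat pmf" and \<alpha> w :: real
  assumes r_pos: "r > 0" and W_carrier: "W \<in> carrier_mat r r"
    and W_sym: "\<And>i j. i < r \<Longrightarrow> j < r \<Longrightarrow> W $$ (i, j) = W $$ (j, i)"
    and W_nonneg: "\<And>i j. i < r \<Longrightarrow> j < r \<Longrightarrow> W $$ (i, j) \<ge> 0"
    and W_le: "\<And>i j. i < r \<Longrightarrow> j < r \<Longrightarrow> W $$ (i, j) \<le> w"
    and w_le: "w \<le> real n" and n_pos: "n > 0"
    and p_types: "set_pmf p \<subseteq> {..<r}"
    and p_uniform: "\<And>i. i < r \<Longrightarrow> pmf p i = 1 / real r"
    and row_sum: "\<And>i. i < r \<Longrightarrow> (\<Sum>j<r. W $$ (i, j)) = real r * \<alpha>"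
    and \<alpha>_ge: "\<alpha> \<ge> 1"
begin

lemma w_nonneg: "w \<ge> 0"
  using W_nonneg[of 0 0] W_le[of 0 0] r_pos by linarith

definition types :: "(nat \<Rightarrow> nat) pmf" where
  "types = Pi_pmf {..<n} 0 (\<lambda>_. p)"

definition ET :: "((nat \<Rightarrow> nat) \<Rightarrow> real) \<Rightarrow> real" where
  "ET f = measure_pmf.expectation types f"

lemma finite_p: "finite (set_pmf p)"
  by (rule finite_subset[OF p_types]) simp

lemma finite_types: "finite (set_pmf types)"
proof -
  have "set_pmf types \<subseteq> PiE_dflt {..<n} 0 (set_pmf \<circ> (\<lambda>_. p))"
    unfolding types_def by (rule set_Pi_pmf_subset') simp
  then show ?thesis by (rule finite_subset) (auto simp: finite_p)
qed

lemma types_lt: "\<sigma> \<in> set_pmf types \<Longrightarrow> v < n \<Longrightarrow> \<sigma> v < r"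
proof -
  assume "\<sigma> \<in> set_pmf types" "v < n"
  moreover have "set_pmf types \<subseteq> PiE_dflt {..<n} 0 (set_pmf \<circ> (\<lambda>_. p))"
    unfolding types_def by (rule set_Pi_pmf_subset') simp
  ultimately have "\<sigma> v \<in> set_pmf p" by (auto simp: PiE_dflt_def)
  then show ?thesis using p_types by auto
qed

lemma integrable_types [simp]: "integrable (measure_pmf types) (f :: _ \<Rightarrow> real)"
  by (rule integrable_measure_pmf_finite[OF finite_types])

lemma ET_cong: "(\<And>\<sigma>. (\<And>v. v < n \<Longrightarrow> \<sigma> v < r) \<Longrightarrow> f \<sigma> = g \<sigma>) \<Longrightarrow> ET f = ET g"
  unfolding ET_def by (rule integral_cong_AE) (auto simp: AE_measure_pmf_iff types_lt)

lemma ET_mono: "(\<And>\<sigma>. (\<And>v. v < n \<Longrightarrow> \<sigma> v < r) \<Longrightarrow> f \<sigma> \<le> g \<sigma>) \<Longrightarrow> ET f \<le> ET g"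
  unfolding ET_def by (rule integral_mono_AE) (auto simp: AE_measure_pmf_iff types_lt)

lemma ET_const [simp]: "ET (\<lambda>_. c) = c"
  by (simp add: ET_def)

lemma ET_cmult: "ET (\<lambda>\<sigma>. c * f \<sigma>) = c * ET f"
  by (simp add: ET_def)

lemma p_expectation: "measure_pmf.expectation p f = (\<Sum>t<r. f t / real r)" for f :: "nat \<Rightarrow> real"
proof -
  have "measure_pmf.expectation p f = (\<Sum>t<r. pmf p t *\<^sub>R f t)"
    by (rule integral_measure_pmf) (use p_types in auto)
  then show ?thesis by (simp add: p_uniform)
qed

text \<open>The types are independent, so drawing the type of \<open>y\<close> afresh leaves the law
  unchanged. This is the form in which a vertex is integrated out: its type becomes an average over
  \<open>t\<close>.\<close>

lemma ET_resample:
  assumes "y < n"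
  shows "ET f = ET (\<lambda>\<sigma>. \<Sum>t<r. f (\<sigma>(y := t)) / real r)"
proof -
  have ins: "{..<n} = insert y ({..<n} - {y})" using assms by auto
  define B where "B = Pi_pmf ({..<n} - {y}) (0::nat) (\<lambda>_. p)"
  have finB: "finite (set_pmf B)"
  proof -
    have "set_pmf B \<subseteq> PiE_dflt ({..<n} - {y}) 0 (set_pmf \<circ> (\<lambda>_. p))"
      unfolding B_def by (rule set_Pi_pmf_subset') simp
    then show ?thesis by (rule finite_subset) (auto simp: finite_p)
  qed
  have T: "types = do {\<sigma> \<leftarrow> B; t \<leftarrow> p; return_pmf (\<sigma>(y := t))}"
    unfolding types_def B_def
    by (subst ins, subst Pi_pmf_insert') (auto intro: bind_commute_pmf)
  have E: "ET g = measure_pmf.expectation B (\<lambda>\<sigma>. \<Sum>t<r. g (\<sigma>(y := t)) / real r)" for g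
  proof -
    have "ET g = measure_pmf.expectation (B \<bind> (\<lambda>\<sigma>. map_pmf (\<lambda>t. \<sigma>(y := t)) p)) g"
      unfolding ET_def T by (simp add: map_pmf_def)
    also have "\<dots> = (\<Sum>\<sigma>\<in>set_pmf B. pmf B \<sigma> *\<^sub>R
        measure_pmf.expectation (map_pmf (\<lambda>t. \<sigma>(y := t)) p) g)"
      by (rule pmf_expectation_bind) (auto simp: finB finite_p)
    also have "\<dots> = measure_pmf.expectation B (\<lambda>\<sigma>. \<Sum>t<r. g (\<sigma>(y := t)) / real r)"
      by (subst integral_measure_pmf[OF finB]) (auto simp: p_expectation)
    finally show ?thesis .
  qed
  have "ET (\<lambda>\<sigma>. \<Sum>t<r. f (\<sigma>(y := t)) / real r) =
      measure_pmf.expectation B (\<lambda>\<sigma>. \<Sum>t<r. (\<Sum>s<r. f (\<sigma>(y := s)) / real r) / real r)"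
    by (subst E) simp
  also have "\<dots> = ET f" by (subst E) (simp add: r_pos)
  finally show ?thesis ..
qed

text \<open>\<open>Min\<close> and \<open>Max\<close> merely name the two ends of an unordered edge;
  by symmetry of \<open>W\<close> their order is immaterial, see \<open>q_doubleton\<close>.\<close>

definition q :: "(nat \<Rightarrow> nat) \<Rightarrow> nat set \<Rightarrow> real" where
  "q \<sigma> e = W $$ (\<sigma> (Min e), \<sigma> (Max e)) / real n"

lemma q_doubleton:
  "\<sigma> x < r \<Longrightarrow> \<sigma> y < r \<Longrightarrow> q \<sigma> {x, y} = W $$ (\<sigma> x, \<sigma> y) / real n"
  by (cases "x \<le> y") (auto simp: q_def min_def max_def intro: W_sym)

lemma q_range:
  assumes "e \<in> pairs n" "\<And>v. v < n \<Longrightarrow> \<sigma> v < r"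
  shows "0 \<le> q \<sigma> e" "q \<sigma> e \<le> w / real n" "q \<sigma> e \<le> 1"
proof -
  have *: "\<sigma> (Min e) < r" "\<sigma> (Max e) < r"
    using pairs_Min_Max[OF assms(1)] assms(2) by force+
  show "0 \<le> q \<sigma> e" "q \<sigma> e \<le> w / real n"
    using W_nonneg[OF *] W_le[OF *] by (auto simp: q_def divide_right_mono)
  moreover have "w / real n \<le> 1" using w_le n_pos by simp
  ultimately show "q \<sigma> e \<le> 1" by linarith
qed

text \<open>Conditional probability, given the types, that all edges of \<open>H\<close> are
  present.\<close>

definition wt :: "(nat \<Rightarrow> nat) \<Rightarrow> nat set set \<Rightarrow> real" where
  "wt \<sigma> H = (\<Prod>e\<in>H. q \<sigma> e)"

lemma wt_nonneg: "H \<subseteq> pairs n \<Longrightarrow> (\<And>v. v < n \<Longrightarrow> \<sigma> v < r) \<Longrightarrow> wt \<sigma> H \<ge> 0"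
  unfolding wt_def by (rule prod_nonneg) (use q_range in blast)

section \<open>The joint law of types and edges\<close>

text \<open>Unlike \<^const>\<open>sbm\<close>, this law keeps the types of the vertices.\<close>

definition joint :: "((nat \<Rightarrow> nat) \<times> nat set set) pmf" where
  "joint =
     do {
       \<sigma> \<leftarrow> types;
       b \<leftarrow> Pi_pmf {(u, v). u < v \<and> v < n} False
              (\<lambda>(u, v). bernoulli_pmf (min (W $$ (\<sigma> u, \<sigma> v) / real n) 1));
       return_pmf (\<sigma>, {{u, v} | u v. u < v \<and> v < n \<and> b (u, v)})
     }"

lemma sbm_eq_joint: "sbm n p W = map_pmf snd joint"
  by (simp add: sbm_def joint_def types_def map_bind_pmf)

lemma finite_index: "finite {(u, v). u < v \<and> v < (n::nat)}"
  by (rule finite_subset[of _ "{..<n} \<times> {..<n}"]) auto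

definition edge_set :: "(nat \<times> nat \<Rightarrow> bool) \<Rightarrow> nat set set" where
  "edge_set b = {{u, v} | u v. u < v \<and> v < n \<and> b (u, v)}"

definition bits :: "(nat \<Rightarrow> nat) \<Rightarrow> (nat \<times> nat \<Rightarrow> bool) pmf" where
  "bits \<sigma> = Pi_pmf {(u, v). u < v \<and> v < n} False
              (\<lambda>(u, v). bernoulli_pmf (min (W $$ (\<sigma> u, \<sigma> v) / real n) 1))"

lemma joint_alt: "joint = types \<bind> (\<lambda>\<sigma>. bits \<sigma> \<bind> (\<lambda>b. return_pmf (\<sigma>, edge_set b)))"
  by (simp add: joint_def bits_def edge_set_def)

lemma finite_bits: "finite (set_pmf (bits \<sigma>))"
proof -
  have "set_pmf (bits \<sigma>) \<subseteq> PiE_dflt {(u, v). u < v \<and> v < n} False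
     (set_pmf \<circ> (\<lambda>(u, v). bernoulli_pmf (min (W $$ (\<sigma> u, \<sigma> v) / real n) 1)))"
    unfolding bits_def by (rule set_Pi_pmf_subset'[OF finite_index])
  then show ?thesis
    by (rule finite_subset) (auto intro!: finite_PiE_dflt finite_index)
qed

lemma finite_joint: "finite (set_pmf joint)"
  unfolding joint_alt by (simp add: finite_types finite_bits)

lemma integrable_joint [simp]: "integrable (measure_pmf joint) (f :: _ \<Rightarrow> real)"
  by (rule integrable_measure_pmf_finite[OF finite_joint])

definition EJ :: "((nat \<Rightarrow> nat) \<times> nat set set \<Rightarrow> real) \<Rightarrow> real" where
  "EJ f = measure_pmf.expectation joint f"

lemma EJ_bind: "EJ f = ET (\<lambda>\<sigma>. measure_pmf.expectation (bits \<sigma>) (\<lambda>b. f (\<sigma>, edge_set b)))"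
proof -
  have "EJ f = (\<Sum>\<sigma>\<in>set_pmf types. pmf types \<sigma> *\<^sub>R
      measure_pmf.expectation (bits \<sigma> \<bind> (\<lambda>b. return_pmf (\<sigma>, edge_set b))) f)"
    unfolding EJ_def joint_alt
    by (rule pmf_expectation_bind) (auto simp: finite_types finite_bits)
  also have "\<dots> = ET (\<lambda>\<sigma>. measure_pmf.expectation (bits \<sigma> \<bind> (\<lambda>b. return_pmf (\<sigma>, edge_set b))) f)"
    unfolding ET_def by (subst integral_measure_pmf[OF finite_types]) auto
  finally show ?thesis
    by (simp add: map_pmf_def[symmetric])
qed

lemma joint_support:
  assumes "\<sigma>E \<in> set_pmf joint"
  shows "snd \<sigma>E \<subseteq> pairs n" "\<And>v. v < n \<Longrightarrow> fst \<sigma>E v < r"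
  using assms by (auto simp: joint_alt edge_set_def doubleton_in_pairs types_lt)

lemma EJ_mono: "(\<And>\<sigma> E. E \<subseteq> pairs n \<Longrightarrow> (\<And>v. v < n \<Longrightarrow> \<sigma> v < r) \<Longrightarrow> f (\<sigma>, E) \<le> g (\<sigma>, E)) \<Longrightarrow> EJ f \<le> EJ g"
  unfolding EJ_def
  by (rule integral_mono_AE) (use joint_support in \<open>auto simp: AE_measure_pmf_iff\<close>)

lemma EJ_cong: "(\<And>\<sigma> E. E \<subseteq> pairs n \<Longrightarrow> (\<And>v. v < n \<Longrightarrow> \<sigma> v < r) \<Longrightarrow> f (\<sigma>, E) = g (\<sigma>, E)) \<Longrightarrow> EJ f = EJ g"
  by (intro antisym EJ_mono) simp_all

lemma edge_in_edge_set: "e \<in> pairs n \<Longrightarrow> e \<in> edge_set b \<longleftrightarrow> b (Min e, Max e)"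
proof
  assume e: "e \<in> pairs n" "e \<in> edge_set b"
  then obtain u v where "e = {u, v}" "u < v" "b (u, v)" by (auto simp: edge_set_def)
  then show "b (Min e, Max e)" by simp
next
  assume "e \<in> pairs n" "b (Min e, Max e)"
  then show "e \<in> edge_set b" using pairs_Min_Max[of e n] unfolding edge_set_def by blast
qed

text \<open>A general function \<open>g\<close> of the bit covers presence and absence of edges at
  once: \<open>of_bool\<close> yields \<open>EJ_subset\<close>, its negation
  \<open>EJ_disjoint\<close>.\<close>

lemma expectation_bits_prod:
  fixes g :: "bool \<Rightarrow> real"
  assumes H: "H \<subseteq> pairs n" and g: "\<And>b. g b \<ge> 0" and \<sigma>: "\<And>v. v < n \<Longrightarrow> \<sigma> v < r"
  shows "measure_pmf.expectation (bits \<sigma>) (\<lambda>b. \<Prod>e\<in>H. g (e \<in> edge_set b)) =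
    (\<Prod>e\<in>H. q \<sigma> e * g True + (1 - q \<sigma> e) * g False)"
proof -
  let ?I = "{(u, v). u < v \<and> v < (n::nat)}"
  \<comment> \<open>Index pairs outside \<open>H\<close> get the factor 1, so that a product over
    \<open>H\<close> becomes one over all independent coordinates.\<close>
  let ?h = "\<lambda>i b. if {fst i, snd i} \<in> H then g b else 1"
  note mm = pairs_Min_Max[of _ n]
  have bij: "bij_betw (\<lambda>e. (Min e, Max e)) (pairs n) ?I"
  proof (rule bij_betwI[where g = "\<lambda>(u, v). {u, v}"])
    show "(\<lambda>e. (Min e, Max e)) \<in> pairs n \<rightarrow> ?I" using mm by blast
    show "(\<lambda>(u, v). {u, v}) \<in> ?I \<rightarrow> pairs n" by (auto simp: doubleton_in_pairs)
    show "(case (Min e, Max e) of (u, v) \<Rightarrow> {u, v}) = e" if "e \<in> pairs n" for e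
      using mm(3)[OF that] by simp
    show "(Min (case y of (u, v) \<Rightarrow> {u, v}), Max (case y of (u, v) \<Rightarrow> {u, v})) = y" if "y \<in> ?I" for y
      using that by auto
  qed
  have fin: "finite H" using finite_subset[OF H] by simp
  have "(\<Prod>e\<in>H. g (e \<in> edge_set b)) = (\<Prod>i\<in>?I. ?h i (b i))" for b
  proof -
    have "(\<Prod>i\<in>?I. ?h i (b i)) = (\<Prod>e\<in>pairs n. ?h (Min e, Max e) (b (Min e, Max e)))"
      by (rule prod.reindex_bij_betw[OF bij, symmetric])
    also have "\<dots> = (\<Prod>e\<in>pairs n. if e \<in> H then g (e \<in> edge_set b) else 1)"
      by (rule prod.cong) (auto simp: mm(3) edge_in_edge_set)
    also have "\<dots> = (\<Prod>e\<in>H. g (e \<in> edge_set b))"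
      using H by (subst prod.inter_restrict[symmetric]) (auto simp: Int_absorb1)
    finally show ?thesis ..
  qed
  then have "measure_pmf.expectation (bits \<sigma>) (\<lambda>b. \<Prod>e\<in>H. g (e \<in> edge_set b)) =
     measure_pmf.expectation (bits \<sigma>) (\<lambda>b. \<Prod>i\<in>?I. ?h i (b i))" by simp
  also have "\<dots> = (\<Prod>i\<in>?I. measure_pmf.expectation
       ((\<lambda>(u, v). bernoulli_pmf (min (W $$ (\<sigma> u, \<sigma> v) / real n) 1)) i) (?h i))"
    unfolding bits_def
    by (rule expectation_prod_Pi_pmf[OF finite_index]) (use g in \<open>auto intro!: integrable_measure_pmf_finite\<close>)
  also have "\<dots> = (\<Prod>i\<in>?I. if {fst i, snd i} \<in> H then q \<sigma> {fst i, snd i} * g True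
      + (1 - q \<sigma> {fst i, snd i}) * g False else 1)"
  proof (rule prod.cong[OF refl], goal_cases)
    case (1 i)
    obtain u v where i: "i = (u, v)" "u < v" "v < n" using 1 by auto
    then have "{u, v} \<in> pairs n" by (simp add: doubleton_in_pairs)
    then have "0 \<le> q \<sigma> {u, v}" "q \<sigma> {u, v} \<le> 1"
      using q_range(1)[of "{u, v}" \<sigma>] q_range(3)[of "{u, v}" \<sigma>] \<sigma> by blast+
    moreover have "q \<sigma> {u, v} = W $$ (\<sigma> u, \<sigma> v) / real n"
      using i \<sigma> by (simp add: q_doubleton)
    ultimately show ?case using i by (auto simp: min_def)
  qed
  also have "\<dots> = (\<Prod>e\<in>pairs n. if e \<in> H then q \<sigma> e * g True + (1 - q \<sigma> e) * g False else 1)"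
    by (subst prod.reindex_bij_betw[OF bij, symmetric], rule prod.cong)
       (auto simp: mm(3))
  also have "\<dots> = (\<Prod>e\<in>H. q \<sigma> e * g True + (1 - q \<sigma> e) * g False)"
    using H by (subst prod.inter_restrict[symmetric]) (auto simp: Int_absorb1)
  finally show ?thesis .
qed

lemma EJ_subset:
  assumes H: "H \<subseteq> pairs n"
  shows "EJ (\<lambda>(\<sigma>, E). F \<sigma> * of_bool (H \<subseteq> E)) = ET (\<lambda>\<sigma>. F \<sigma> * wt \<sigma> H)"
proof -
  have fin: "finite H" using finite_subset[OF H] by simp
  have "of_bool (H \<subseteq> E) = (\<Prod>e\<in>H. of_bool (e \<in> E) :: real)" for E
    using fin by (induction rule: finite_induct) auto
  then show ?thesis
    unfolding EJ_bind by (intro ET_cong) (simp add: expectation_bits_prod[OF H, where g = of_bool] wt_def)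
qed

lemma EJ_disjoint:
  assumes H: "H \<subseteq> pairs n"
  shows "EJ (\<lambda>(\<sigma>, E). of_bool (H \<inter> E = {})) = ET (\<lambda>\<sigma>. \<Prod>e\<in>H. 1 - q \<sigma> e)"
proof -
  have fin: "finite H" using finite_subset[OF H] by simp
  have "of_bool (H \<inter> E = {}) = (\<Prod>e\<in>H. of_bool (\<not> e \<in> E) :: real)" for E
    using fin by (induction rule: finite_induct) auto
  then show ?thesis
    unfolding EJ_bind
    by (intro ET_cong) (simp add: expectation_bits_prod[OF H, where g = "\<lambda>b. of_bool (\<not> b)"])
qed

end

section \<open>Expected numbers of paths\<close>


fun edges :: "nat list \<Rightarrow> nat set set" where
  "edges (x # y # zs) = insert {x, y} (edges (y # zs))"
| "edges _ = {}"

lemma finite_edges [simp]: "finite (edges xs)"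
  by (induction xs rule: edges.induct) auto

lemma edges_snoc: "xs \<noteq> [] \<Longrightarrow> edges (xs @ [y]) = insert {last xs, y} (edges xs)"
  by (induction xs rule: edges.induct) auto

lemma edges_append: "edges (xs @ y # ys) = edges (xs @ [y]) \<union> edges (y # ys)"
  by (induction xs rule: edges.induct) auto

lemma edges_append_last: "xs \<noteq> [] \<Longrightarrow> edges (xs @ ys) = edges xs \<union> edges (last xs # ys)"
  by (induction xs rule: edges.induct) auto

lemma edges_rev: "edges (rev xs) = edges xs"
proof (induction xs rule: edges.induct)
  case (1 x y zs)
  then show ?case using edges_snoc[of "rev zs @ [y]" x] by (simp add: insert_commute)
qed auto

lemma edges_take: "edges (take k xs) \<subseteq> edges xs"
proof (cases "take k xs = []")
  case False
  then have "edges (take k xs @ drop k xs) = edges (take k xs) \<union> edges (last (take k xs) # drop k xs)"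
    by (rule edges_append_last)
  then show ?thesis by simp
qed auto

lemma edges_drop: "edges (drop k xs) \<subseteq> edges xs"
proof -
  have "edges (rev (drop k xs)) \<subseteq> edges (rev xs)"
    by (simp add: rev_drop edges_take)
  then show ?thesis by (simp add: edges_rev)
qed

lemma Union_edges: "\<Union> (edges xs) \<subseteq> set xs"
  by (induction xs rule: edges.induct) auto

lemma edges_subset_pairs: "distinct xs \<Longrightarrow> set xs \<subseteq> {..<n} \<Longrightarrow> edges xs \<subseteq> pairs n"
  by (induction xs rule: edges.induct) (auto simp: doubleton_in_pairs)

lemma set_subset_if_edges: "edges xs \<subseteq> pairs n \<Longrightarrow> length xs \<ge> 2 \<Longrightarrow> set xs \<subseteq> {..<n}"
proof (induction xs rule: edges.induct)
  case (1 x y zs)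
  then show ?case by (cases zs) (auto simp: doubleton_in_pairs)
qed auto

lemma edges_nth: "Suc i < length xs \<Longrightarrow> {xs ! i, xs ! Suc i} \<in> edges xs"
proof (induction xs arbitrary: i rule: edges.induct)
  case (1 x y zs)
  then show ?case by (cases i) auto
qed auto

lemma edges_conv_nth: "edges xs = {{xs ! i, xs ! Suc i} | i. Suc i < length xs}"
proof (rule subset_antisym)
  show "edges xs \<subseteq> {{xs ! i, xs ! Suc i} | i. Suc i < length xs}"
  proof (induction xs rule: edges.induct)
    case (1 x y zs)
    have "\<exists>i. e = {(x # y # zs) ! i, (x # y # zs) ! Suc i} \<and> Suc i < length (x # y # zs)"
      if e: "e \<in> edges (x # y # zs)" for e
    proof (cases "e = {x, y}")
      case True then show ?thesis by (intro exI[of _ 0]) simp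
    next
      case False
      then have "e \<in> edges (y # zs)" using e by simp
      then obtain i where "e = {(y # zs) ! i, (y # zs) ! Suc i}" "Suc i < length (y # zs)"
        using 1 by blast
      then show ?thesis by (intro exI[of _ "Suc i"]) auto
    qed
    then show ?case by blast
  qed auto
qed (use edges_nth in auto)

text \<open>Self-avoiding walks with \<open>m\<close> edges in the complete graph, hence lists of
  \<open>m + 1\<close> vertices; that their edges are present is required separately.\<close>

definition saws :: "nat \<Rightarrow> nat \<Rightarrow> nat list set" where
  "saws n m = {xs. length xs = Suc m \<and> distinct xs \<and> set xs \<subseteq> {..<n}}"

lemma finite_lists: "finite {xs. set xs \<subseteq> {..<n::nat} \<and> length xs = m}"
  by (rule finite_lists_length_eq) simp

lemma finite_saws [simp]: "finite (saws n m)"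
  by (rule finite_subset[OF _ finite_lists[of n "Suc m"]]) (auto simp: saws_def)

lemma card_saws_le: "card (saws n m) \<le> n ^ Suc m"
proof -
  have "card (saws n m) \<le> card {xs. set xs \<subseteq> {..<n} \<and> length xs = Suc m}"
    by (rule card_mono[OF finite_lists]) (auto simp: saws_def)
  then show ?thesis by (simp add: card_lists_length_eq)
qed

text \<open>A Bernoulli-type bound for the falling factorial, proved factor by factor with the loss
  \<open>k\<^sup>2 / n\<close> after \<open>k\<close> factors. For \<open>Suc m > n\<close> the
  right-hand side is not positive.\<close>

lemma card_saws_ge: "real (card (saws n m)) \<ge> real n ^ Suc m * (1 - (real m + 1)\<^sup>2 / real n)" if "n > 0"
proof (cases "Suc m \<le> n")
  case False
  then have "real n \<le> real m + 1" by simp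
  then have "1 * real n \<le> (real m + 1) * (real m + 1)" by (intro mult_mono) (use that in auto)
  then have "1 - (real m + 1)\<^sup>2 / real n \<le> 0" using that by (simp add: field_simps power2_eq_square)
  then have "real n ^ Suc m * (1 - (real m + 1)\<^sup>2 / real n) \<le> 0"
    by (intro mult_nonneg_nonpos) auto
  then show ?thesis by (meson of_nat_0_le_iff order_trans)
next
  case True
  have "card (saws n m) = \<Prod>{n - Suc m + 1..n}"
    unfolding saws_def using card_lists_distinct_length_eq[of "{..<n}" "Suc m"] True
    by (simp add: conj_commute)
  also have "\<Prod>{n - Suc m + 1..n} = (\<Prod>i<Suc m. n - i)"
    by (rule prod.reindex_bij_witness[of _ "\<lambda>i. n - i" "\<lambda>i. n - i"]) (use True in auto)
  finally have c: "real (card (saws n m)) = (\<Prod>i<Suc m. real n - real i)"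
    using True by (simp add: of_nat_diff del: prod.lessThan_Suc)
  have "real n ^ k * (1 - real k * real k / real n) \<le> (\<Prod>i<k. real n - real i)" if "k \<le> n" for k
    using that
  proof (induction k)
    case (Suc k)
    have "real n ^ Suc k * (1 - real (Suc k) * real (Suc k) / real n)
       \<le> real n ^ k * (1 - real k * real k / real n) * (real n - real k)"
    proof -
      have "real n * (1 - real (Suc k) * real (Suc k) / real n) \<le> (1 - real k * real k / real n) * (real n - real k)"
      proof -
        have "(1 - real k * real k / real n) * (real n - real k) = real n - real k * real k - real k + real k * real k * real k / real n"
          using \<open>n > 0\<close> by (simp add: divide_simps) (simp add: algebra_simps)
        moreover have "real n * (1 - real (Suc k) * real (Suc k) / real n) = real n - real (Suc k) * real (Suc k)"
          using \<open>n > 0\<close> by (simp add: field_simps)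
        moreover have "real k * real k * real k / real n \<ge> 0" by simp
        moreover have "real (Suc k) * real (Suc k) = real k * real k + 2 * real k + 1"
          by (simp add: algebra_simps)
        ultimately show ?thesis by linarith
      qed
      then have "real n ^ k * (real n * (1 - real (Suc k) * real (Suc k) / real n)) \<le>
        real n ^ k * ((1 - real k * real k / real n) * (real n - real k))"
        by (intro mult_left_mono) auto
      then show ?thesis by (simp add: mult_ac)
    qed
    also have "\<dots> \<le> (\<Prod>i<k. real n - real i) * (real n - real k)"
      by (intro mult_right_mono) (use Suc in auto)
    finally show ?case by simp
  qed simp
  from this[OF True] show ?thesis unfolding c by (simp add: power2_eq_square add.commute)
qed

context block_model
begin

text \<open>The matrix \<open>W / r\<close>, that is \<open>M\<close>, acting on functions of the
  type: one edge to a fresh neighbour, averaged over its type, with the factor \<open>1 / n\<close>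
  taken out.\<close>

definition type_op :: "(nat \<Rightarrow> real) \<Rightarrow> nat \<Rightarrow> real" where
  "type_op g s = (\<Sum>t<r. W $$ (s, t) / real r * g t)"

lemma type_op_pow_mono:
  assumes "\<And>t. t < r \<Longrightarrow> g t \<le> h t" "s < r"
  shows "(type_op ^^ k) g s \<le> (type_op ^^ k) h s"
  using assms(2)
proof (induction k arbitrary: s)
  case (Suc k)
  then show ?case
    unfolding funpow.simps comp_def type_op_def
    by (intro sum_mono mult_left_mono divide_nonneg_nonneg) (auto intro: W_nonneg)
qed (simp add: assms(1))

lemma type_op_pow_const: "s < r \<Longrightarrow> (type_op ^^ k) (\<lambda>_. c) s = \<alpha> ^ k * c"
proof (induction k arbitrary: s)
  case (Suc k)
  have "(type_op ^^ Suc k) (\<lambda>_. c) s = (\<Sum>t<r. W $$ (s, t)) / real r * (\<alpha> ^ k * c)"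
    using Suc.IH unfolding funpow.simps comp_def type_op_def[of _ s]
    by (simp add: sum_distrib_right sum_divide_distrib)
  then show ?case using row_sum[OF Suc.prems] r_pos by simp
qed simp

lemma type_op_pow_nonneg:
  assumes "\<And>t. t < r \<Longrightarrow> g t \<ge> 0" "s < r" shows "(type_op ^^ k) g s \<ge> 0"
  using type_op_pow_mono[of "\<lambda>_. 0" g s k] type_op_pow_const[of s k 0] assms by simp

lemma wt_fun_upd: "y \<notin> \<Union>H \<Longrightarrow> H \<subseteq> pairs n \<Longrightarrow> wt (\<sigma>(y := t)) H = wt \<sigma> H"
proof -
  assume y: "y \<notin> \<Union>H" and H: "H \<subseteq> pairs n"
  have "q (\<sigma>(y := t)) e = q \<sigma> e" if "e \<in> H" for e
  proof -
    have "{Min e, Max e} = e" using pairs_Min_Max[of e n] that H by blast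
    then have "Min e \<in> e" "Max e \<in> e" by blast+
    then have "Min e \<noteq> y" "Max e \<noteq> y" using that y by blast+
    then show ?thesis by (simp add: q_def)
  qed
  then show ?thesis by (simp add: wt_def)
qed

text \<open>\<open>y\<close> is touched neither by \<open>H\<close> nor by \<open>F\<close>, so its
  type can be resampled; averaging the probability of the new edge against \<open>g\<close> is one
  application of \<open>type_op\<close>.\<close>

lemma ET_attach:
  assumes y: "y < n" "y \<notin> \<Union>H" "y \<noteq> x" and x: "x < n" and H: "H \<subseteq> pairs n"
    and F: "\<And>\<sigma> t. F (\<sigma>(y := t)) = F \<sigma>"
  shows "ET (\<lambda>\<sigma>. F \<sigma> * wt \<sigma> (insert {x, y} H) * g (\<sigma> y)) =
         ET (\<lambda>\<sigma>. F \<sigma> * wt \<sigma> H * type_op g (\<sigma> x)) / real n"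
proof -
  have nin: "{x, y} \<notin> H" using y by auto
  have fin: "finite H" using finite_subset[OF H] by simp
  have "ET (\<lambda>\<sigma>. F \<sigma> * wt \<sigma> (insert {x, y} H) * g (\<sigma> y)) =
     ET (\<lambda>\<sigma>. F \<sigma> * wt \<sigma> H * q \<sigma> {x, y} * g (\<sigma> y))"
    using nin fin by (simp add: wt_def mult_ac)
  also have "\<dots> = ET (\<lambda>\<sigma>. \<Sum>t<r. F \<sigma> * wt \<sigma> H * q (\<sigma>(y := t)) {x, y} * g t / real r)"
    by (subst ET_resample[OF y(1)]) (simp add: F wt_fun_upd[OF y(2) H])
  also have "\<dots> = ET (\<lambda>\<sigma>. 1 / real n * (F \<sigma> * wt \<sigma> H * type_op g (\<sigma> x)))"
  proof (rule ET_cong)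
    fix \<sigma> assume "\<And>v. v < n \<Longrightarrow> \<sigma> v < r"
    then have "q (\<sigma>(y := t)) {x, y} = W $$ (\<sigma> x, t) / real n" if "t < r" for t
      using q_doubleton[of "\<sigma>(y := t)" x y] that x y by simp
    then show "(\<Sum>t<r. F \<sigma> * wt \<sigma> H * q (\<sigma>(y := t)) {x, y} * g t / real r) =
      1 / real n * (F \<sigma> * wt \<sigma> H * type_op g (\<sigma> x))"
      by (simp add: type_op_def sum_distrib_left sum_divide_distrib mult_ac)
  qed
  finally show ?thesis by (simp only: ET_cmult) simp
qed

text \<open>The path is stripped from its far end, each removed vertex turning \<open>g\<close> into
  \<open>type_op g\<close>, until only a function of the type of \<open>x\<close> is left of
  it.\<close>

lemma ET_attach_path:
  assumes x: "x < n" and H: "H \<subseteq> pairs n"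
  shows "distinct ys \<Longrightarrow> x \<notin> set ys \<Longrightarrow> set ys \<subseteq> {..<n} \<Longrightarrow> set ys \<inter> \<Union>H = {} \<Longrightarrow>
    (\<And>y \<sigma> t. y \<in> set ys \<Longrightarrow> F (\<sigma>(y := t)) = F \<sigma>) \<Longrightarrow>
    ET (\<lambda>\<sigma>. F \<sigma> * wt \<sigma> (H \<union> edges (x # ys)) * g (\<sigma> (last (x # ys)))) =
    ET (\<lambda>\<sigma>. F \<sigma> * wt \<sigma> H * (type_op ^^ length ys) g (\<sigma> x)) / real n ^ length ys"
proof (induction ys arbitrary: g rule: rev_induct)
  case (snoc y ys)
  let ?H = "H \<union> edges (x # ys)"
  have Us: "\<Union> (edges (x # ys)) \<subseteq> set (x # ys)" by (rule Union_edges)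
  have "edges (x # ys) \<subseteq> pairs n"
    by (rule edges_subset_pairs) (use snoc x in auto)
  then have H': "?H \<subseteq> pairs n" using H by simp
  have "H \<union> edges (x # ys @ [y]) = insert {last (x # ys), y} ?H"
    using edges_snoc[of "x # ys" y] by simp
  then have "ET (\<lambda>\<sigma>. F \<sigma> * wt \<sigma> (H \<union> edges (x # ys @ [y])) * g (\<sigma> (last (x # ys @ [y])))) =
     ET (\<lambda>\<sigma>. F \<sigma> * wt \<sigma> (insert {last (x # ys), y} ?H) * g (\<sigma> y))" by simp
  also have "\<dots> = ET (\<lambda>\<sigma>. F \<sigma> * wt \<sigma> ?H * type_op g (\<sigma> (last (x # ys)))) / real n"
  proof (rule ET_attach)
    show "y \<notin> \<Union> ?H" using snoc.prems Us by auto
    show "last (x # ys) < n" using snoc.prems x last_in_set[of "x # ys"] by auto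
    show "y \<noteq> last (x # ys)" using snoc.prems last_in_set[of "x # ys"] by auto
    show "F (\<sigma>(y := t)) = F \<sigma>" for \<sigma> t by (rule snoc.prems(5)) simp
    show "y < n" using snoc.prems by simp
  qed (rule H')
  also have "ET (\<lambda>\<sigma>. F \<sigma> * wt \<sigma> ?H * type_op g (\<sigma> (last (x # ys)))) =
      ET (\<lambda>\<sigma>. F \<sigma> * wt \<sigma> H * (type_op ^^ length ys) (type_op g) (\<sigma> x)) / real n ^ length ys"
    by (rule snoc.IH) (use snoc.prems in auto)
  finally show ?case by (simp add: funpow_swap1)
qed simp

text \<open>By \<open>EJ_subset\<close> with \<open>F = 1\<close>, this is the probability that the
  random graph contains \<open>H\<close>.\<close>

definition pr :: "nat set set \<Rightarrow> real" where
  "pr H = ET (\<lambda>\<sigma>. wt \<sigma> H)"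

lemma pr_empty [simp]: "pr {} = 1"
  by (simp add: pr_def wt_def)

text \<open>Equal row sums make constants eigenfunctions of \<open>type_op\<close> for \<alpha>, so
  each fresh vertex costs exactly \<alpha> / n, whatever \<open>H\<close> is.\<close>

lemma pr_attach_path:
  assumes "x < n" "H \<subseteq> pairs n" "distinct ys" "x \<notin> set ys" "set ys \<subseteq> {..<n}" "set ys \<inter> \<Union>H = {}"
  shows "pr (H \<union> edges (x # ys)) = (\<alpha> / real n) ^ length ys * pr H"
proof -
  have "pr (H \<union> edges (x # ys)) =
      ET (\<lambda>\<sigma>. 1 * wt \<sigma> H * (type_op ^^ length ys) (\<lambda>_. 1) (\<sigma> x)) / real n ^ length ys"
    unfolding pr_def
    using ET_attach_path[OF assms(1,2,3,4,5,6), of "\<lambda>_. 1" "\<lambda>_. 1"] by simp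
  also have "ET (\<lambda>\<sigma>. 1 * wt \<sigma> H * (type_op ^^ length ys) (\<lambda>_. 1) (\<sigma> x)) = ET (\<lambda>\<sigma>. \<alpha> ^ length ys * wt \<sigma> H)"
    by (rule ET_cong) (use assms(1) in \<open>simp add: type_op_pow_const\<close>)
  finally show ?thesis by (simp add: ET_cmult pr_def power_divide)
qed

lemma pr_saw:
  assumes "P \<in> saws n m" shows "pr (edges P) = (\<alpha> / real n) ^ m"
proof -
  obtain x ys where P: "P = x # ys" using assms by (cases P) (auto simp: saws_def)
  then show ?thesis using pr_attach_path[of x "{}" ys] assms by (auto simp: saws_def)
qed

text \<open>Both ends of \<open>e\<close> may already be in use, so no type is free to be averaged
  and only the uniform bound on \<open>W\<close> is left. It is applied to the edge that closes a
  cycle.\<close>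

lemma pr_insert_le:
  assumes "e \<in> pairs n" "e \<notin> H" "H \<subseteq> pairs n"
  shows "pr (insert e H) \<le> w / real n * pr H"
proof -
  have fin: "finite H" using finite_subset[OF assms(3)] by simp
  have "pr (insert e H) \<le> ET (\<lambda>\<sigma>. w / real n * wt \<sigma> H)"
    unfolding pr_def
  proof (rule ET_mono)
    fix \<sigma> assume \<sigma>: "\<And>v. v < n \<Longrightarrow> \<sigma> v < r"
    have "wt \<sigma> (insert e H) = q \<sigma> e * wt \<sigma> H" using fin assms by (simp add: wt_def)
    also have "\<dots> \<le> w / real n * wt \<sigma> H"
      by (rule mult_right_mono) (use q_range(2)[OF assms(1) \<sigma>] wt_nonneg[OF assms(3) \<sigma>] in auto)
    finally show "wt \<sigma> (insert e H) \<le> w / real n * wt \<sigma> H" .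
  qed
  then show ?thesis unfolding pr_def by (simp only: ET_cmult)
qed

lemma EJ_sum: "finite A \<Longrightarrow> EJ (\<lambda>\<omega>. \<Sum>c\<in>A. f c \<omega>) = (\<Sum>c\<in>A. EJ (f c))"
  unfolding EJ_def by (rule Bochner_Integration.integral_sum) simp

lemma EJ_add: "EJ (\<lambda>\<omega>. f \<omega> + g \<omega>) = EJ f + EJ g"
  by (simp add: EJ_def)

lemma EJ_diff: "EJ (\<lambda>\<omega>. f \<omega> - g \<omega>) = EJ f - EJ g"
  by (simp add: EJ_def)

lemma EJ_cmult: "EJ (\<lambda>\<omega>. c * f \<omega>) = c * EJ f"
  by (simp add: EJ_def)

lemma EJ_const [simp]: "EJ (\<lambda>_. c) = c"
  by (simp add: EJ_def)

lemma EJ_count: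
  assumes "finite C" "\<And>c. c \<in> C \<Longrightarrow> H c \<subseteq> pairs n"
  shows "EJ (\<lambda>(\<sigma>, E). real (card {c \<in> C. H c \<subseteq> E})) = (\<Sum>c\<in>C. pr (H c))"
proof -
  have "real (card {c \<in> C. H c \<subseteq> E}) = (\<Sum>c\<in>C. 1 * of_bool (H c \<subseteq> E))" for E
    using assms(1) by (simp add: of_bool_def sum.If_cases Int_def)
  then have "EJ (\<lambda>(\<sigma>, E). real (card {c \<in> C. H c \<subseteq> E})) =
     EJ (\<lambda>\<omega>. \<Sum>c\<in>C. (\<lambda>(\<sigma>, E). 1 * of_bool (H c \<subseteq> E)) \<omega>)" by (simp add: case_prod_unfold)
  also have "\<dots> = (\<Sum>c\<in>C. EJ (\<lambda>(\<sigma>, E). 1 * of_bool (H c \<subseteq> E)))"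
    by (rule EJ_sum[OF assms(1)])
  also have "\<dots> = (\<Sum>c\<in>C. pr (H c))"
    by (rule sum.cong[OF refl], subst EJ_subset[where F = "\<lambda>_. 1"]) (auto simp: assms pr_def)
  finally show ?thesis .
qed

text \<open>Configurations of a fixed shape \<open>s\<close> with \<open>k s\<close> fresh vertices besides the first one
  contribute at most \<open>n ^ (k s + 1) * (\<alpha> / n) ^ k s\<close> to the expected number.\<close>

lemma EJ_count_shapes:
  assumes S: "finite S" and C: "\<And>s. s \<in> S \<Longrightarrow> finite (C s)"
    and card_C: "\<And>s. s \<in> S \<Longrightarrow> card (C s) \<le> n ^ Suc (k s)"
    and H: "\<And>s c. s \<in> S \<Longrightarrow> c \<in> C s \<Longrightarrow> H s c \<subseteq> pairs n"
    and prH: "\<And>s c. s \<in> S \<Longrightarrow> c \<in> C s \<Longrightarrow> pr (H s c) \<le> \<kappa> * (\<alpha> / real n) ^ k s"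
    and k: "\<And>s. s \<in> S \<Longrightarrow> k s \<le> N" and \<kappa>: "\<kappa> \<ge> 0"
  shows "EJ (\<lambda>(\<sigma>, E). real (card {(s, c) \<in> Sigma S C. H s c \<subseteq> E})) \<le> real (card S) * \<kappa> * real n * \<alpha> ^ N"
proof -
  have "EJ (\<lambda>(\<sigma>, E). real (card {(s, c) \<in> Sigma S C. H s c \<subseteq> E})) =
     EJ (\<lambda>(\<sigma>, E). real (card {sc \<in> Sigma S C. case_prod H sc \<subseteq> E}))"
    by (rule arg_cong[where f = EJ]) (auto simp: fun_eq_iff intro!: arg_cong[where f = card])
  also have "\<dots> = (\<Sum>sc\<in>Sigma S C. pr (case_prod H sc))"
    by (rule EJ_count) (use S C H in auto)
  also have "\<dots> = (\<Sum>s\<in>S. \<Sum>c\<in>C s. pr (H s c))"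
    by (subst sum.Sigma) (use S C in \<open>auto simp: case_prod_unfold\<close>)
  also have "\<dots> \<le> (\<Sum>s\<in>S. \<kappa> * real n * \<alpha> ^ N)"
  proof (rule sum_mono)
    fix s assume s: "s \<in> S"
    have "(\<Sum>c\<in>C s. pr (H s c)) \<le> (\<Sum>c\<in>C s. \<kappa> * (\<alpha> / real n) ^ k s)"
      by (rule sum_mono) (rule prH[OF s])
    also have "\<dots> = real (card (C s)) * (\<kappa> * (\<alpha> / real n) ^ k s)" by simp
    also have "\<dots> \<le> real (n ^ Suc (k s)) * (\<kappa> * (\<alpha> / real n) ^ k s)"
    proof (rule mult_right_mono)
      show "real (card (C s)) \<le> real (n ^ Suc (k s))"
        using card_C[OF s] by (rule of_nat_mono)
    qed (use \<kappa> \<alpha>_ge in auto)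
    also have "\<dots> = \<kappa> * real n * \<alpha> ^ k s" using n_pos by (simp add: power_divide)
    also have "\<dots> \<le> \<kappa> * real n * \<alpha> ^ N"
      by (intro mult_left_mono power_increasing) (use \<kappa> \<alpha>_ge k[OF s] in auto)
    finally show "(\<Sum>c\<in>C s. pr (H s c)) \<le> \<kappa> * real n * \<alpha> ^ N" .
  qed
  finally show ?thesis by (simp add: mult_ac)
qed

end

section \<open>Rigid paths\<close>


definition path_in :: "nat set set \<Rightarrow> nat list \<Rightarrow> bool" where
  "path_in E xs \<longleftrightarrow> xs \<noteq> [] \<and> distinct xs \<and> edges xs \<subseteq> E"

definition seg :: "'a list \<Rightarrow> nat \<Rightarrow> nat \<Rightarrow> 'a list" where
  "seg P i j = take (Suc j - i) (drop i P)"

lemma length_seg: "i \<le> j \<Longrightarrow> j < length P \<Longrightarrow> length (seg P i j) = Suc j - i"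
  by (auto simp: seg_def)

lemma nth_seg: "i \<le> j \<Longrightarrow> j < length P \<Longrightarrow> k \<le> j - i \<Longrightarrow> seg P i j ! k = P ! (i + k)"
  by (auto simp: seg_def)

lemma nth_in_seg: "i \<le> k \<Longrightarrow> k \<le> j \<Longrightarrow> j < length P \<Longrightarrow> P ! k \<in> set (seg P i j)"
  using nth_seg[of i j P "k - i"] length_seg[of i j P] nth_mem[of "k - i" "seg P i j"] by auto

lemma seg_glue:
  assumes "i \<le> b" "b \<le> j" "j < length P"
  shows "seg P i b @ tl (seg P b j) = seg P i j"
proof (rule nth_equalityI)
  show "length (seg P i b @ tl (seg P b j)) = length (seg P i j)"
    using assms by (simp add: length_seg)
  fix k assume "k < length (seg P i b @ tl (seg P b j))"
  then have "k \<le> j - i" using assms by (simp add: length_seg)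
  then show "(seg P i b @ tl (seg P b j)) ! k = seg P i j ! k"
    using assms
  proof (cases "k < Suc b - i")
    case False
    then have "k \<ge> 1" "Suc (b + (k - (Suc b - i))) = i + k" using assms by linarith+
    then show ?thesis using False assms \<open>k \<le> j - i\<close>
      by (simp add: nth_append length_seg nth_seg nth_tl)
  qed (auto simp: nth_append length_seg nth_seg)
qed

lemma seg_hd_last: "i \<le> j \<Longrightarrow> j < length P \<Longrightarrow> hd (seg P i j) = P ! i \<and> last (seg P i j) = P ! j \<and> seg P i j \<noteq> []"
proof -
  assume a: "i \<le> j" "j < length P"
  then have ne: "seg P i j \<noteq> []" using length_seg[of i j P] by auto
  then show ?thesis using a nth_seg[of i j P 0] nth_seg[of i j P "j - i"] length_seg[of i j P]
    by (auto simp: hd_conv_nth last_conv_nth)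
qed

text \<open>This replaces the requirement that neighbourhoods are trees: a path that is not rigid
  comes with one edge closing a cycle, which costs a factor of order \<open>1 / n\<close>.\<close>

definition rigid :: "nat set set \<Rightarrow> nat \<Rightarrow> nat list \<Rightarrow> bool" where
  "rigid E R P \<longleftrightarrow> (\<forall>i j T. i < j \<longrightarrow> j < length P \<longrightarrow> path_in E T \<longrightarrow> hd T = P ! i \<longrightarrow>
     last T = P ! j \<longrightarrow> length T \<le> Suc R \<longrightarrow> T = seg P i j)"

lemma path_in_appendD:
  assumes "path_in E (T1 @ y # T2)"
  shows "path_in E (T1 @ [y])" "path_in E (y # T2)"
  using assms edges_append[of T1 y T2] by (auto simp: path_in_def)

text \<open>Among all violations of rigidity take one with shortest \<open>T\<close>. If
  \<open>T\<close> met \<open>P\<close> in between, its two halves would be shorter, so each half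
  running forward along \<open>P\<close> would be a segment of \<open>P\<close>. Then either
  \<open>T\<close> is a segment itself or it visits one of its ends twice. Hence \<open>T\<close> is
  an ear, attached to \<open>P\<close> at its two ends only.\<close>

lemma not_rigid_imp_ear:
  assumes E: "E \<subseteq> pairs n" and P: "distinct P" and "\<not> rigid E R P"
  obtains i j ys where "i < j" "j < length P" "distinct ys" "set ys \<inter> set P = {}" "set ys \<subseteq> {..<n}"
    "edges (P ! i # ys @ [P ! j]) \<subseteq> E" "length ys < R" "ys = [] \<longrightarrow> j \<noteq> Suc i"
proof -
  define V where "V = (\<lambda>(i, j, T). i < j \<and> j < length P \<and> path_in E T \<and> hd T = P ! i \<and>
     last T = P ! j \<and> length T \<le> Suc R \<and> T \<noteq> seg P i j)"
  have "\<exists>x. V x" using assms(3) unfolding rigid_def V_def by auto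
  then obtain x where "V x" and min: "\<And>y. V y \<Longrightarrow> length (snd (snd x)) \<le> length (snd (snd y))"
    using ex_has_least_nat[of V _ "\<lambda>x. length (snd (snd x))"] by blast
  obtain i j T where x: "x = (i, j, T)" by (cases x)
  have V: "i < j" "j < length P" "path_in E T" "hd T = P ! i" "last T = P ! j" "length T \<le> Suc R" "T \<noteq> seg P i j"
    using \<open>V x\<close> by (auto simp: V_def x)
  have min': "S = seg P a b" if "a < b" "b < length P" "path_in E S" "hd S = P ! a" "last S = P ! b"
    "length S < length T" for a b S
    using min[of "(a, b, S)"] that V(6) by (force simp: V_def x)
  have ne: "P ! i \<noteq> P ! j" using P V(1,2) by (simp add: nth_eq_iff_index_eq)
  obtain T' where T1: "T = P ! i # T'" using V(3,4) by (cases T) (auto simp: path_in_def)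
  then have "T' \<noteq> []" using V(5) ne by auto
  then obtain ys where T: "T = P ! i # ys @ [P ! j]"
    using V(5) T1 by (metis append_butlast_last_id last_ConsR)
  have dT: "distinct T" and eT: "edges T \<subseteq> E" using V(3) by (auto simp: path_in_def)
  have fresh: "set ys \<inter> set P = {}"
  proof (rule ccontr)
    assume "set ys \<inter> set P \<noteq> {}"
    then obtain y where y: "y \<in> set ys" "y \<in> set P" by auto
    obtain b where b: "b < length P" "P ! b = y" using y(2) by (metis in_set_conv_nth)
    obtain y1 y2 where ys: "ys = y1 @ y # y2" using y(1) by (metis split_list)
    define A where "A = P ! i # y1 @ [y]"
    define B where "B = y # y2 @ [P ! j]"
    have TA: "T = (P ! i # y1) @ y # (y2 @ [P ! j])" using T ys by simp
    have pA: "path_in E A" and pB: "path_in E B"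
      using path_in_appendD[of E "P ! i # y1" y "y2 @ [P ! j]"] V(3) TA by (auto simp: A_def B_def)
    have lens: "length A < length T" "length B < length T" by (simp_all add: TA A_def B_def)
    have bij: "b \<noteq> i" "b \<noteq> j" using dT b TA by auto
    have A: "A = seg P i b" if "i < b"
      by (rule min') (use that b pA lens in \<open>auto simp: A_def\<close>)
    have B: "B = seg P b j" if "b < j"
      by (rule min') (use that b V pB lens in \<open>auto simp: B_def\<close>)
    consider "b < i" | "i < b" "b < j" | "j < b" using bij by linarith
    then show False
    proof cases
      case 1
      then have "P ! i \<in> set B" using B V nth_in_seg[of b i j P] by auto
      then show False using dT by (auto simp: TA B_def)
    next
      case 2
      then have "T = A @ tl B" by (simp add: TA A_def B_def)
      also have "\<dots> = seg P i j" using A B 2 V seg_glue[of i b j P] by simp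
      finally show False using V by simp
    next
      case 3
      then have "P ! j \<in> set A" using A V b nth_in_seg[of i j b P] by auto
      then show False using dT by (auto simp: TA A_def)
    qed
  qed
  show thesis
  proof (rule that[of i j ys])
    \<comment> \<open>An empty ear between consecutive vertices would be an edge of \<open>P\<close>
      itself and close no cycle.\<close>
    show "ys = [] \<longrightarrow> j \<noteq> Suc i"
    proof (intro impI notI)
      assume a: "ys = []" "j = Suc i"
      have "T = seg P i j"
      proof (rule nth_equalityI)
        show "length T = length (seg P i j)" using a V by (simp add: T length_seg)
        fix k assume "k < length T"
        then have "k = 0 \<or> k = 1" using a T by auto
        then show "T ! k = seg P i j ! k" using a V by (auto simp: T nth_seg)
      qed
      then show False using V by simp
    qed
    show "length ys < R" using V(6) T by simp
    have "set T \<subseteq> {..<n}" by (rule set_subset_if_edges) (use eT E T in auto)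
    then show "set ys \<subseteq> {..<n}" using T by auto
  qed (use V fresh dT eT T in auto)
qed

text \<open>A substitute for the ball of radius \<open>R\<close> about \<open>v\<close> being a
  tree. \<open>R\<close> counts edges, whence \<open>Suc R\<close> vertices.\<close>

definition uniq :: "nat set set \<Rightarrow> nat \<Rightarrow> nat \<Rightarrow> bool" where
  "uniq E R v \<longleftrightarrow> (\<forall>P P'. path_in E P \<longrightarrow> path_in E P' \<longrightarrow> hd P = v \<longrightarrow> hd P' = v \<longrightarrow> last P = last P' \<longrightarrow>
     length P \<le> Suc R \<longrightarrow> length P' \<le> Suc R \<longrightarrow> P = P')"

lemma path_in_hd_eq_last: "path_in E P \<Longrightarrow> hd P = last P \<Longrightarrow> length P = 1"
  by (cases P) (auto simp: path_in_def split: if_splits)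

lemma path_in_saws:
  assumes "path_in E P" "E \<subseteq> pairs n" "hd P < n"
  shows "P \<in> saws n (length P - 1)"
proof -
  have "set P \<subseteq> {..<n}"
  proof (cases "length P \<ge> 2")
    case True then show ?thesis using set_subset_if_edges assms by (auto simp: path_in_def)
  next
    case False
    moreover have "length P > 0" using assms(1) by (simp add: path_in_def)
    ultimately have "length P = 1" by linarith
    then show ?thesis using assms by (auto simp: length_Suc_conv)
  qed
  then show ?thesis using assms by (auto simp: saws_def path_in_def)
qed

lemma seg_full: "P \<noteq> [] \<Longrightarrow> seg P 0 (length P - 1) = P"
  by (simp add: seg_def)

text \<open>Of two different paths with the same ends, the second violates the rigidity of the first
  between its first and last position. The first cannot be a single vertex, as then the second would
  be that vertex too.\<close>

lemma not_uniq_imp_not_rigid: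
  assumes E: "E \<subseteq> pairs n" and v: "v < n" and nu: "\<not> uniq E R v"
  obtains m P where "m \<le> R" "P \<in> saws n m" "hd P = v" "edges P \<subseteq> E" "\<not> rigid E R P"
proof -
  obtain P P' where P: "path_in E P" "path_in E P'" "hd P = v" "hd P' = v" "last P = last P'"
    "length P \<le> Suc R" "length P' \<le> Suc R" "P \<noteq> P'"
    using nu unfolding uniq_def by blast
  have ne: "P \<noteq> []" "P' \<noteq> []" using P by (auto simp: path_in_def)
  have len: "length P \<ge> 2"
  proof (rule ccontr)
    assume "\<not> length P \<ge> 2"
    moreover have "length P > 0" using ne by simp
    ultimately have "length P = 1" by linarith
    then have 1: "P = [v]" using P by (auto simp: length_Suc_conv)
    then have "length P' = 1" using path_in_hd_eq_last[OF P(2)] P by simp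
    then have "P' = [v]" using P by (auto simp: length_Suc_conv)
    then show False using 1 P by simp
  qed
  have "\<not> rigid E R P"
  proof
    assume "rigid E R P"
    then have "P' = seg P 0 (length P - 1)"
      using P len ne unfolding rigid_def
      by (elim allE[of _ 0] allE[of _ "length P - 1"] allE[of _ P']) (auto simp: hd_conv_nth last_conv_nth)
    then show False using seg_full[OF ne(1)] P by simp
  qed
  then show thesis
    using that[of "length P - 1" P] path_in_saws[OF P(1) E] P v by (auto simp: path_in_def)
qed

text \<open>Between its first and its last vertex on \<open>P\<close> the path \<open>P'\<close>
  must run along \<open>P\<close>, by rigidity. The union is therefore a tree: \<open>P\<close> with
  two tails. \<open>A\<close> is listed outwards from the shared segment, hence
  \<open>rev A\<close>, and \<open>d\<close> records whether \<open>P'\<close> runs against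
  \<open>P\<close>.\<close>

lemma rigid_intersection:
  assumes P: "distinct P" "length P = Suc m" and rigid: "rigid E m P"
    and P': "path_in E P'" "length P' = Suc m" and meet: "set P \<inter> set P' \<noteq> {}"
  obtains A B i j d where "i \<le> j" "j \<le> m" "length A + (j - i) + length B = m"
    "P' = rev A @ (if d then rev (seg P i j) else seg P i j) @ B"
    "set A \<inter> set P = {}" "set B \<inter> set P = {}" "set A \<inter> set B = {}" "distinct A" "distinct B"
proof -
  obtain X x Y where X: "P' = X @ x # Y" "x \<in> set P" "\<forall>y\<in>set X. y \<notin> set P"
    using split_list_first_prop[of P' "\<lambda>y. y \<in> set P"] meet by auto
  obtain Z z B where Z: "x # Y = Z @ z # B" "z \<in> set P" "\<forall>y\<in>set B. y \<notin> set P"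
    using split_list_last_prop[of "x # Y" "\<lambda>y. y \<in> set P"] X by auto
  define mid where "mid = Z @ [z]"
  have P'eq: "P' = X @ mid @ B" using X Z by (simp add: mid_def)
  have hdmid: "hd mid = x" using Z(1) by (cases Z) (auto simp: mid_def)
  have "path_in E (X @ Z @ z # B)" using P' P'eq by (simp add: mid_def)
  then have "path_in E (X @ mid)" using path_in_appendD(1)[of E "X @ Z" z B] by (simp add: mid_def)
  then have pm: "path_in E mid"
    using path_in_appendD(2)[of E X "hd mid" "tl mid"] by (simp add: mid_def)
  have dist: "distinct P'" using P' by (simp add: path_in_def)
  obtain a where a: "a < length P" "P ! a = x" using X(2) by (metis in_set_conv_nth)
  obtain c where c: "c < length P" "P ! c = z" using Z(2) by (metis in_set_conv_nth)
  have len: "length X + length mid + length B = Suc m" using P' P'eq by simp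
  have key: "\<exists>i j d. i \<le> j \<and> j \<le> m \<and> mid = (if d then rev (seg P i j) else seg P i j)"
  proof -
    consider "a = c" | "a < c" | "c < a" by linarith
    then show ?thesis
    proof cases
      case 1
      have "length mid = 1" by (rule path_in_hd_eq_last[OF pm]) (use hdmid 1 a c in \<open>auto simp: mid_def\<close>)
      then have "mid = [P ! a]" using hdmid a by (cases mid) auto
      moreover have "seg P a a = [P ! a]" using a by (simp add: seg_def take_Suc_conv_app_nth hd_drop_conv_nth take_Suc)
      ultimately show ?thesis using a P by (intro exI[of _ a] exI[of _ a] exI[of _ False]) auto
    next
      case 2
      have "mid = seg P a c"
        using rigid 2 c a pm hdmid len unfolding rigid_def by (auto simp: mid_def)
      then show ?thesis using 2 c P by (intro exI[of _ a] exI[of _ c] exI[of _ False]) auto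
    next
      case 3
      have "path_in E (rev mid)" using pm by (simp add: path_in_def edges_rev)
      moreover have "hd (rev mid) = P ! c" "last (rev mid) = P ! a"
        using hdmid a c by (auto simp: hd_rev last_rev mid_def)
      moreover have "length (rev mid) \<le> Suc m" using len by simp
      ultimately have "rev mid = seg P c a"
        using rigid 3 a unfolding rigid_def by blast
      then have "mid = rev (seg P c a)" by (metis rev_rev_ident)
      then show ?thesis using 3 a P by (intro exI[of _ c] exI[of _ a] exI[of _ True]) auto
    qed
  qed
  then obtain i j d where ijd: "i \<le> j" "j \<le> m" "mid = (if d then rev (seg P i j) else seg P i j)" by blast
  then have "length mid = Suc j - i" using length_seg[of i j P] P by (simp split: if_splits)
  then have 1: "length (rev X) + (j - i) + length B = m" using len ijd by simp
  have 2: "P' = rev (rev X) @ (if d then rev (seg P i j) else seg P i j) @ B" using P'eq ijd by simp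
  show thesis
    by (rule that[OF ijd(1,2) 1 2]) (use X(3) Z(3) dist P'eq in auto)
qed

section \<open>Walks, paths and graph distance\<close>

lemma walk_iff: "(i, j) \<in> {(u, v). {u, v} \<in> E} ^^ k \<longleftrightarrow>
   (\<exists>xs. length xs = Suc k \<and> hd xs = i \<and> last xs = j \<and> edges xs \<subseteq> E)"
proof (induction k arbitrary: j)
  case 0
  show ?case
  proof
    assume "(i, j) \<in> {(u, v). {u, v} \<in> E} ^^ 0"
    then show "\<exists>xs. length xs = Suc 0 \<and> hd xs = i \<and> last xs = j \<and> edges xs \<subseteq> E"
      by (intro exI[of _ "[i]"]) auto
  next
    assume "\<exists>xs. length xs = Suc 0 \<and> hd xs = i \<and> last xs = j \<and> edges xs \<subseteq> E"
    then show "(i, j) \<in> {(u, v). {u, v} \<in> E} ^^ 0" by (auto simp: length_Suc_conv)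
  qed
next
  case (Suc k)
  show ?case
  proof
    assume "(i, j) \<in> {(u, v). {u, v} \<in> E} ^^ Suc k"
    then obtain y where "(i, y) \<in> {(u, v). {u, v} \<in> E} ^^ k" "{y, j} \<in> E" by auto
    then obtain xs where "length xs = Suc k" "hd xs = i" "last xs = y" "edges xs \<subseteq> E" "{y, j} \<in> E"
      using Suc by blast
    then show "\<exists>xs. length xs = Suc (Suc k) \<and> hd xs = i \<and> last xs = j \<and> edges xs \<subseteq> E"
      by (intro exI[of _ "xs @ [j]"]) (cases "xs = []", auto simp: edges_snoc)
  next
    assume "\<exists>xs. length xs = Suc (Suc k) \<and> hd xs = i \<and> last xs = j \<and> edges xs \<subseteq> E"
    then obtain xs where xs: "length xs = Suc (Suc k)" "hd xs = i" "last xs = j" "edges xs \<subseteq> E" by blast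
    define ys where "ys = butlast xs"
    have ys: "xs = ys @ [j]" "length ys = Suc k" using xs by (auto simp: ys_def intro: append_butlast_last_id[symmetric])
    then have "ys \<noteq> []" by auto
    then have "hd ys = i" "edges ys \<subseteq> E" "{last ys, j} \<in> E" using xs ys by (auto simp: edges_snoc)
    then have "(i, last ys) \<in> {(u, v). {u, v} \<in> E} ^^ k" using Suc ys by blast
    then show "(i, j) \<in> {(u, v). {u, v} \<in> E} ^^ Suc k" using \<open>{last ys, j} \<in> E\<close> by auto
  qed
qed

lemma graph_dist_le:
  assumes "edges xs \<subseteq> E" "xs \<noteq> []" "length xs \<le> Suc k"
  shows "graph_dist E (hd xs) (last xs) \<le> enat k"
proof -
  have "graph_dist E (hd xs) (last xs) \<le> enat (length xs - 1)"
    unfolding graph_dist_def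
    by (rule INF_lower) (use assms in \<open>auto simp: walk_iff intro!: exI[of _ xs]\<close>)
  also have "\<dots> \<le> enat k" using assms by (cases xs) auto
  finally show ?thesis .
qed

text \<open>A shortest walk repeats no vertex, since cutting out the loop between two visits would
  shorten it.\<close>

lemma graph_dist_path:
  assumes "graph_dist E i j = enat k"
  obtains xs where "path_in E xs" "length xs = Suc k" "hd xs = i" "last xs = j"
proof -
  let ?A = "enat ` {k. (i, j) \<in> {(u, v). {u, v} \<in> E} ^^ k}"
  have I: "Inf ?A = enat k" using assms by (simp add: graph_dist_def)
  have "?A \<noteq> {}"
  proof
    assume "?A = {}"
    then have "Inf ?A = Inf {}" by (rule arg_cong)
    then show False using I by (simp add: Inf_enat_def)
  qed
  then have "Inf ?A \<in> ?A" unfolding Inf_enat_def by (metis (mono_tags, lifting) LeastI ex_in_conv)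
  then have "(i, j) \<in> {(u, v). {u, v} \<in> E} ^^ k" using I by auto
  then obtain xs where xs: "length xs = Suc k" "hd xs = i" "last xs = j" "edges xs \<subseteq> E"
    using walk_iff by blast
  have "distinct xs"
  proof (rule ccontr)
    assume "\<not> distinct xs"
    then obtain as y bs cs where d: "xs = as @ [y] @ bs @ [y] @ cs" using not_distinct_decomp by blast
    define zs where "zs = as @ y # cs"
    have "edges zs \<subseteq> E"
    proof -
      have "edges (as @ [y]) \<subseteq> E" using xs d edges_append[of as y "bs @ y # cs"] by auto
      moreover have "edges (y # cs) \<subseteq> E" using xs d edges_append[of "as @ y # bs" y cs] by auto
      ultimately show ?thesis using edges_append[of as y cs] by (auto simp: zs_def)
    qed
    moreover have "length zs \<le> Suc (k - 1)" "zs \<noteq> []" "k \<noteq> 0" using xs d by (auto simp: zs_def)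
    moreover have "hd zs = i" "last zs = j" using xs d by (auto simp: zs_def hd_append split: if_splits)
    ultimately show False using graph_dist_le[of zs E "k - 1"] assms by auto
  qed
  moreover have "xs \<noteq> []" using xs by auto
  ultimately show thesis using that xs by (simp add: path_in_def)
qed

lemma graph_dist_commute: "graph_dist E i j = graph_dist E j i"
proof -
  have "(i, j) \<in> {(u, v). {u, v} \<in> E} ^^ k \<longleftrightarrow> (j, i) \<in> {(u, v). {u, v} \<in> E} ^^ k" for i j k
  proof -
    have "(j, i) \<in> {(u, v). {u, v} \<in> E} ^^ k" if "(i, j) \<in> {(u, v). {u, v} \<in> E} ^^ k" for i j
    proof -
      obtain xs where "length xs = Suc k" "hd xs = i" "last xs = j" "edges xs \<subseteq> E"
        using \<open>(i, j) \<in> _\<close> walk_iff by blast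
      then show ?thesis unfolding walk_iff
        by (intro exI[of _ "rev xs"]) (cases "xs = []", auto simp: edges_rev hd_rev last_rev)
    qed
    then show ?thesis by blast
  qed
  then show ?thesis by (simp add: graph_dist_def)
qed

text \<open>A geodesic between the two ends has at most \<open>m\<close> edges, so rigidity makes it
  the whole of \<open>P\<close>.\<close>

lemma rigid_imp_graph_dist:
  assumes P: "path_in E P" "length P = Suc m" "rigid E m P" and "m > 0"
  shows "graph_dist E (hd P) (last P) = enat m"
proof -
  have "P \<noteq> []" using P by auto
  have "graph_dist E (hd P) (last P) \<le> enat m"
    using graph_dist_le[of P E m] P by (auto simp: path_in_def)
  then obtain k where k: "graph_dist E (hd P) (last P) = enat k" "k \<le> m"
    by (cases "graph_dist E (hd P) (last P)") auto
  from k(1) obtain T where T: "path_in E T" "length T = Suc k" "hd T = hd P" "last T = last P"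
    by (rule graph_dist_path)
  have "T = seg P 0 m"
    using P(3) T k \<open>m > 0\<close> P(2) \<open>P \<noteq> []\<close> unfolding rigid_def by (auto simp: hd_conv_nth last_conv_nth)
  then have "T = P" using seg_full[OF \<open>P \<noteq> []\<close>] P(2) by simp
  then show ?thesis using T P k by simp
qed

lemma rigid_unique:
  assumes "path_in E P" "length P = Suc m" "rigid E m P" "m > 0"
    and "path_in E T" "length T = Suc m" "hd T = hd P" "last T = last P"
  shows "T = P"
proof -
  have "P \<noteq> []" using assms by auto
  have "T = seg P 0 m"
    using assms(3)[unfolded rigid_def, rule_format, of 0 m T] assms \<open>P \<noteq> []\<close>
    by (simp add: hd_conv_nth last_conv_nth)
  then show ?thesis using seg_full[OF \<open>P \<noteq> []\<close>] assms by simp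
qed

text \<open>Rigid paths are geodesics determined by their ends, and every pair at distance
  \<open>m\<close> is joined by some path; this squeezes the number of pairs between two path
  counts. \<open>K\<close> is meant for restrictions on the ends, such as their types.\<close>

lemma card_dist_pairs_bounds:
  assumes E: "E \<subseteq> pairs n" and m: "m > 0"
  shows "card {P \<in> saws n m. edges P \<subseteq> E \<and> rigid E m P \<and> K (hd P) (last P)}
      \<le> card {(v, w). v < n \<and> w < n \<and> graph_dist E v w = enat m \<and> K v w}" (is "card ?A \<le> card ?B")
    and "card {(v, w). v < n \<and> w < n \<and> graph_dist E v w = enat m \<and> K v w}
      \<le> card {P \<in> saws n m. edges P \<subseteq> E \<and> K (hd P) (last P)}" (is "card ?B \<le> card ?C")
proof -
  have finB: "finite ?B" by (rule finite_subset[of _ "{..<n} \<times> {..<n}"]) auto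
  have pin: "path_in E P" "length P = Suc m" "hd P < n" "last P < n"
    if "P \<in> saws n m" "edges P \<subseteq> E" for P
  proof -
    have "P \<noteq> []" using that by (auto simp: saws_def)
    then have "hd P \<in> set P" "last P \<in> set P" by auto
    then show "path_in E P" "length P = Suc m" "hd P < n" "last P < n"
      using that by (auto simp: path_in_def saws_def)
  qed
  show "card ?A \<le> card ?B"
  proof (rule card_inj_on_le[OF _ _ finB])
    show "inj_on (\<lambda>P. (hd P, last P)) ?A"
    proof (rule inj_onI)
      fix P T assume a: "P \<in> ?A" "T \<in> ?A" "(hd P, last P) = (hd T, last T)"
      show "P = T" by (rule rigid_unique[of E T m P]) (use a pin m in auto)
    qed
    show "(\<lambda>P. (hd P, last P)) ` ?A \<subseteq> ?B"
      using pin rigid_imp_graph_dist[OF _ _ _ m] by auto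
  qed
  show "card ?B \<le> card ?C"
  proof -
    have "?B \<subseteq> (\<lambda>P. (hd P, last P)) ` ?C"
    proof clarify
      fix v w assume a: "v < n" "w < n" "graph_dist E v w = enat m" "K v w"
      from a(3) obtain xs where xs: "path_in E xs" "length xs = Suc m" "hd xs = v" "last xs = w"
        by (rule graph_dist_path)
      then have "xs \<in> ?C" using path_in_saws[OF xs(1) E] a by (auto simp: path_in_def)
      then show "(v, w) \<in> (\<lambda>P. (hd P, last P)) ` ?C" using xs by force
    qed
    moreover have "finite ?C" by (rule finite_subset[OF _ finite_saws[of n m]]) auto
    ultimately show ?thesis by (rule surj_card_le[rotated])
  qed
qed

text \<open>Cut \<open>P'\<close> at its last vertex on the union of \<open>Ps\<close>. What comes
  before is a path from \<open>v\<close> to a vertex of some \<open>P\<close>, hence a prefix of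
  that \<open>P\<close> by uniqueness, and the tail \<open>A\<close> is fresh. Applied repeatedly,
  this presents several paths from \<open>v\<close> as a growing tree.\<close>

lemma uniq_branch:
  assumes uniq: "uniq E R v" and Ps: "\<And>P. P \<in> Ps \<Longrightarrow> path_in E P \<and> hd P = v \<and> length P \<le> Suc R"
    and ne: "P0 \<in> Ps" and P': "path_in E P'" "hd P' = v" "length P' \<le> Suc R"
  obtains P i A where "P \<in> Ps" "i < length P" "P' = take (Suc i) P @ A" "\<forall>P\<in>Ps. set A \<inter> set P = {}"
proof -
  have "v \<in> set P'" using P' by (metis hd_in_set path_in_def)
  moreover have "v \<in> set P0" using Ps[OF ne] by (metis hd_in_set path_in_def)
  ultimately have "\<exists>x\<in>set P'. x \<in> \<Union> (set ` Ps)" using ne by auto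
  then obtain X y A where X: "P' = X @ y # A" "y \<in> \<Union> (set ` Ps)" "\<forall>z\<in>set A. z \<notin> \<Union> (set ` Ps)"
    using split_list_last_prop[of P' "\<lambda>x. x \<in> \<Union> (set ` Ps)"] by blast
  then obtain P where P: "P \<in> Ps" "y \<in> set P" by auto
  then obtain i where i: "i < length P" "P ! i = y" by (metis in_set_conv_nth)
  note P1 = Ps[OF P(1)]
  have "X @ [y] = take (Suc i) P"
  proof -
    have "path_in E (X @ [y])" using path_in_appendD(1)[of E X y A] P' X by simp
    moreover have "path_in E (take (Suc i) P)"
      using P1 edges_take[of "Suc i" P] by (auto simp: path_in_def)
    moreover have "hd (X @ [y]) = v" using P' X by (cases X) auto
    moreover have "hd (take (Suc i) P) = v" using P1 by auto
    moreover have "last (take (Suc i) P) = y" using i by (simp add: take_Suc_conv_app_nth)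
    moreover have "length (X @ [y]) \<le> Suc R" using P' X by simp
    moreover have "length (take (Suc i) P) \<le> Suc R" using P1 by auto
    ultimately show ?thesis using uniq unfolding uniq_def by (metis last_snoc)
  qed
  then have "P' = take (Suc i) P @ A" using X by simp
  then show thesis using that P i X by blast
qed

text \<open>Let \<open>Q ! b\<close> be the last vertex on \<open>Q\<close> of a geodesic from
  \<open>x\<close> to \<open>w\<close>. As both paths are shortest, the piece from \<open>x\<close>
  to \<open>Q ! b\<close> has exactly \<open>m - b\<close> edges, which leaves
  \<open>l - (m - b) = b + 1\<close> edges to \<open>w\<close>. Following \<open>Q\<close> up to
  \<open>b\<close> and then the rest gives \<open>2 * b + 1\<close> edges, few enough for uniqueness
  up to \<open>2 * l\<close> to apply to the resulting path.\<close>

lemma two_geodesics: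
  assumes uniq: "uniq E (2 * l) v" and l: "l = Suc m"
    and Q: "path_in E Q" "hd Q = v" "last Q = x" "length Q = Suc m" and dvx: "graph_dist E v x = enat m"
    and dxw: "graph_dist E x w = enat l"
  obtains Q1 b where "b \<le> m" "path_in E Q1" "hd Q1 = v" "last Q1 = w" "length Q1 = Suc (2 * b + 1)"
    "take (Suc b) Q1 = take (Suc b) Q"
proof -
  from dxw obtain U where U: "path_in E U" "length U = Suc l" "hd U = x" "last U = w"
    by (rule graph_dist_path)
  have "x \<in> set U" "x \<in> set Q" using U Q unfolding path_in_def by (metis hd_in_set, metis last_in_set)
  then obtain X y Y where X: "U = X @ y # Y" "y \<in> set Q" "\<forall>z\<in>set Y. z \<notin> set Q"
    using split_list_last_prop[of U "\<lambda>x. x \<in> set Q"] by blast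
  obtain b where b: "b < length Q" "Q ! b = y" using X(2) by (metis in_set_conv_nth)
  define Q0 where "Q0 = take (Suc b) Q"
  have lQ0: "length Q0 = Suc b" "last Q0 = y" "hd Q0 = v" "Q0 \<noteq> []" "edges Q0 \<subseteq> E"
    using b Q edges_take[of "Suc b" Q]
    by (auto simp: Q0_def take_Suc_conv_app_nth path_in_def hd_append hd_conv_nth)
  have eU: "edges (X @ [y]) \<subseteq> E" "edges (y # Y) \<subseteq> E"
    using U X edges_append[of X y Y] by (auto simp: path_in_def)
  have lX: "length X + length Y = l" using U X by simp
  have hdX: "hd (X @ [y]) = x" using U X by (cases X) auto
  have lastY: "last (y # Y) = w" using U X by simp
  \<comment> \<open>Otherwise \<open>Q\<close> up to \<open>b\<close>, continued backwards along
    \<open>U\<close>, would lead from \<open>v\<close> to \<open>x\<close> in fewer than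
    \<open>m\<close> edges.\<close>
  have ge: "length X \<ge> m - b"
  proof (rule ccontr)
    assume "\<not> length X \<ge> m - b"
    define T where "T = Q0 @ rev X"
    have "edges T = edges Q0 \<union> edges (rev (X @ [y]))"
      using edges_append_last[OF lQ0(4), of "rev X"] lQ0 by (simp add: T_def)
    then have "edges T \<subseteq> E" using lQ0 eU by (simp add: edges_rev del: rev_append)
    moreover have "hd T = v" using lQ0 by (simp add: T_def)
    moreover have "last T = x" using hdX lQ0 by (cases X) (auto simp: T_def)
    moreover have "length T \<le> Suc (m - 1)" "T \<noteq> []" "m \<noteq> 0"
      using \<open>\<not> length X \<ge> m - b\<close> lQ0 by (auto simp: T_def)
    ultimately show False using graph_dist_le[of T E "m - 1"] dvx by auto
  qed
  have le: "length X \<le> m - b"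
  proof (rule ccontr)
    assume "\<not> length X \<le> m - b"
    define T where "T = rev (drop b Q) @ Y"
    have dQ: "drop b Q \<noteq> []" "hd (drop b Q) = y" "last (drop b Q) = x" "edges (drop b Q) \<subseteq> E"
      using b Q edges_drop[of b Q] by (auto simp: hd_drop_conv_nth path_in_def)
    then have "edges T = edges (drop b Q) \<union> edges (y # Y)"
      using edges_append_last[of "rev (drop b Q)" Y] by (simp add: T_def edges_rev last_rev)
    then have "edges T \<subseteq> E" using dQ eU by simp
    moreover have "hd T = x" using dQ by (simp add: T_def hd_rev)
    moreover have "last T = w" using dQ lastY by (auto simp: T_def last_rev split: if_splits)
    moreover have "length T \<le> Suc (l - 1)" "T \<noteq> []" "l \<noteq> 0"
      using \<open>\<not> length X \<le> m - b\<close> dQ lX Q b l by (auto simp: T_def)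
    ultimately show False using graph_dist_le[of T E "l - 1"] dxw by auto
  qed
  define Q1 where "Q1 = Q0 @ Y"
  have bm: "b \<le> m" using b Q by simp
  have len: "length Q1 = Suc (2 * b + 1)" using ge le lX l bm lQ0 by (simp add: Q1_def)
  have e: "edges Q1 = edges Q0 \<union> edges (y # Y)"
    using edges_append_last[OF lQ0(4), of Y] lQ0 by (simp add: Q1_def)
  have "set Q0 \<subseteq> set Q" by (simp add: Q0_def set_take_subset)
  then have "path_in E Q1"
    using e lQ0 eU X U Q by (auto simp: Q1_def path_in_def Q0_def)
  moreover have "last Q1 = w" using lastY lQ0 by (auto simp: Q1_def split: if_splits)
  moreover have "take (Suc b) Q1 = take (Suc b) Q" using lQ0(1) by (simp add: Q1_def Q0_def)
  moreover have "hd Q1 = v" using lQ0 by (simp add: Q1_def)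
  ultimately show thesis using bm len by (intro that)
qed

section \<open>Moments of path counts\<close>


definition lists_of :: "nat \<Rightarrow> nat \<Rightarrow> nat list set" where
  "lists_of n k = {xs. set xs \<subseteq> {..<n} \<and> length xs = k}"

lemma finite_lists_of [simp]: "finite (lists_of n k)"
  unfolding lists_of_def by (rule finite_lists)

lemma card_lists_of: "card (lists_of n k) = n ^ k"
  unfolding lists_of_def by (simp add: card_lists_length_eq)

lemma finite_subset_prod3:
  "C \<subseteq> saws n m \<times> lists_of n a \<times> lists_of n b \<Longrightarrow> finite C"
  by (erule finite_subset) simp

lemma card_subset_prod3:
  assumes "C \<subseteq> saws n m \<times> lists_of n a \<times> lists_of n b" shows "card C \<le> n ^ Suc (m + a + b)"
proof -
  have "card C \<le> card (saws n m \<times> lists_of n a \<times> lists_of n b)"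
    by (rule card_mono[OF _ assms]) simp
  also have "\<dots> = card (saws n m) * (n ^ a * n ^ b)" by (simp add: card_cartesian_product card_lists_of)
  also have "\<dots> \<le> n ^ Suc m * (n ^ a * n ^ b)" by (rule mult_right_mono[OF card_saws_le]) simp
  finally show ?thesis by (simp add: power_add mult_ac)
qed

context block_model
begin

text \<open>The shape \<open>(i, j, k)\<close> is an ear with \<open>k\<close> interior vertices
  from \<open>P ! i\<close> to \<open>P ! j\<close>. Path and ear have \<open>m + k\<close> vertices
  besides the first, giving at most \<open>n * \<alpha> ^ (m + k)\<close> in expectation; the edge
  closing the cycle contributes \<open>w / n\<close>, so no factor \<open>n\<close>
  survives.\<close>

lemma EJ_not_rigid:
  "EJ (\<lambda>(\<sigma>, E). real (card {P \<in> saws n m. edges P \<subseteq> E \<and> \<not> rigid E R P})) \<le>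
     (real m + 1)\<^sup>2 * real R * w * \<alpha> ^ (m + R)"
proof -
  define S where "S = {(i, j, k). i < j \<and> j \<le> m \<and> k < R}"
  \<comment> \<open>The third component is a dummy, kept empty so that the bounds for triples of
    lists apply.\<close>
  define C :: "nat \<times> nat \<times> nat \<Rightarrow> (nat list \<times> nat list \<times> nat list) set" where
    "C = (\<lambda>(i, j, k). {(P, ys, zs). P \<in> saws n m \<and> ys \<in> lists_of n k \<and> distinct ys \<and> set ys \<inter> set P = {}
       \<and> (ys = [] \<longrightarrow> j \<noteq> Suc i) \<and> zs = []})"
  define H :: "nat \<times> nat \<times> nat \<Rightarrow> nat list \<times> nat list \<times> nat list \<Rightarrow> nat set set" where
    "H = (\<lambda>(i, j, k) (P, ys, zs). insert {last (P ! i # ys), P ! j} (edges P \<union> edges (P ! i # ys)))"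
  have S_sub: "S \<subseteq> {..m} \<times> {..m} \<times> {..<R}" by (auto simp: S_def)
  have finS: "finite S" by (rule finite_subset[OF S_sub]) simp
  have cardS: "real (card S) \<le> (real m + 1)\<^sup>2 * real R"
  proof -
    have "card S \<le> card ({..m} \<times> {..m} \<times> {..<R})" by (rule card_mono[OF _ S_sub]) simp
    then have "card S \<le> Suc m * (Suc m * R)" by (simp add: card_cartesian_product)
    then have "real (card S) \<le> real (Suc m * (Suc m * R))" by (rule of_nat_mono)
    then show ?thesis by (simp add: power2_eq_square algebra_simps)
  qed
  have C_sub: "C (i, j, k) \<subseteq> saws n m \<times> lists_of n k \<times> lists_of n 0" for i j k
    by (auto simp: C_def lists_of_def)
  have Hpr: "H s c \<subseteq> pairs n \<and> pr (H s c) \<le> w / real n * (\<alpha> / real n) ^ (m + snd (snd s))"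
    if "s \<in> S" "c \<in> C s" for s c
  proof -
    obtain i j k where s: "s = (i, j, k)" by (cases s)
    obtain P ys where c: "c = (P, ys, [])" using \<open>c \<in> C s\<close> by (auto simp: C_def s)
    have ij: "i < j" "j \<le> m" using \<open>s \<in> S\<close> by (auto simp: S_def s)
    have P: "P \<in> saws n m" and ys: "set ys \<subseteq> {..<n}" "length ys = k" "distinct ys" "set ys \<inter> set P = {}"
      "ys = [] \<longrightarrow> j \<noteq> Suc i"
      using \<open>c \<in> C s\<close> by (auto simp: C_def s c lists_of_def)
    have dP: "distinct P" "length P = Suc m" "set P \<subseteq> {..<n}" using P by (auto simp: saws_def)
    have nthP: "P ! a \<in> set P" if "a \<le> m" for a using dP that by simp
    have lt: "P ! i < n" "P ! j < n" using nthP[of i] nthP[of j] ij subsetD[OF dP(3)] by auto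
    have PiPj: "P ! i \<noteq> P ! j" using dP ij by (simp add: nth_eq_iff_index_eq)
    have iys: "P ! i \<notin> set ys" using ys(4) nthP[of i] ij by auto
    have jys: "P ! j \<notin> set ys" using ys(4) nthP[of j] ij by auto
    have eP: "edges P \<subseteq> pairs n" by (rule edges_subset_pairs) (use dP in auto)
    have ey: "edges (P ! i # ys) \<subseteq> pairs n"
      by (rule edges_subset_pairs) (use lt ys iys in auto)
    let ?e = "{last (P ! i # ys), P ! j}"
    have e: "?e \<in> pairs n"
    proof (cases "ys = []")
      case False
      then have "last ys \<in> set ys" by simp
      then have "last ys < n" "last ys \<noteq> P ! j" using ys(1) jys by auto
      then show ?thesis using lt False by (simp add: doubleton_in_pairs)
    qed (use lt PiPj in \<open>simp add: doubleton_in_pairs\<close>)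
    \<comment> \<open>The factor \<open>w / n\<close> is gained only if the closing edge is new: it
      is a chord between non-consecutive vertices of \<open>P\<close>, or one of its ends lies on
      the ear and off \<open>P\<close>.\<close>
    have "?e \<notin> edges P \<union> edges (P ! i # ys)"
    proof (cases "ys = []")
      case True
      have "{P ! i, P ! j} \<notin> edges P"
      proof
        assume "{P ! i, P ! j} \<in> edges P"
        then obtain a where "{P ! i, P ! j} = {P ! a, P ! Suc a}" "Suc a < length P"
          by (auto simp: edges_conv_nth)
        then have "i = a \<and> j = Suc a \<or> i = Suc a \<and> j = a"
          using dP ij by (auto simp: doubleton_eq_iff nth_eq_iff_index_eq)
        then show False using ij ys True by auto
      qed
      then show ?thesis using True by simp
    next
      case False
      then have "last (P ! i # ys) \<notin> set P" using ys(4) last_in_set[of ys] by (metis disjoint_iff last_ConsR)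
      then have "?e \<notin> edges P" using Union_edges[of P] by auto
      moreover have "P ! j \<notin> set (P ! i # ys)" using PiPj jys by auto
      then have "?e \<notin> edges (P ! i # ys)" using Union_edges[of "P ! i # ys"] by auto
      ultimately show ?thesis by blast
    qed
    then have "pr (H s c) \<le> w / real n * pr (edges P \<union> edges (P ! i # ys))"
      unfolding H_def s c prod.case by (rule pr_insert_le[OF e]) (use eP ey in auto)
    also have "pr (edges P \<union> edges (P ! i # ys)) = (\<alpha> / real n) ^ k * pr (edges P)"
    proof -
      have "set ys \<inter> \<Union> (edges P) = {}" using ys(4) Union_edges[of P] by blast
      then show ?thesis
        using pr_attach_path[OF lt(1) eP ys(3) iys ys(1)] ys(2) by simp
    qed
    finally show ?thesis using e eP ey
      by (simp add: H_def s c pr_saw[OF P] power_add mult_ac)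
  qed
  have "EJ (\<lambda>(\<sigma>, E). real (card {P \<in> saws n m. edges P \<subseteq> E \<and> \<not> rigid E R P})) \<le>
     EJ (\<lambda>(\<sigma>, E). real (card {(s, c) \<in> Sigma S C. H s c \<subseteq> E}))"
  proof (rule EJ_mono, unfold prod.case, rule of_nat_mono)
    fix E assume E: "E \<subseteq> pairs n"
    let ?Z = "{(s, c) \<in> Sigma S C. H s c \<subseteq> E}"
    have "finite (C s)" for s using finite_subset_prod3[OF C_sub] by (cases s) blast
    then have "finite (Sigma S C)" using finS by simp
    then have fin: "finite ?Z" by (rule finite_subset[rotated]) auto
    have "{P \<in> saws n m. edges P \<subseteq> E \<and> \<not> rigid E R P} \<subseteq> (\<lambda>(s, (P, ys, zs)). P) ` ?Z"
    proof clarify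
      fix P assume P: "P \<in> saws n m" "edges P \<subseteq> E" "\<not> rigid E R P"
      then have "distinct P" by (simp add: saws_def)
      from not_rigid_imp_ear[OF E this P(3)] obtain i j ys where
        ear: "i < j" "j < length P" "distinct ys" "set ys \<inter> set P = {}" "set ys \<subseteq> {..<n}"
         "edges (P ! i # ys @ [P ! j]) \<subseteq> E" "length ys < R" "ys = [] \<longrightarrow> j \<noteq> Suc i" .
      have "edges (P ! i # ys @ [P ! j]) = insert {last (P ! i # ys), P ! j} (edges (P ! i # ys))"
        using edges_snoc[of "P ! i # ys" "P ! j"] by simp
      then have "((i, j, length ys), (P, ys, [])) \<in> ?Z"
        using ear P by (auto simp: S_def C_def H_def lists_of_def saws_def)
      then show "P \<in> (\<lambda>(s, (P, ys, zs)). P) ` ?Z" by force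
    qed
    then show "card {P \<in> saws n m. edges P \<subseteq> E \<and> \<not> rigid E R P} \<le> card ?Z"
      by (rule surj_card_le[OF fin])
  qed
  also have "\<dots> \<le> real (card S) * (w / real n) * real n * \<alpha> ^ (m + R)"
  proof (rule EJ_count_shapes[where k = "\<lambda>s. m + snd (snd s)"])
    fix s assume s: "s \<in> S"
    obtain i j k where [simp]: "s = (i, j, k)" by (cases s)
    show "finite (C s)" using finite_subset_prod3[OF C_sub] by simp
    show "card (C s) \<le> n ^ Suc (m + snd (snd s))" using card_subset_prod3[OF C_sub[of i j k]] by simp
    show "m + snd (snd s) \<le> m + R" using s by (auto simp: S_def)
  qed (use finS Hpr w_nonneg in auto)
  also have "\<dots> = real (card S) * (w * \<alpha> ^ (m + R))" using n_pos by simp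
  also have "\<dots> \<le> (real m + 1)\<^sup>2 * real R * (w * \<alpha> ^ (m + R))"
    by (rule mult_right_mono[OF cardS]) (use w_nonneg \<alpha>_ge in auto)
  finally show ?thesis by (simp add: mult_ac)
qed

text \<open>Rigidity of \<open>P\<close> makes the union of two meeting paths a tree, described by
  the shared segment from \<open>i\<close> to \<open>j\<close>, the direction \<open>d\<close> and
  the length \<open>a\<close> of the first tail. It has at most \<open>2 * m\<close> vertices
  besides the first, hence a single factor \<open>n\<close>, compared with \<open>n\<^sup>2\<close>
  for all pairs of paths.\<close>

lemma EJ_intersecting_pairs:
  "EJ (\<lambda>(\<sigma>, E). real (card {(P, P'). P \<in> saws n m \<and> P' \<in> saws n m \<and> set P \<inter> set P' \<noteq> {} \<and>
      edges P \<subseteq> E \<and> edges P' \<subseteq> E \<and> rigid E m P})) \<le> 2 * (real m + 1) ^ 3 * real n * \<alpha> ^ (2 * m)"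
proof -
  define S :: "(bool \<times> nat \<times> nat \<times> nat) set" where "S = {(d, i, j, a). i \<le> j \<and> j \<le> m \<and> a + (j - i) \<le> m}"
  define C :: "bool \<times> nat \<times> nat \<times> nat \<Rightarrow> (nat list \<times> nat list \<times> nat list) set" where
    "C = (\<lambda>(d, i, j, a). {(P, A, B). P \<in> saws n m \<and> A \<in> lists_of n a \<and> B \<in> lists_of n (m - (j - i) - a) \<and>
       distinct A \<and> distinct B \<and> set A \<inter> set P = {} \<and> set B \<inter> set P = {} \<and> set A \<inter> set B = {}})"
  define H :: "bool \<times> nat \<times> nat \<times> nat \<Rightarrow> nat list \<times> nat list \<times> nat list \<Rightarrow> nat set set" where
    "H = (\<lambda>(d, i, j, a) (P, A, B). edges P \<union> edges (P ! (if d then j else i) # A)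
        \<union> edges (P ! (if d then i else j) # B))"
  define K where "K = (\<lambda>(d::bool, i, j, a). m + a + (m - (j - i) - a))"
  define G :: "(bool \<times> nat \<times> nat \<times> nat) \<times> nat list \<times> nat list \<times> nat list \<Rightarrow> nat list \<times> nat list" where
    "G = (\<lambda>((d, i, j, a), (P, A, B)). (P, rev A @ (if d then rev (seg P i j) else seg P i j) @ B))"
  have S_sub: "S \<subseteq> UNIV \<times> {..m} \<times> {..m} \<times> {..m}" by (auto simp: S_def)
  have finS: "finite S" by (rule finite_subset[OF S_sub]) simp
  have cardS: "real (card S) \<le> 2 * (real m + 1) ^ 3"
  proof -
    have "card S \<le> card ((UNIV :: bool set) \<times> {..m} \<times> {..m} \<times> {..m})" by (rule card_mono[OF _ S_sub]) simp
    then have "card S \<le> 2 * (Suc m * (Suc m * Suc m))" by (simp add: card_cartesian_product)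
    then have "real (card S) \<le> real (2 * (Suc m * (Suc m * Suc m)))" by (rule of_nat_mono)
    then show ?thesis by (simp add: power3_eq_cube algebra_simps)
  qed
  have C_sub: "C (d, i, j, a) \<subseteq> saws n m \<times> lists_of n a \<times> lists_of n (m - (j - i) - a)" for d i j a
    by (auto simp: C_def)
  have Hpr: "H s c \<subseteq> pairs n \<and> pr (H s c) \<le> 1 * (\<alpha> / real n) ^ K s"
    if "s \<in> S" "c \<in> C s" for s c
  proof -
    obtain d i j a where s: "s = (d, i, j, a)" by (cases s)
    obtain P A B where c: "c = (P, A, B)" by (cases c)
    have ij: "i \<le> j" "j \<le> m" using \<open>s \<in> S\<close> by (auto simp: S_def s)
    have P: "P \<in> saws n m" and A: "set A \<subseteq> {..<n}" "length A = a" "distinct A" "set A \<inter> set P = {}"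
      and B: "set B \<subseteq> {..<n}" "length B = m - (j - i) - a" "distinct B" "set B \<inter> set P = {}" "set A \<inter> set B = {}"
      using \<open>c \<in> C s\<close> by (auto simp: C_def s c lists_of_def)
    have dP: "distinct P" "length P = Suc m" "set P \<subseteq> {..<n}" using P by (auto simp: saws_def)
    define x where "x = P ! (if d then j else i)"
    define z where "z = P ! (if d then i else j)"
    have xz: "x \<in> set P" "z \<in> set P" using dP ij by (auto simp: x_def z_def)
    have eP: "edges P \<subseteq> pairs n" by (rule edges_subset_pairs) (use dP in auto)
    have eA: "edges (x # A) \<subseteq> pairs n" by (rule edges_subset_pairs) (use dP A xz in auto)
    have eB: "edges (z # B) \<subseteq> pairs n" by (rule edges_subset_pairs) (use dP B xz in auto)
    have "pr (edges P \<union> edges (x # A) \<union> edges (z # B)) = (\<alpha> / real n) ^ length B * pr (edges P \<union> edges (x # A))"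
      using Union_edges[of P] Union_edges[of "x # A"] xz A B dP eP eA
      by (intro pr_attach_path) auto
    also have "pr (edges P \<union> edges (x # A)) = (\<alpha> / real n) ^ length A * pr (edges P)"
      using Union_edges[of P] xz A dP eP by (intro pr_attach_path) auto
    finally show ?thesis using eP eA eB
      by (simp add: H_def s c K_def x_def z_def pr_saw[OF P] power_add A B mult_ac)
  qed
  have "EJ (\<lambda>(\<sigma>, E). real (card {(P, P'). P \<in> saws n m \<and> P' \<in> saws n m \<and> set P \<inter> set P' \<noteq> {} \<and>
      edges P \<subseteq> E \<and> edges P' \<subseteq> E \<and> rigid E m P})) \<le>
     EJ (\<lambda>(\<sigma>, E). real (card {(s, c) \<in> Sigma S C. H s c \<subseteq> E}))"
  proof (rule EJ_mono, unfold prod.case, rule of_nat_mono)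
    fix E assume E: "E \<subseteq> pairs n"
    let ?Z = "{(s, c) \<in> Sigma S C. H s c \<subseteq> E}"
    let ?L = "{(P, P'). P \<in> saws n m \<and> P' \<in> saws n m \<and> set P \<inter> set P' \<noteq> {} \<and>
      edges P \<subseteq> E \<and> edges P' \<subseteq> E \<and> rigid E m P}"
    have "finite (C s)" for s using finite_subset_prod3[OF C_sub] by (cases s) blast
    then have "finite (Sigma S C)" using finS by simp
    then have fin: "finite ?Z" by (rule finite_subset[rotated]) auto
    have "?L \<subseteq> G ` ?Z"
    proof (rule subsetI, unfold split_paired_all mem_Collect_eq prod.case, elim conjE)
      fix P P' assume P: "P \<in> saws n m" "P' \<in> saws n m" "set P \<inter> set P' \<noteq> {}" "edges P \<subseteq> E"
        "edges P' \<subseteq> E" "rigid E m P"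
      have dP: "distinct P" "length P = Suc m" and P': "path_in E P'" "length P' = Suc m"
        using P by (auto simp: saws_def path_in_def)
      from rigid_intersection[OF dP P(6) P' P(3)] obtain A B i j d where
        AB: "i \<le> j" "j \<le> m" "length A + (j - i) + length B = m"
          "P' = rev A @ (if d then rev (seg P i j) else seg P i j) @ B"
          "set A \<inter> set P = {}" "set B \<inter> set P = {}" "set A \<inter> set B = {}" "distinct A" "distinct B" .
      define mid where "mid = (if d then rev (seg P i j) else seg P i j)"
      have mid: "mid \<noteq> []" "hd mid = P ! (if d then j else i)" "last mid = P ! (if d then i else j)"
        using seg_hd_last[of i j P] AB dP by (auto simp: mid_def hd_rev last_rev)
      have P'eq: "P' = (rev A @ mid) @ B" using AB by (simp add: mid_def)
      have e1: "edges P' = edges (rev A @ mid) \<union> edges (last mid # B)"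
        using edges_append_last[of "rev A @ mid" B] mid P'eq by simp
      have "edges (rev A @ mid) = edges (rev A @ [hd mid]) \<union> edges mid"
        using edges_append[of "rev A" "hd mid" "tl mid"] by (simp only: list.collapse[OF mid(1)])
      moreover have "edges (rev A @ [hd mid]) = edges (hd mid # A)"
        using edges_rev[of "hd mid # A"] by simp
      ultimately have "edges (hd mid # A) \<subseteq> E" "edges (last mid # B) \<subseteq> E"
        using e1 P by auto
      moreover have "set A \<subseteq> {..<n}" "set B \<subseteq> {..<n}" using P(2) P'eq by (auto simp: saws_def)
      moreover have "length B = m - (j - i) - length A" using AB by simp
      ultimately have "((d, i, j, length A), (P, A, B)) \<in> ?Z"
        using AB P mid by (auto simp: S_def C_def H_def lists_of_def)
      moreover have "(P, P') = G ((d, i, j, length A), (P, A, B))"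
        using AB by (simp add: G_def)
      ultimately show "(P, P') \<in> G ` ?Z" by blast
    qed
    then show "card ?L \<le> card ?Z" by (rule surj_card_le[OF fin])
  qed
  also have "\<dots> \<le> real (card S) * 1 * real n * \<alpha> ^ (2 * m)"
  proof (rule EJ_count_shapes[where k = K])
    fix s assume s: "s \<in> S"
    obtain d i j a where [simp]: "s = (d, i, j, a)" by (cases s)
    show "finite (C s)" using finite_subset_prod3[OF C_sub] by simp
    show "card (C s) \<le> n ^ Suc (K s)" using card_subset_prod3[OF C_sub[of d i j a]] by (simp add: K_def)
    show "K s \<le> 2 * m" using s by (auto simp: S_def K_def)
  qed (use finS Hpr in auto)
  also have "\<dots> = real (card S) * (real n * \<alpha> ^ (2 * m))" by simp
  also have "\<dots> \<le> 2 * (real m + 1) ^ 3 * (real n * \<alpha> ^ (2 * m))"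
    by (rule mult_right_mono[OF cardS]) (use \<alpha>_ge in auto)
  finally show ?thesis by (simp add: mult_ac)
qed

text \<open>Both routes from \<open>v\<close> to \<open>w\<close> produce the same path
  \<open>Q\<close>, by uniqueness, and hence the same \<open>b\<close>. The path to \<open>x\<close>
  follows \<open>Q\<close> up to some \<open>i \<ge> b\<close>; the path to \<open>x'\<close> leaves
  \<open>Q\<close> at some \<open>j \<ge> b\<close> if \<open>f\<close> holds and otherwise leaves
  the path to \<open>x\<close> there. This tree has \<open>2 * b + 1 + (m - i) + (m - j)\<close>
  vertices besides \<open>v\<close>, at most \<open>2 * m + 1\<close>.\<close>

lemma EJ_two_step_pairs:
  assumes l: "l = Suc m"
  shows "EJ (\<lambda>(\<sigma>, E). real (card {(v, w, x, x'). v < n \<and> uniq E (2 * l) v \<and> graph_dist E v x = enat m \<and>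
      graph_dist E v x' = enat m \<and> graph_dist E x w = enat l \<and> graph_dist E x' w = enat l}))
    \<le> 2 * (real m + 1) ^ 3 * real n * \<alpha> ^ (2 * m + 1)"
proof -
  define S :: "(bool \<times> nat \<times> nat \<times> nat) set" where
    "S = {(f, b, i, j). b \<le> i \<and> b \<le> j \<and> i \<le> m \<and> j \<le> m \<and> i < 2 * b + 2 \<and> (f \<longrightarrow> j < 2 * b + 2)}"
  define Q2 :: "nat \<Rightarrow> nat list \<Rightarrow> nat list \<Rightarrow> nat list" where "Q2 = (\<lambda>i Q A. take (Suc i) Q @ A)"
  define Pk where "Pk = (\<lambda>f i Q A. if f then Q else Q2 i Q A)"
  define C :: "bool \<times> nat \<times> nat \<times> nat \<Rightarrow> (nat list \<times> nat list \<times> nat list) set" where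
    "C = (\<lambda>(f, b, i, j). {(Q, A, B). Q \<in> saws n (2 * b + 1) \<and> A \<in> lists_of n (m - i) \<and> B \<in> lists_of n (m - j) \<and>
       distinct A \<and> distinct B \<and> set A \<inter> set Q = {} \<and> set B \<inter> set Q = {} \<and> set A \<inter> set B = {}})"
  define H :: "bool \<times> nat \<times> nat \<times> nat \<Rightarrow> nat list \<times> nat list \<times> nat list \<Rightarrow> nat set set" where
    "H = (\<lambda>(f, b, i, j) (Q, A, B). edges Q \<union> edges (Q ! i # A) \<union> edges (Pk f i Q A ! j # B))"
  define K where "K = (\<lambda>(f::bool, b, i, j). 2 * b + 1 + (m - i) + (m - j))"
  define G :: "(bool \<times> nat \<times> nat \<times> nat) \<times> nat list \<times> nat list \<times> nat list \<Rightarrow> nat \<times> nat \<times> nat \<times> nat" where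
    "G = (\<lambda>((f, b, i, j), (Q, A, B)). (hd Q, last Q, last (Q2 i Q A), last (take (Suc j) (Pk f i Q A) @ B)))"
  have S_sub: "S \<subseteq> UNIV \<times> {..m} \<times> {..m} \<times> {..m}" by (auto simp: S_def)
  have finS: "finite S" by (rule finite_subset[OF S_sub]) simp
  have cardS: "real (card S) \<le> 2 * (real m + 1) ^ 3"
  proof -
    have "card S \<le> card ((UNIV :: bool set) \<times> {..m} \<times> {..m} \<times> {..m})" by (rule card_mono[OF _ S_sub]) simp
    then have "card S \<le> 2 * (Suc m * (Suc m * Suc m))" by (simp add: card_cartesian_product)
    then have "real (card S) \<le> real (2 * (Suc m * (Suc m * Suc m)))" by (rule of_nat_mono)
    then show ?thesis by (simp add: power3_eq_cube algebra_simps)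
  qed
  have C_sub: "C (f, b, i, j) \<subseteq> saws n (2 * b + 1) \<times> lists_of n (m - i) \<times> lists_of n (m - j)" for f b i j
    by (auto simp: C_def)
  have Hpr: "H s c \<subseteq> pairs n \<and> pr (H s c) \<le> 1 * (\<alpha> / real n) ^ K s"
    if "s \<in> S" "c \<in> C s" for s c
  proof -
    obtain f b i j where s: "s = (f, b, i, j)" by (cases s)
    obtain Q A B where c: "c = (Q, A, B)" by (cases c)
    have ij: "b \<le> i" "b \<le> j" "i \<le> m" "j \<le> m" "i < 2 * b + 2" "f \<longrightarrow> j < 2 * b + 2"
      using \<open>s \<in> S\<close> by (auto simp: S_def s)
    have Q: "Q \<in> saws n (2 * b + 1)" and A: "set A \<subseteq> {..<n}" "length A = m - i" "distinct A" "set A \<inter> set Q = {}"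
      and B: "set B \<subseteq> {..<n}" "length B = m - j" "distinct B" "set B \<inter> set Q = {}" "set A \<inter> set B = {}"
      using \<open>c \<in> C s\<close> by (auto simp: C_def s c lists_of_def)
    have dQ: "distinct Q" "length Q = 2 * b + 2" "set Q \<subseteq> {..<n}" using Q by (auto simp: saws_def)
    define x where "x = Q ! i"
    define z where "z = Pk f i Q A ! j"
    have x: "x \<in> set Q" using dQ ij by (auto simp: x_def)
    have "j < length (Pk f i Q A)" using ij A dQ by (auto simp: Pk_def Q2_def)
    then have "z \<in> set (Pk f i Q A)" by (simp add: z_def)
    then have z: "z \<in> set Q \<union> set A"
      by (auto simp: Pk_def Q2_def dest: in_set_takeD split: if_splits)
    have zB: "z \<notin> set B" using z B by auto
    have eQ: "edges Q \<subseteq> pairs n" by (rule edges_subset_pairs) (use dQ in auto)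
    have eA: "edges (x # A) \<subseteq> pairs n" by (rule edges_subset_pairs) (use dQ A x in auto)
    have eB: "edges (z # B) \<subseteq> pairs n" by (rule edges_subset_pairs) (use dQ A B z zB in auto)
    have "set B \<inter> \<Union> (edges Q \<union> edges (x # A)) = {}"
      using Union_edges[of Q] Union_edges[of "x # A"] x B by auto
    then have "pr (edges Q \<union> edges (x # A) \<union> edges (z # B)) = (\<alpha> / real n) ^ length B * pr (edges Q \<union> edges (x # A))"
      using z zB A B dQ eQ eA by (intro pr_attach_path) auto
    also have "pr (edges Q \<union> edges (x # A)) = (\<alpha> / real n) ^ length A * pr (edges Q)"
      using Union_edges[of Q] x A dQ eQ by (intro pr_attach_path) auto
    finally show ?thesis using eQ eA eB
      by (simp add: H_def s c K_def x_def[symmetric] z_def[symmetric] pr_saw[OF Q] power_add A B mult_ac)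
  qed
  have "EJ (\<lambda>(\<sigma>, E). real (card {(v, w, x, x'). v < n \<and> uniq E (2 * l) v \<and> graph_dist E v x = enat m \<and>
      graph_dist E v x' = enat m \<and> graph_dist E x w = enat l \<and> graph_dist E x' w = enat l})) \<le>
     EJ (\<lambda>(\<sigma>, E). real (card {(s, c) \<in> Sigma S C. H s c \<subseteq> E}))"
  proof (rule EJ_mono, unfold prod.case, rule of_nat_mono)
    fix E assume E: "E \<subseteq> pairs n"
    let ?Z = "{(s, c) \<in> Sigma S C. H s c \<subseteq> E}"
    let ?L = "{(v, w, x, x'). v < n \<and> uniq E (2 * l) v \<and> graph_dist E v x = enat m \<and>
      graph_dist E v x' = enat m \<and> graph_dist E x w = enat l \<and> graph_dist E x' w = enat l}"
    have "finite (C s)" for s using finite_subset_prod3[OF C_sub] by (cases s) blast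
    then have "finite (Sigma S C)" using finS by simp
    then have fin: "finite ?Z" by (rule finite_subset[rotated]) auto
    have "?L \<subseteq> G ` ?Z"
    proof (rule subsetI, unfold split_paired_all mem_Collect_eq prod.case, elim conjE)
      fix v w x x' assume v: "v < n" and uniq: "uniq E (2 * l) v" and
        d: "graph_dist E v x = enat m" "graph_dist E v x' = enat m"
           "graph_dist E x w = enat l" "graph_dist E x' w = enat l"
      from d(1) obtain R2 where R2: "path_in E R2" "length R2 = Suc m" "hd R2 = v" "last R2 = x"
        by (rule graph_dist_path)
      from d(2) obtain R3 where R3: "path_in E R3" "length R3 = Suc m" "hd R3 = v" "last R3 = x'"
        by (rule graph_dist_path)
      from two_geodesics[OF uniq l R2(1,3,4,2) d(1,3)] obtain Q b where
        Q: "b \<le> m" "path_in E Q" "hd Q = v" "last Q = w" "length Q = Suc (2 * b + 1)"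
          "take (Suc b) Q = take (Suc b) R2" .
      from two_geodesics[OF uniq l R3(1,3,4,2) d(2,4)] obtain Q' b' where
        Q': "b' \<le> m" "path_in E Q'" "hd Q' = v" "last Q' = w" "length Q' = Suc (2 * b' + 1)"
          "take (Suc b') Q' = take (Suc b') R3" .
      \<comment> \<open>Both paths have at most \<open>2 * m + 2 = 2 * l\<close> vertices, within
        the range of uniqueness.\<close>
      have "Q' = Q" using uniq Q Q' l unfolding uniq_def by auto
      then have "b' = b" using Q Q' by simp
      have pref: "take (Suc b) Q = take (Suc b) R3" using Q' \<open>Q' = Q\<close> \<open>b' = b\<close> by simp
      \<comment> \<open>\<open>R\<close> agrees with \<open>Q\<close> up to position
        \<open>b\<close>, so a tail disjoint from \<open>Q\<close> can only begin later.\<close>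
      have fresh_late: "b \<le> i" if "R = take (Suc i) P @ A" "i < length P" "set A \<inter> set Q = {}" "length R = Suc m"
        "take (Suc b) Q = take (Suc b) R" for R P A i
      proof (rule ccontr)
        assume "\<not> b \<le> i"
        then have "R ! b = A ! (b - Suc i)" "b - Suc i < length A" using that Q(1) by (auto simp: nth_append)
        then have "R ! b \<in> set A" by simp
        moreover have "R ! b = Q ! b" using that(5) by (metis lessI nth_take)
        moreover have "Q ! b \<in> set Q" using Q(5) by simp
        ultimately show False using that(3) by auto
      qed
      have Ps: "path_in E P \<and> hd P = v \<and> length P \<le> Suc (2 * l)" if "P \<in> {Q, R2}" for P
        using that Q R2 l by auto
      have len: "length R2 \<le> Suc (2 * l)" "length R3 \<le> Suc (2 * l)" using R2 R3 l by auto
      have Ps1: "path_in E P \<and> hd P = v \<and> length P \<le> Suc (2 * l)" if "P \<in> {Q}" for P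
        using that Ps by simp
      from uniq_branch[OF uniq Ps1 insertI1 R2(1,3) len(1)] obtain P i A where
        "P \<in> {Q}" "i < length P" "R2 = take (Suc i) P @ A" "\<forall>P\<in>{Q}. set A \<inter> set P = {}" .
      then have A: "i < length Q" "R2 = take (Suc i) Q @ A" "set A \<inter> set Q = {}" by simp_all
      from uniq_branch[OF uniq Ps insertI1 R3(1,3) len(2)] obtain P j B where
        P: "P \<in> {Q, R2}" "j < length P" "R3 = take (Suc j) P @ B"
        and fB: "\<forall>P\<in>{Q, R2}. set B \<inter> set P = {}" .
      have B: "P \<in> {Q, R2}" "j < length P" "R3 = take (Suc j) P @ B" "set B \<inter> set Q = {}"
        "set B \<inter> set R2 = {}" using P fB by simp_all
      define f where "f = (P = Q)"
      have R2eq: "Q2 i Q A = R2" by (simp add: Q2_def A)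
      have Pk: "Pk f i Q A = P" using B(1) by (auto simp: Pk_def f_def R2eq)
      have bi: "b \<le> i" by (rule fresh_late[OF A(2,1,3) R2(2) Q(6)])
      have bj: "b \<le> j" by (rule fresh_late[OF B(3,2,4) R3(2) pref])
      have lA: "length A = m - i" "i \<le> m" using R2(2) A by auto
      have lB: "length B = m - j" "j \<le> m" using R3(2) B by auto
      have QS: "Q \<in> saws n (2 * b + 1)" using path_in_saws[OF Q(2) E] Q v by simp
      have "set R2 \<subseteq> {..<n}" "set R3 \<subseteq> {..<n}"
        using path_in_saws[OF R2(1) E] path_in_saws[OF R3(1) E] R2 R3 v by (auto simp: saws_def)
      then have sub: "set A \<subseteq> {..<n}" "set B \<subseteq> {..<n}" using A B by auto
      have dAB: "distinct A" "distinct B" using R2(1) R3(1) A B by (auto simp: path_in_def)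
      have AB: "set A \<inter> set B = {}" using B A(2) by auto
      have e: "edges Q \<subseteq> E" "edges (Q ! i # A) \<subseteq> E" "edges (P ! j # B) \<subseteq> E"
      proof -
        show "edges Q \<subseteq> E" using Q by (simp add: path_in_def)
        show "edges (Q ! i # A) \<subseteq> E"
          using edges_append_last[of "take (Suc i) Q" A] A R2(1) by (auto simp: path_in_def take_Suc_conv_app_nth)
        show "edges (P ! j # B) \<subseteq> E"
          using edges_append_last[of "take (Suc j) P" B] B(2,3) R3(1) by (auto simp: path_in_def take_Suc_conv_app_nth)
      qed
      have "f \<longrightarrow> j < 2 * b + 2" using B(2) Q(5) by (auto simp: f_def)
      then have "(f, b, i, j) \<in> S" using bi bj lA lB A(1) Q(5) by (simp add: S_def)
      moreover have "(Q, A, B) \<in> C (f, b, i, j)"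
        using QS lA lB sub dAB A(3) B(4) AB by (simp add: C_def lists_of_def)
      moreover have "H (f, b, i, j) (Q, A, B) \<subseteq> E" using e by (simp add: H_def Pk)
      moreover have "(v, w, x, x') = G ((f, b, i, j), (Q, A, B))"
        by (simp add: G_def Pk R2eq Q R2 R3 B(3)[symmetric])
      ultimately show "(v, w, x, x') \<in> G ` ?Z" by blast
    qed
    then show "card ?L \<le> card ?Z" by (rule surj_card_le[OF fin])
  qed
  also have "\<dots> \<le> real (card S) * 1 * real n * \<alpha> ^ (2 * m + 1)"
  proof (rule EJ_count_shapes[where k = K])
    fix s assume s: "s \<in> S"
    obtain f b i j where [simp]: "s = (f, b, i, j)" by (cases s)
    show "finite (C s)" using finite_subset_prod3[OF C_sub] by simp
    show "card (C s) \<le> n ^ Suc (K s)" using card_subset_prod3[OF C_sub[of f b i j]] by (simp add: K_def)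
    show "K s \<le> 2 * m + 1" using s by (auto simp: S_def K_def)
  qed (use finS Hpr in auto)
  also have "\<dots> = real (card S) * (real n * \<alpha> ^ (2 * m + 1))" by simp
  also have "\<dots> \<le> 2 * (real m + 1) ^ 3 * (real n * \<alpha> ^ (2 * m + 1))"
    by (rule mult_right_mono[OF cardS]) (use \<alpha>_ge in auto)
  finally show ?thesis by (simp add: mult_ac)
qed

section \<open>Path sums weighted by the types of the two ends\<close>

definition pair_mean :: "(nat \<Rightarrow> real) \<Rightarrow> (nat \<Rightarrow> real) \<Rightarrow> nat \<Rightarrow> real" where
  "pair_mean f g m = (\<Sum>s<r. f s * (type_op ^^ m) g s) / real r"

text \<open>\<open>P\<close> is disjoint from \<open>H\<close>, so the type of its first vertex is
  integrated out as well and the expectation factorises exactly; \<open>pair_mean\<close> is the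
  average over that type of \<open>f\<close> times the \<open>m\<close>-th power of \<open>M\<close>
  applied to \<open>g\<close>. For two disjoint paths it gives the product of the
  expectations.\<close>

lemma ET_fresh_path:
  assumes P: "P \<in> saws n m" and H: "H \<subseteq> pairs n" and fresh: "set P \<inter> \<Union>H = {}"
    and F: "\<And>y \<sigma> t. y \<in> set P \<Longrightarrow> F (\<sigma>(y := t)) = F \<sigma>"
  shows "ET (\<lambda>\<sigma>. F \<sigma> * (f (\<sigma> (hd P)) * g (\<sigma> (last P))) * wt \<sigma> (H \<union> edges P)) =
    ET (\<lambda>\<sigma>. F \<sigma> * wt \<sigma> H) * (pair_mean f g m / real n ^ m)"
proof -
  obtain x ys where xs: "P = x # ys" using P by (cases P) (auto simp: saws_def)
  have x: "x < n" "x \<notin> set ys" "distinct ys" "set ys \<subseteq> {..<n}" "length ys = m" using P by (auto simp: xs saws_def)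
  have "ET (\<lambda>\<sigma>. F \<sigma> * (f (\<sigma> (hd P)) * g (\<sigma> (last P))) * wt \<sigma> (H \<union> edges P)) =
     ET (\<lambda>\<sigma>. (F \<sigma> * f (\<sigma> x)) * wt \<sigma> (H \<union> edges (x # ys)) * g (\<sigma> (last (x # ys))))"
    by (simp add: xs mult_ac)
  also have "\<dots> = ET (\<lambda>\<sigma>. (F \<sigma> * f (\<sigma> x)) * wt \<sigma> H * (type_op ^^ length ys) g (\<sigma> x)) / real n ^ length ys"
  proof (rule ET_attach_path[OF x(1) H x(3,2,4)])
    show "set ys \<inter> \<Union>H = {}" using fresh by (auto simp: xs)
    fix y \<sigma> t assume "y \<in> set ys"
    then show "F (\<sigma>(y := t)) * f ((\<sigma>(y := t)) x) = F \<sigma> * f (\<sigma> x)" using F[of y] x(2) by (auto simp: xs)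
  qed
  also have "ET (\<lambda>\<sigma>. (F \<sigma> * f (\<sigma> x)) * wt \<sigma> H * (type_op ^^ length ys) g (\<sigma> x)) =
     ET (\<lambda>\<sigma>. \<Sum>t<r. F \<sigma> * wt \<sigma> H * (f t * (type_op ^^ m) g t) / real r)"
  proof -
    have "x \<notin> \<Union>H" using fresh by (auto simp: xs)
    then show ?thesis
      by (subst ET_resample[OF x(1)]) (simp add: F[of x] xs wt_fun_upd[OF _ H] x(5) mult_ac)
  qed
  also have "\<dots> = ET (\<lambda>\<sigma>. pair_mean f g m * (F \<sigma> * wt \<sigma> H))"
    by (rule ET_cong) (simp add: pair_mean_def sum_distrib_left sum_divide_distrib mult_ac)
  finally show ?thesis by (simp only: ET_cmult x(5)) (simp add: mult_ac)
qed

definition path_mean :: "(nat \<Rightarrow> real) \<Rightarrow> (nat \<Rightarrow> real) \<Rightarrow> nat \<Rightarrow> real" where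
  "path_mean f g m = real (card (saws n m)) * (pair_mean f g m / real n ^ m)"

definition rigid_sum :: "(nat \<Rightarrow> real) \<Rightarrow> (nat \<Rightarrow> real) \<Rightarrow> nat \<Rightarrow> (nat \<Rightarrow> nat) \<times> nat set set \<Rightarrow> real" where
  "rigid_sum f g m = (\<lambda>(\<sigma>, E). \<Sum>P | P \<in> saws n m \<and> edges P \<subseteq> E \<and> rigid E m P. f (\<sigma> (hd P)) * g (\<sigma> (last P)))"

definition path_sum :: "(nat \<Rightarrow> real) \<Rightarrow> (nat \<Rightarrow> real) \<Rightarrow> nat \<Rightarrow> (nat \<Rightarrow> nat) \<times> nat set set \<Rightarrow> real" where
  "path_sum f g m = (\<lambda>(\<sigma>, E). \<Sum>P | P \<in> saws n m \<and> edges P \<subseteq> E. f (\<sigma> (hd P)) * g (\<sigma> (last P)))"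

lemma saws_edges: "P \<in> saws n m \<Longrightarrow> edges P \<subseteq> pairs n"
  by (rule edges_subset_pairs) (auto simp: saws_def)

lemma EJ_path_sum: "EJ (path_sum f g m) = path_mean f g m"
proof -
  have "path_sum f g m = (\<lambda>\<omega>. \<Sum>P\<in>saws n m. (\<lambda>(\<sigma>, E). f (\<sigma> (hd P)) * g (\<sigma> (last P)) * of_bool (edges P \<subseteq> E)) \<omega>)"
    by (simp add: path_sum_def fun_eq_iff of_bool_def sum.inter_filter[symmetric] if_distrib cong: if_cong)
  then have "EJ (path_sum f g m) = (\<Sum>P\<in>saws n m. EJ (\<lambda>(\<sigma>, E). f (\<sigma> (hd P)) * g (\<sigma> (last P)) * of_bool (edges P \<subseteq> E)))"
    by (simp only: EJ_sum[OF finite_saws])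
  also have "\<dots> = (\<Sum>P\<in>saws n m. pair_mean f g m / real n ^ m)"
  proof (rule sum.cong[OF refl])
    fix P assume P: "P \<in> saws n m"
    have "EJ (\<lambda>(\<sigma>, E). f (\<sigma> (hd P)) * g (\<sigma> (last P)) * of_bool (edges P \<subseteq> E)) =
      ET (\<lambda>\<sigma>. f (\<sigma> (hd P)) * g (\<sigma> (last P)) * wt \<sigma> (edges P))"
      by (rule EJ_subset[OF saws_edges[OF P]])
    also have "\<dots> = pair_mean f g m / real n ^ m"
      using ET_fresh_path[OF P, of "{}" "\<lambda>_. 1" f g] by (simp add: wt_def)
    finally show "EJ (\<lambda>(\<sigma>, E). f (\<sigma> (hd P)) * g (\<sigma> (last P)) * of_bool (edges P \<subseteq> E)) = pair_mean f g m / real n ^ m" .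
  qed
  finally show ?thesis by (simp add: path_mean_def)
qed

text \<open>Only rigid paths are summed because meeting pairs are controlled through the rigidity of
  \<open>P\<close>. Disjoint pairs contribute at most the square of \<open>path_mean\<close>,
  meeting pairs the first error term. The centring is at the mean over all paths, so the expected
  deficit \<open>e\<close> due to non-rigid paths enters through the cross term and gives the
  second.\<close>

lemma rigid_sum_second_moment:
  assumes f: "\<And>s. s < r \<Longrightarrow> 0 \<le> f s \<and> f s \<le> 1" and g: "\<And>s. s < r \<Longrightarrow> 0 \<le> g s \<and> g s \<le> 1"
  shows "EJ (\<lambda>\<omega>. (rigid_sum f g m \<omega> - path_mean f g m)\<^sup>2) \<le>
    2 * (real m + 1) ^ 3 * real n * \<alpha> ^ (2 * m) +
    2 * path_mean f g m * ((real m + 1)\<^sup>2 * real m * w * \<alpha> ^ (2 * m))"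
proof -
  let ?\<mu> = "path_mean f g m"
  let ?c = "pair_mean f g m / real n ^ m"
  define F where "F = (\<lambda>(\<sigma> :: nat \<Rightarrow> nat) P. f (\<sigma> (hd P)) * g (\<sigma> (last P)))"
  define e where "e = (real m + 1)\<^sup>2 * real m * w * \<alpha> ^ (2 * m)"
  have F01: "0 \<le> F \<sigma> P \<and> F \<sigma> P \<le> 1" if "P \<in> saws n m" "\<And>v. v < n \<Longrightarrow> \<sigma> v < r" for \<sigma> P
  proof -
    have "P \<noteq> []" using that(1) by (auto simp: saws_def)
    then have "hd P \<in> set P" "last P \<in> set P" by auto
    then have "hd P < n" "last P < n" using that(1) by (auto simp: saws_def)
    then show ?thesis using f g that(2) by (auto simp: F_def mult_le_one)
  qed
  have pm: "pair_mean f g m \<ge> 0"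
    unfolding pair_mean_def using f g type_op_pow_nonneg
    by (intro divide_nonneg_nonneg sum_nonneg mult_nonneg_nonneg) auto
  then have \<mu>0: "?\<mu> \<ge> 0" by (simp add: path_mean_def)
  have first: "EJ (rigid_sum f g m) \<ge> ?\<mu> - e"
  proof -
    have "EJ (\<lambda>\<omega>. path_sum f g m \<omega> - rigid_sum f g m \<omega>) \<le>
       EJ (\<lambda>(\<sigma>, E). real (card {P \<in> saws n m. edges P \<subseteq> E \<and> \<not> rigid E m P}))"
    proof (rule EJ_mono, unfold prod.case)
      fix \<sigma> E assume \<sigma>: "\<And>v. v < n \<Longrightarrow> \<sigma> v < r"
      let ?A = "{P. P \<in> saws n m \<and> edges P \<subseteq> E \<and> rigid E m P}"
      let ?B = "{P \<in> saws n m. edges P \<subseteq> E \<and> \<not> rigid E m P}"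
      have "{P. P \<in> saws n m \<and> edges P \<subseteq> E} = ?A \<union> ?B" by auto
      then have "path_sum f g m (\<sigma>, E) = rigid_sum f g m (\<sigma>, E) + (\<Sum>P\<in>?B. F \<sigma> P)"
        unfolding path_sum_def rigid_sum_def F_def prod.case
        by (simp only:) (rule sum.union_disjoint, auto)
      also have "(\<Sum>P\<in>?B. F \<sigma> P) \<le> (\<Sum>P\<in>?B. 1)" by (rule sum_mono) (use F01 \<sigma> in auto)
      finally show "path_sum f g m (\<sigma>, E) - rigid_sum f g m (\<sigma>, E) \<le> real (card ?B)" by simp
    qed
    also have "\<dots> \<le> e" using EJ_not_rigid[of m m] by (simp add: e_def mult_2)
    finally show ?thesis by (simp add: EJ_diff EJ_path_sum)
  qed
  have second: "EJ (\<lambda>\<omega>. (rigid_sum f g m \<omega>)\<^sup>2) \<le> ?\<mu>\<^sup>2 + 2 * (real m + 1) ^ 3 * real n * \<alpha> ^ (2 * m)"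
  proof -
    define D where "D = {(P, P'). P \<in> saws n m \<and> P' \<in> saws n m \<and> set P \<inter> set P' = {}}"
    have D_sub: "D \<subseteq> saws n m \<times> saws n m" by (auto simp: D_def)
    have finD: "finite D" by (rule finite_subset[OF D_sub]) simp
    define T where "T = (\<lambda>pp :: nat list \<times> nat list. \<lambda>(\<sigma>, E).
      F \<sigma> (fst pp) * F \<sigma> (snd pp) * of_bool (edges (fst pp) \<union> edges (snd pp) \<subseteq> E))"
    define I where "I = (\<lambda>(\<sigma> :: nat \<Rightarrow> nat, E). real (card {(P, P'). P \<in> saws n m \<and> P' \<in> saws n m \<and>
       set P \<inter> set P' \<noteq> {} \<and> edges P \<subseteq> E \<and> edges P' \<subseteq> E \<and> rigid E m P}))"
    have "EJ (\<lambda>\<omega>. (rigid_sum f g m \<omega>)\<^sup>2) \<le> EJ (\<lambda>\<omega>. (\<Sum>pp\<in>D. T pp \<omega>) + I \<omega>)"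
    proof (rule EJ_mono)
      fix \<sigma> E assume \<sigma>: "\<And>v. v < n \<Longrightarrow> \<sigma> v < r"
      let ?A = "{P. P \<in> saws n m \<and> edges P \<subseteq> E \<and> rigid E m P}"
      let ?J = "{(P, P'). P \<in> saws n m \<and> P' \<in> saws n m \<and>
         set P \<inter> set P' \<noteq> {} \<and> edges P \<subseteq> E \<and> edges P' \<subseteq> E \<and> rigid E m P}"
      have finA: "finite ?A" by (rule finite_subset[OF _ finite_saws[of n m]]) auto
      have finJ: "finite ?J" by (rule finite_subset[of _ "saws n m \<times> saws n m"]) auto
      have FF: "0 \<le> F \<sigma> (fst pp) * F \<sigma> (snd pp) \<and> F \<sigma> (fst pp) * F \<sigma> (snd pp) \<le> 1" if "pp \<in> saws n m \<times> saws n m" for pp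
        using F01[OF _ \<sigma>] that by (auto simp: mult_le_one)
      have "(rigid_sum f g m (\<sigma>, E))\<^sup>2 = (\<Sum>P\<in>?A. F \<sigma> P) * (\<Sum>P\<in>?A. F \<sigma> P)"
        by (simp add: rigid_sum_def F_def power2_eq_square)
      also have "\<dots> = (\<Sum>pp\<in>?A \<times> ?A. F \<sigma> (fst pp) * F \<sigma> (snd pp))"
        by (simp add: sum_product sum.cartesian_product case_prod_unfold)
      also have "\<dots> \<le> (\<Sum>pp\<in>{pp \<in> D. edges (fst pp) \<union> edges (snd pp) \<subseteq> E} \<union> ?J. F \<sigma> (fst pp) * F \<sigma> (snd pp))"
      proof (rule sum_mono2)
        show "finite ({pp \<in> D. edges (fst pp) \<union> edges (snd pp) \<subseteq> E} \<union> ?J)" using finD finJ by simp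
        show "?A \<times> ?A \<subseteq> {pp \<in> D. edges (fst pp) \<union> edges (snd pp) \<subseteq> E} \<union> ?J" by (auto simp: D_def)
      qed (use FF D_sub in blast)
      also have "\<dots> = (\<Sum>pp\<in>{pp \<in> D. edges (fst pp) \<union> edges (snd pp) \<subseteq> E}. F \<sigma> (fst pp) * F \<sigma> (snd pp)) +
          (\<Sum>pp\<in>?J. F \<sigma> (fst pp) * F \<sigma> (snd pp))"
        by (rule sum.union_disjoint) (use finD finJ in \<open>auto simp: D_def\<close>)
      also have "(\<Sum>pp\<in>?J. F \<sigma> (fst pp) * F \<sigma> (snd pp)) \<le> (\<Sum>pp\<in>?J. 1)"
        by (rule sum_mono) (use FF in blast)
      also have "(\<Sum>pp\<in>{pp \<in> D. edges (fst pp) \<union> edges (snd pp) \<subseteq> E}. F \<sigma> (fst pp) * F \<sigma> (snd pp)) =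
          (\<Sum>pp\<in>D. T pp (\<sigma>, E))"
        using finD by (simp add: T_def of_bool_def sum.inter_filter if_distrib cong: if_cong)
      finally show "(rigid_sum f g m (\<sigma>, E))\<^sup>2 \<le> (\<Sum>pp\<in>D. T pp (\<sigma>, E)) + I (\<sigma>, E)" by (simp add: I_def)
    qed
    also have "\<dots> = (\<Sum>pp\<in>D. EJ (T pp)) + EJ I" by (simp add: EJ_add EJ_sum[OF finD])
    also have "EJ I \<le> 2 * (real m + 1) ^ 3 * real n * \<alpha> ^ (2 * m)"
      unfolding I_def by (rule EJ_intersecting_pairs)
    also have "(\<Sum>pp\<in>D. EJ (T pp)) = (\<Sum>pp\<in>D. ?c\<^sup>2)"
    proof (rule sum.cong[OF refl])
      fix pp assume "pp \<in> D"
      then obtain P P' where pp: "pp = (P, P')" "P \<in> saws n m" "P' \<in> saws n m" "set P \<inter> set P' = {}"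
        by (auto simp: D_def)
      have ends: "hd P \<in> set P" "last P \<in> set P" using pp(2) by (auto simp: saws_def hd_in_set last_in_set intro: hd_in_set last_in_set)
      have "EJ (T pp) = ET (\<lambda>\<sigma>. F \<sigma> P * F \<sigma> P' * wt \<sigma> (edges P \<union> edges P'))"
        unfolding T_def pp fst_conv snd_conv by (rule EJ_subset) (use saws_edges pp in auto)
      also have "\<dots> = ET (\<lambda>\<sigma>. F \<sigma> P * wt \<sigma> (edges P)) * ?c"
        unfolding F_def
      proof (rule ET_fresh_path[OF pp(3) saws_edges[OF pp(2)]])
        show "set P' \<inter> \<Union> (edges P) = {}" using Union_edges[of P] pp(4) by auto
        show "f ((\<sigma>(y := t)) (hd P)) * g ((\<sigma>(y := t)) (last P)) = f (\<sigma> (hd P)) * g (\<sigma> (last P))"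
          if "y \<in> set P'" for y \<sigma> t
          using that ends pp(4) by auto
      qed
      also have "ET (\<lambda>\<sigma>. F \<sigma> P * wt \<sigma> (edges P)) = ?c"
        using ET_fresh_path[OF pp(2), of "{}" "\<lambda>_. 1" f g] by (simp add: wt_def F_def)
      finally show "EJ (T pp) = ?c\<^sup>2" by (simp add: power2_eq_square)
    qed
    also have "(\<Sum>pp\<in>D. ?c\<^sup>2) \<le> ?\<mu>\<^sup>2"
    proof -
      have "card D \<le> card (saws n m \<times> saws n m)" by (rule card_mono[OF _ D_sub]) simp
      then have "real (card D) \<le> real (card (saws n m) * card (saws n m))"
        unfolding card_cartesian_product by (rule of_nat_mono)
      then have "real (card D) * ?c\<^sup>2 \<le> real (card (saws n m) * card (saws n m)) * ?c\<^sup>2"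
        by (rule mult_right_mono) simp
      then show ?thesis by (simp add: path_mean_def power2_eq_square mult_ac)
    qed
    finally show ?thesis by simp
  qed
  have "EJ (\<lambda>\<omega>. (rigid_sum f g m \<omega> - ?\<mu>)\<^sup>2) =
    EJ (\<lambda>\<omega>. (rigid_sum f g m \<omega>)\<^sup>2 - (2 * ?\<mu>) * rigid_sum f g m \<omega> + ?\<mu>\<^sup>2)"
    by (simp add: power2_diff algebra_simps)
  also have "\<dots> = EJ (\<lambda>\<omega>. (rigid_sum f g m \<omega>)\<^sup>2) - (2 * ?\<mu>) * EJ (rigid_sum f g m) + ?\<mu>\<^sup>2"
    by (simp only: EJ_add EJ_diff EJ_cmult EJ_const)
  also have "\<dots> \<le> (?\<mu>\<^sup>2 + 2 * (real m + 1) ^ 3 * real n * \<alpha> ^ (2 * m)) - (2 * ?\<mu>) * (?\<mu> - e) + ?\<mu>\<^sup>2"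
    using second mult_left_mono[OF first, of "2 * ?\<mu>"] \<mu>0 by linarith
  also have "\<dots> = 2 * (real m + 1) ^ 3 * real n * \<alpha> ^ (2 * m) + 2 * ?\<mu> * e"
    by (simp add: algebra_simps power2_eq_square)
  finally show ?thesis by (simp add: e_def)
qed

end

section \<open>Symmetric real matrices\<close>


text \<open>Vectors are plain functions of which only the values below \<open>n\<close> count; this
  frees the linear algebra from carrier conditions.\<close>

definition ip :: "nat \<Rightarrow> (nat \<Rightarrow> real) \<Rightarrow> (nat \<Rightarrow> real) \<Rightarrow> real" where
  "ip n f g = (\<Sum>i<n. f i * g i)"

definition mv :: "nat \<Rightarrow> (nat \<Rightarrow> nat \<Rightarrow> real) \<Rightarrow> (nat \<Rightarrow> real) \<Rightarrow> nat \<Rightarrow> real" where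
  "mv n c f i = (\<Sum>j<n. c i j * f j)"

lemma ip_add_right: "ip n f (\<lambda>i. g i + t * h i) = ip n f g + t * ip n f h"
  by (simp add: ip_def sum.distrib sum_distrib_left algebra_simps)

lemma ip_add_self: "ip n (\<lambda>i. f i + t * g i) (\<lambda>i. f i + t * g i) =
    ip n f f + 2 * t * ip n g f + t\<^sup>2 * ip n g g"
  by (simp add: ip_def sum.distrib sum_distrib_left power2_eq_square algebra_simps)

lemma ip_self_nonneg: "ip n f f \<ge> 0"
  by (simp add: ip_def sum_nonneg)

lemma ip_self_eq_0: "ip n f f = 0 \<Longrightarrow> i < n \<Longrightarrow> f i = 0"
  by (simp add: ip_def sum_nonneg_eq_0_iff)

lemma ip_cong: "(\<And>i. i < n \<Longrightarrow> f i = f' i) \<Longrightarrow> (\<And>i. i < n \<Longrightarrow> g i = g' i) \<Longrightarrow> ip n f g = ip n f' g'"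
  by (simp add: ip_def)

lemma ip_Cauchy_Schwarz: "(ip n f g)\<^sup>2 \<le> ip n f f * ip n g g"
  using Cauchy_Schwarz_ineq_sum[of f g "{..<n}"] by (simp add: ip_def power2_eq_square)

lemma mv_add: "mv n c (\<lambda>i. f i + t * g i) i = mv n c f i + t * mv n c g i"
  by (simp add: mv_def sum.distrib sum_distrib_left algebra_simps)

lemma mv_cong: "(\<And>j. j < n \<Longrightarrow> f j = g j) \<Longrightarrow> mv n c f i = mv n c g i"
  by (simp add: mv_def)

lemma ip_mv_sym:
  assumes "\<And>i j. i < n \<Longrightarrow> j < n \<Longrightarrow> c i j = c j i"
  shows "ip n (mv n c f) g = ip n f (mv n c g)"
proof -
  have "ip n (mv n c f) g = (\<Sum>i<n. \<Sum>j<n. c i j * f j * g i)"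
    by (simp add: ip_def mv_def sum_distrib_right)
  also have "\<dots> = (\<Sum>j<n. \<Sum>i<n. c i j * f j * g i)" by (rule sum.swap)
  also have "\<dots> = ip n f (mv n c g)"
    unfolding ip_def mv_def sum_distrib_left
    by (intro sum.cong refl) (simp add: assms mult_ac)
  finally show ?thesis .
qed

text \<open>Coordinates from \<open>n\<close> on are pinned to 0, so the sphere is a closed subset
  of a product of compact sets and Tychonoff's theorem applies.\<close>

lemma compact_unit_sphere:
  "compact {f :: nat \<Rightarrow> real. (\<forall>i\<ge>n. f i = 0) \<and> (\<Sum>i<n. f i * f i) = 1}" (is "compact ?K")
proof -
  define S :: "nat \<Rightarrow> real set" where "S = (\<lambda>i. if i < n then {-1..1} else {0})"
  have "compactin (product_topology (\<lambda>_. euclidean) UNIV) (PiE UNIV S)"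
    by (simp add: compactin_PiE S_def)
  then have comp: "compact (PiE UNIV S)" by (simp add: euclidean_product_topology)
  have cont: "continuous_on UNIV (\<lambda>f :: nat \<Rightarrow> real. \<Sum>i<n. f i * f i)"
    by (intro continuous_on_sum continuous_on_mult continuous_on_product_coordinates)
  have "closed {f :: nat \<Rightarrow> real. (\<Sum>i<n. f i * f i) = 1}"
    using closed_vimage[OF closed_singleton cont, of 1] by (simp add: vimage_def)
  then have "compact (PiE UNIV S \<inter> {f. (\<Sum>i<n. f i * f i) = 1})"
    by (rule compact_Int_closed[OF comp])
  moreover have "PiE UNIV S \<inter> {f. (\<Sum>i<n. f i * f i) = 1} = ?K"
  proof (intro equalityI subsetI)
    fix f assume f: "f \<in> ?K"
    have "f i \<in> S i" for i
    proof (cases "i < n")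
      case True
      have "f i * f i \<le> (\<Sum>i<n. f i * f i)" by (rule member_le_sum) (use True in auto)
      then have "\<bar>f i\<bar>\<^sup>2 \<le> 1\<^sup>2" using f by (simp add: power2_eq_square)
      then have "\<bar>f i\<bar> \<le> 1" by (rule power2_le_imp_le) simp
      then show ?thesis using True by (auto simp: S_def)
    qed (use f in \<open>auto simp: S_def\<close>)
    then show "f \<in> PiE UNIV S \<inter> {f. (\<Sum>i<n. f i * f i) = 1}" using f by auto
  next
    fix f assume f: "f \<in> PiE UNIV S \<inter> {f. (\<Sum>i<n. f i * f i) = 1}"
    then have "f i \<in> S i" for i by auto
    then have "\<forall>i\<ge>n. f i = 0" unfolding S_def by (metis leD singletonD)
    then show "f \<in> ?K" using f by auto
  qed
  ultimately show ?thesis by simp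
qed

text \<open>The minimum \<open>m\<close> of the square of the norm of \<open>(c - \<theta>) x\<close> over the unit sphere is
  an eigenvalue of \<open>(c - \<theta>)\<^sup>2\<close>, so \<open>\<theta> + sqrt m\<close> or \<open>\<theta> - sqrt m\<close> is an eigenvalue of \<open>c\<close>.\<close>

lemma symmetric_near_eigenvalue:
  assumes sym: "\<And>i j. i < n \<Longrightarrow> j < n \<Longrightarrow> c i j = c j i"
    and z: "ip n z z > 0" and \<eta>: "\<eta> \<ge> 0"
    and close: "ip n (\<lambda>i. mv n c z i - \<theta> * z i) (\<lambda>i. mv n c z i - \<theta> * z i) \<le> \<eta>\<^sup>2 * ip n z z"
  obtains lam y i where "\<bar>lam - \<theta>\<bar> \<le> \<eta>" "i < n" "y i \<noteq> 0" "\<And>i. i < n \<Longrightarrow> mv n c y i = lam * y i"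
proof -
  define C where "C = (\<lambda>i j. c i j - (if i = j then \<theta> else 0))"
  define T where "T = mv n C"
  have T: "T f i = mv n c f i - \<theta> * f i" if "i < n" for f i
  proof -
    have "T f i = (\<Sum>j<n. c i j * f j - (if j = i then \<theta> * f i else 0))"
      unfolding T_def mv_def C_def by (rule sum.cong) (auto simp: algebra_simps)
    then show ?thesis using that by (simp add: sum_subtractf mv_def)
  qed
  have Tsym: "ip n (T f) g = ip n f (T g)" for f g
    unfolding T_def by (rule ip_mv_sym) (auto simp: C_def sym)
  define K where "K = {f :: nat \<Rightarrow> real. (\<forall>i\<ge>n. f i = 0) \<and> (\<Sum>i<n. f i * f i) = 1}"
  define q where "q = (\<lambda>f. ip n (T f) (T f))"
  define nrm where "nrm = (\<lambda>f i. if i < n then f i / sqrt (ip n f f) else 0)"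
  have nrm: "nrm f \<in> K" "q f = q (nrm f) * ip n f f" if "ip n f f > 0" for f
  proof -
    have "(\<Sum>i<n. nrm f i * nrm f i) = ip n f f / (sqrt (ip n f f) * sqrt (ip n f f))"
      by (simp add: nrm_def ip_def sum_divide_distrib)
    then show "nrm f \<in> K" using that by (auto simp: K_def nrm_def)
    have "T (nrm f) i = T f i / sqrt (ip n f f)" for i
      by (simp add: T_def mv_def nrm_def sum_divide_distrib)
    then have "q (nrm f) = q f / (sqrt (ip n f f) * sqrt (ip n f f))"
      by (simp add: q_def ip_def sum_divide_distrib)
    then show "q f = q (nrm f) * ip n f f" using that by simp
  qed
  have "continuous_on K q"
    unfolding q_def ip_def T_def mv_def
    by (intro continuous_on_sum continuous_on_mult continuous_on_const
        continuous_on_subset[OF continuous_on_product_coordinates]) auto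
  moreover have "compact K" unfolding K_def by (rule compact_unit_sphere)
  moreover have "K \<noteq> {}" using nrm(1)[OF z] by auto
  ultimately obtain x where x: "x \<in> K" "\<And>f. f \<in> K \<Longrightarrow> q x \<le> q f"
    using continuous_attains_inf[of K q] by auto
  define m where "m = q x"
  have m0: "m \<ge> 0" by (simp add: m_def q_def ip_self_nonneg)
  have xx: "ip n x x = 1" using x by (simp add: K_def ip_def)
  have low: "m * ip n f f \<le> q f" for f
  proof (cases "ip n f f > 0")
    case True
    then show ?thesis using nrm[OF True] x(2)[of "nrm f"] by (simp add: m_def mult_right_mono)
  next
    case False
    then have "ip n f f = 0" using ip_self_nonneg[of n f] by simp
    then show ?thesis by (simp add: q_def ip_self_nonneg)
  qed
  have m\<eta>: "m \<le> \<eta>\<^sup>2"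
  proof -
    have "q z \<le> \<eta>\<^sup>2 * ip n z z"
      using close unfolding q_def by (subst ip_cong[OF T T]) auto
    then have "m * ip n z z \<le> \<eta>\<^sup>2 * ip n z z" using low[of z] by linarith
    then show ?thesis using z by simp
  qed
  \<comment> \<open>The residual of the desired equation \<open>T (T x) = m x\<close>; it also
    serves as the direction in which the minimiser \<open>x\<close> is varied.\<close>
  define d where "d = (\<lambda>i. T (T x) i + (- m) * x i)"
  have dd: "ip n d d = ip n (T d) (T x) - m * ip n d x"
  proof -
    have "ip n d d = ip n d (T (T x)) + (- m) * ip n d x"
      by (subst (2) d_def) (rule ip_add_right)
    then show ?thesis by (simp add: Tsym)
  qed
  have quad: "0 \<le> 2 * t * ip n d d + t\<^sup>2 * (q d - m * ip n d d)" for t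
  proof -
    let ?f = "\<lambda>i. x i + t * d i"
    have Tf: "T ?f = (\<lambda>i. T x i + t * T d i)" by (rule ext) (simp add: T_def mv_add)
    have 1: "q ?f = m + 2 * t * ip n (T d) (T x) + t\<^sup>2 * q d"
      unfolding m_def q_def Tf by (rule ip_add_self)
    have 2: "ip n ?f ?f = 1 + 2 * t * ip n d x + t\<^sup>2 * ip n d d"
      unfolding ip_add_self xx by simp
    have 3: "ip n (T d) (T x) = ip n d d + m * ip n d x" using dd by simp
    show ?thesis using low[of ?f] unfolding 1 2 3 by (simp add: algebra_simps)
  qed
  have d0: "ip n d d = 0"
  proof (rule ccontr)
    assume "ip n d d \<noteq> 0"
    then have s: "ip n d d > 0" using ip_self_nonneg[of n d] by simp
    define b where "b = q d - m * ip n d d"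
    have b: "b \<ge> 0" using low[of d] by (simp add: b_def)
    \<comment> \<open>The minimiser of \<open>2 * t * ip n d d + t\<^sup>2 * b\<close>, with
      \<open>b + 1\<close> for \<open>b\<close> to avoid a zero denominator.\<close>
    define t where "t = - (ip n d d) / (b + 1)"
    have "2 * t * ip n d d + t\<^sup>2 * b = - ((ip n d d)\<^sup>2 * (b + 2) / (b + 1)\<^sup>2)"
      using b by (simp add: t_def power2_eq_square divide_simps) (simp add: algebra_simps)
    also have "\<dots> < 0" using s b by (simp add: zero_less_divide_iff)
    finally show False using quad[of t] by (simp add: b_def)
  qed
  have TT: "T (T x) i = m * x i" if "i < n" for i
    using ip_self_eq_0[OF d0 that] by (simp add: d_def)
  define s where "s = sqrt m"
  have s: "s * s = m" "0 \<le> s" using m0 by (simp_all add: s_def)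
  have s\<eta>: "s \<le> \<eta>" using m\<eta> \<eta> by (simp add: s_def real_le_lsqrt)
  \<comment> \<open>\<open>(T - s) (T + s) x = 0\<close>: either \<open>y = (T + s) x\<close> is an
    eigenvector of \<open>T\<close> for \<open>s\<close>, or it vanishes and \<open>x\<close> is one
    for \<open>- s\<close>.\<close>
  define y where "y = (\<lambda>i. T x i + s * x i)"
  show thesis
  proof (cases "\<exists>i<n. y i \<noteq> 0")
    case True
    then obtain i where i: "i < n" "y i \<noteq> 0" by auto
    have "mv n c y i = (\<theta> + s) * y i" if "i < n" for i
    proof -
      have "T y i = T (T x) i + s * T x i" unfolding y_def T_def by (rule mv_add)
      also have "\<dots> = s * y i" using TT[OF that] s by (simp add: y_def algebra_simps)
      finally show ?thesis using T[OF that, of y] by (simp add: algebra_simps)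
    qed
    then show ?thesis by (rule that[of "\<theta> + s" i y, rotated 3]) (use i s s\<eta> in auto)
  next
    case False
    have "\<exists>i<n. x i \<noteq> 0" using xx unfolding ip_def by (metis (no_types, lifting) lessThan_iff mult_zero_left sum.neutral zero_neq_one)
    then obtain i where i: "i < n" "x i \<noteq> 0" by auto
    have "mv n c x i = (\<theta> - s) * x i" if "i < n" for i
    proof -
      have "T x i + s * x i = 0" using False that by (simp add: y_def)
      then show ?thesis using T[OF that, of x] unfolding left_diff_distrib by linarith
    qed
    then show ?thesis by (rule that[of "\<theta> - s" i x, rotated 3]) (use i s s\<eta> in auto)
  qed
qed

section \<open>Eigenbases and the min-max principle\<close>

lemma underdetermined_system:
  fixes c :: "nat \<Rightarrow> nat \<Rightarrow> real"
  assumes "m < k"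
  shows "\<exists>a. (\<exists>i<k. a i \<noteq> 0) \<and> (\<forall>j<m. (\<Sum>i<k. c j i * a i) = 0)"
proof -
  \<comment> \<open>Padding with zero rows makes the matrix square and, since row \<open>m\<close>
    vanishes, singular.\<close>
  define A where "A = Matrix.mat k k (\<lambda>(j, i). if j < m then c j i else 0)"
  have A: "A \<in> carrier_mat k k" by (simp add: A_def)
  have "A $$ (m, j) = 0" if "j < k" for j using assms that by (simp add: A_def)
  then have "A = mat\<^sub>r k k (\<lambda>i. if i = m then 0\<^sub>v k else row A i)"
    using A by (intro eq_matI) (auto simp: row_def)
  then have "det A = det (mat\<^sub>r k k (\<lambda>i. if i = m then 0\<^sub>v k else row A i))" by (rule arg_cong)
  also have "\<dots> = 0" by (rule det_row_0[OF assms]) (use A in auto)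
  finally obtain v where v: "v \<in> carrier_vec k" "v \<noteq> 0\<^sub>v k" "A *\<^sub>v v = 0\<^sub>v k"
    unfolding det_0_iff_vec_prod_zero[OF A] by blast
  obtain i where i: "i < k" "vec_index v i \<noteq> 0"
  proof -
    have "\<exists>i<k. vec_index v i \<noteq> 0"
    proof (rule ccontr)
      assume "\<not> (\<exists>i<k. vec_index v i \<noteq> 0)"
      then have "v = 0\<^sub>v k" using v(1) by (intro eq_vecI) auto
      then show False using v(2) by simp
    qed
    then show thesis using that by blast
  qed
  have "(\<Sum>i<k. c j i * vec_index v i) = 0" if "j < m" for j
  proof -
    have "vec_index (A *\<^sub>v v) j = (\<Sum>i<k. c j i * vec_index v i)"
      using that assms v(1) by (simp add: A_def scalar_prod_def lessThan_atLeast0)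
    then show ?thesis using v(3) that assms by simp
  qed
  then show ?thesis using i by blast
qed

lemma scalar_prod_ip:
  "y \<in> carrier_vec n \<Longrightarrow> scalar_prod x y = ip n (vec_index x) (vec_index y)"
  by (simp add: scalar_prod_def ip_def lessThan_atLeast0)

lemma mult_mat_vec_mv:
  "A \<in> carrier_mat n n \<Longrightarrow> x \<in> carrier_vec n \<Longrightarrow> i < n \<Longrightarrow>
   vec_index (A *\<^sub>v x) i = mv n (\<lambda>i j. A $$ (i, j)) (vec_index x) i"
  by (simp add: scalar_prod_def mv_def lessThan_atLeast0)

definition orthonormal_system :: "nat \<Rightarrow> (nat \<Rightarrow> nat \<Rightarrow> real) \<Rightarrow> bool" where
  "orthonormal_system n U \<longleftrightarrow> (\<forall>j\<in>{1..n}. \<forall>k\<in>{1..n}. ip n (U j) (U k) = (if j = k then 1 else 0))"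

text \<open>The matrix \<open>A\<close> with rows \<open>U j\<close> satisfies
  \<open>A * transpose_mat A = 1\<close>; being square it also satisfies
  \<open>transpose_mat A * A = 1\<close>, which is completeness of the system.\<close>

lemma orthonormal_Parseval:
  assumes U: "orthonormal_system n U"
  shows "ip n f f = (\<Sum>j=1..n. (ip n f (U j))\<^sup>2)"
proof -
  define A where "A = Matrix.mat n n (\<lambda>(j, i). U (Suc j) i)"
  have A: "A \<in> carrier_mat n n" by (simp add: A_def)
  have AAT: "A * transpose_mat A = 1\<^sub>m n"
  proof (rule eq_matI)
    fix i j assume ij: "i < dim_row (1\<^sub>m n :: real mat)" "j < dim_col (1\<^sub>m n :: real mat)"
    then have "(A * transpose_mat A) $$ (i, j) = ip n (U (Suc i)) (U (Suc j))"
      by (simp add: A_def scalar_prod_def ip_def lessThan_atLeast0)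
    then show "(A * transpose_mat A) $$ (i, j) = 1\<^sub>m n $$ (i, j)"
      using U ij by (simp add: orthonormal_system_def)
  qed (simp_all add: A_def)
  have ATA: "transpose_mat A * A = 1\<^sub>m n"
    by (rule mat_mult_left_right_inverse[OF A _ AAT]) (use A in auto)
  have col: "(\<Sum>j<n. U (Suc j) i * U (Suc j) k) = (if i = k then 1 else 0)" if "i < n" "k < n" for i k
  proof -
    have "(transpose_mat A * A) $$ (i, k) = (\<Sum>j<n. U (Suc j) i * U (Suc j) k)"
      using that by (simp add: A_def scalar_prod_def lessThan_atLeast0)
    then show ?thesis using ATA that by simp
  qed
  have "(\<Sum>j=1..n. (ip n f (U j))\<^sup>2) = (\<Sum>j<n. (ip n f (U (Suc j)))\<^sup>2)"
    by (rule sum.reindex_bij_witness[of _ Suc "\<lambda>j. j - 1"]) auto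
  also have "\<dots> = (\<Sum>j<n. \<Sum>i<n. \<Sum>k<n. f i * f k * (U (Suc j) i * U (Suc j) k))"
    by (simp add: ip_def power2_eq_square sum_product mult_ac)
  also have "\<dots> = (\<Sum>i<n. \<Sum>j<n. \<Sum>k<n. f i * f k * (U (Suc j) i * U (Suc j) k))" by (rule sum.swap)
  also have "\<dots> = (\<Sum>i<n. \<Sum>k<n. \<Sum>j<n. f i * f k * (U (Suc j) i * U (Suc j) k))"
    by (rule sum.cong[OF refl], rule sum.swap)
  also have "\<dots> = (\<Sum>i<n. \<Sum>k<n. f i * f k * (if i = k then 1 else 0))"
    by (intro sum.cong refl) (simp add: sum_distrib_left[symmetric] col)
  also have "\<dots> = ip n f f" by (simp add: ip_def if_distrib cong: if_cong)
  finally show ?thesis ..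
qed

definition eigenbasis_values :: "nat \<Rightarrow> (nat \<Rightarrow> nat \<Rightarrow> real) \<Rightarrow> (nat \<Rightarrow> nat \<Rightarrow> real) \<Rightarrow> (nat \<Rightarrow> real) \<Rightarrow> bool" where
  "eigenbasis_values n c U ev \<longleftrightarrow> orthonormal_system n U \<and>
     (\<forall>k\<in>{1..n}. \<forall>i<n. mv n c (U k) i = ev k * U k i) \<and>
     (\<forall>j k. 1 \<le> j \<and> j \<le> k \<and> k \<le> n \<longrightarrow> \<bar>ev k\<bar> \<le> \<bar>ev j\<bar>)"

lemma ordered_eigenbasisD:
  assumes "ordered_eigenbasis n A u" "A \<in> carrier_mat n n"
  obtains ev where "eigenbasis_values n (\<lambda>i j. A $$ (i, j)) (\<lambda>k. vec_index (u k)) ev"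
    "\<And>k. k \<in> {1..n} \<Longrightarrow> u k \<in> carrier_vec n"
proof -
  obtain ev where ev: "\<forall>k\<in>{1..n}. eigenvector A (u k) (ev k)"
    "\<forall>j k. 1 \<le> j \<and> j \<le> k \<and> k \<le> n \<longrightarrow> \<bar>ev k\<bar> \<le> \<bar>ev j\<bar>"
    and on: "\<forall>j\<in>{1..n}. \<forall>k\<in>{1..n}. scalar_prod (u j) (u k) = (if j = k then 1 else 0)"
    using assms(1) unfolding ordered_eigenbasis_def by blast
  have car: "u k \<in> carrier_vec n" if "k \<in> {1..n}" for k
    using ev(1) that assms(2) by (auto simp: eigenvector_def)
  have "mv n (\<lambda>i j. A $$ (i, j)) (vec_index (u k)) i = ev k * vec_index (u k) i" if "k \<in> {1..n}" "i < n" for k i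
  proof -
    have "A *\<^sub>v u k = ev k \<cdot>\<^sub>v u k" using ev(1) that by (auto simp: eigenvector_def)
    then show ?thesis using mult_mat_vec_mv[OF assms(2) car[OF that(1)] that(2)] car[OF that(1)] that(2) by simp
  qed
  moreover have on': "ip n (vec_index (u j)) (vec_index (u k)) = (if j = k then 1 else 0)"
    if "j \<in> {1..n}" "k \<in> {1..n}" for j k
    using on that scalar_prod_ip[OF car[OF that(2)], of "u j"] by simp
  ultimately have "eigenbasis_values n (\<lambda>i j. A $$ (i, j)) (\<lambda>k. vec_index (u k)) ev"
    using on' ev(2) unfolding eigenbasis_values_def orthonormal_system_def by simp
  then show thesis using that car by blast
qed

lemma eigenbasis_norm_mv:
  assumes sym: "\<And>i j. i < n \<Longrightarrow> j < n \<Longrightarrow> c i j = c j i" and U: "eigenbasis_values n c U ev"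
  shows "ip n (mv n c f) (mv n c f) = (\<Sum>j=1..n. (ev j)\<^sup>2 * (ip n f (U j))\<^sup>2)"
proof -
  have "ip n (mv n c f) (mv n c f) = (\<Sum>j=1..n. (ip n (mv n c f) (U j))\<^sup>2)"
    by (rule orthonormal_Parseval) (use U in \<open>simp add: eigenbasis_values_def\<close>)
  also have "\<dots> = (\<Sum>j=1..n. (ev j)\<^sup>2 * (ip n f (U j))\<^sup>2)"
  proof (rule sum.cong[OF refl])
    fix j assume j: "j \<in> {1..n}"
    have "ip n (mv n c f) (U j) = ip n f (mv n c (U j))" by (rule ip_mv_sym[OF sym])
    also have "\<dots> = ip n f (\<lambda>i. ev j * U j i)"
      by (rule ip_cong) (use U j in \<open>auto simp: eigenbasis_values_def\<close>)
    also have "\<dots> = ev j * ip n f (U j)" by (simp add: ip_def sum_distrib_left mult_ac)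
    finally show "(ip n (mv n c f) (U j))\<^sup>2 = (ev j)\<^sup>2 * (ip n f (U j))\<^sup>2" by (simp add: power_mult_distrib)
  qed
  finally show ?thesis .
qed

lemma eigenbasis_mv_le:
  assumes sym: "\<And>i j. i < n \<Longrightarrow> j < n \<Longrightarrow> c i j = c j i" and U: "eigenbasis_values n c U ev"
    and k: "k \<in> {1..n}" and orth: "\<And>j. 1 \<le> j \<Longrightarrow> j < k \<Longrightarrow> ip n f (U j) = 0"
  shows "ip n (mv n c f) (mv n c f) \<le> (ev k)\<^sup>2 * ip n f f"
proof -
  have "ip n f f = (\<Sum>j=1..n. (ip n f (U j))\<^sup>2)"
    by (rule orthonormal_Parseval) (use U in \<open>simp add: eigenbasis_values_def\<close>)
  then have "(ev k)\<^sup>2 * ip n f f = (\<Sum>j=1..n. (ev k)\<^sup>2 * (ip n f (U j))\<^sup>2)" by (simp add: sum_distrib_left)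
  also have "\<dots> \<ge> (\<Sum>j=1..n. (ev j)\<^sup>2 * (ip n f (U j))\<^sup>2)"
  proof (rule sum_mono)
    fix j assume j: "j \<in> {1..n}"
    show "(ev j)\<^sup>2 * (ip n f (U j))\<^sup>2 \<le> (ev k)\<^sup>2 * (ip n f (U j))\<^sup>2"
    proof (cases "j < k")
      case False
      then have "\<bar>ev j\<bar> \<le> \<bar>ev k\<bar>" using U k j by (auto simp: eigenbasis_values_def)
      then show ?thesis by (intro mult_right_mono) (auto simp: abs_le_square_iff)
    qed (use orth j in auto)
  qed
  finally show ?thesis by (simp add: eigenbasis_norm_mv[OF sym U])
qed

lemma eigenbasis_mv_ge:
  assumes sym: "\<And>i j. i < n \<Longrightarrow> j < n \<Longrightarrow> c i j = c j i" and U: "eigenbasis_values n c U ev"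
    and k: "k \<in> {1..n}" and orth: "\<And>j. k < j \<Longrightarrow> j \<le> n \<Longrightarrow> ip n f (U j) = 0"
  shows "ip n (mv n c f) (mv n c f) \<ge> (ev k)\<^sup>2 * ip n f f"
proof -
  have "ip n f f = (\<Sum>j=1..n. (ip n f (U j))\<^sup>2)"
    by (rule orthonormal_Parseval) (use U in \<open>simp add: eigenbasis_values_def\<close>)
  then have "(ev k)\<^sup>2 * ip n f f = (\<Sum>j=1..n. (ev k)\<^sup>2 * (ip n f (U j))\<^sup>2)" by (simp add: sum_distrib_left)
  also have "\<dots> \<le> (\<Sum>j=1..n. (ev j)\<^sup>2 * (ip n f (U j))\<^sup>2)"
  proof (rule sum_mono)
    fix j assume j: "j \<in> {1..n}"
    show "(ev k)\<^sup>2 * (ip n f (U j))\<^sup>2 \<le> (ev j)\<^sup>2 * (ip n f (U j))\<^sup>2"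
    proof (cases "k < j")
      case False
      then have "\<bar>ev k\<bar> \<le> \<bar>ev j\<bar>" using U k j by (auto simp: eigenbasis_values_def)
      then show ?thesis by (intro mult_right_mono) (auto simp: abs_le_square_iff)
    qed (use orth j in auto)
  qed
  finally show ?thesis by (simp add: eigenbasis_norm_mv[OF sym U])
qed

lemma ip_sum_left: "ip n (\<lambda>x. \<Sum>i<k. a i * F i x) g = (\<Sum>i<k. a i * ip n (F i) g)"
proof -
  have "ip n (\<lambda>x. \<Sum>i<k. a i * F i x) g = (\<Sum>x<n. \<Sum>i<k. a i * (F i x * g x))"
    unfolding ip_def by (simp add: sum_distrib_right mult.assoc)
  also have "\<dots> = (\<Sum>i<k. \<Sum>x<n. a i * (F i x * g x))" by (rule sum.swap)
  finally show ?thesis by (simp add: ip_def sum_distrib_left)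
qed

text \<open>Courant-Fischer for the square of \<open>c\<close>: the span of the first
  \<open>k\<close> vectors of \<open>U\<close> contains a nonzero \<open>f\<close> orthogonal to the
  first \<open>k - 1\<close> of \<open>V\<close>. With the roles exchanged it shows that the
  absolute eigenvalues do not depend on the basis.\<close>

lemma eigenbasis_abs_values_le:
  assumes sym: "\<And>i j. i < n \<Longrightarrow> j < n \<Longrightarrow> c i j = c j i"
    and U: "eigenbasis_values n c U ev" and V: "eigenbasis_values n c V ev'" and k: "k \<in> {1..n}"
  shows "\<bar>ev k\<bar> \<le> \<bar>ev' k\<bar>"
proof -
  have "k - 1 < k" using k by simp
  then obtain a i where a: "i < k" "a i \<noteq> 0"
    "\<forall>j<k - 1. (\<Sum>i<k. ip n (U (Suc i)) (V (Suc j)) * a i) = 0"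
    using underdetermined_system[where c = "\<lambda>j i. ip n (U (Suc i)) (V (Suc j))"] by metis
  define f where "f = (\<lambda>x. \<Sum>i<k. a i * U (Suc i) x)"
  have on: "ip n (U i) (U j) = (if i = j then 1 else 0)" if "i \<in> {1..n}" "j \<in> {1..n}" for i j
    using U that by (auto simp: eigenbasis_values_def orthonormal_system_def)
  have V0: "ip n f (V j) = 0" if "1 \<le> j" "j < k" for j
    using a(3)[rule_format, of "j - 1"] that by (simp add: f_def ip_sum_left mult.commute)
  have U0: "ip n f (U j) = 0" if "k < j" "j \<le> n" for j
    unfolding f_def ip_sum_left using that k by (intro sum.neutral) (auto simp: on)
  have "ip n f (U (Suc i)) = (\<Sum>j<k. if j = i then a i else 0)"
    unfolding f_def ip_sum_left using a(1) k by (intro sum.cong) (auto simp: on)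
  then have "ip n f (U (Suc i)) = a i" using a(1) by simp
  then have "0 < (ip n f (U (Suc i)))\<^sup>2" using a(2) by simp
  also have "\<dots> \<le> ip n f f * ip n (U (Suc i)) (U (Suc i))" by (rule ip_Cauchy_Schwarz)
  also have "ip n (U (Suc i)) (U (Suc i)) = 1" using a(1) k by (simp add: on)
  finally have pos: "ip n f f > 0" by simp
  have "(ev k)\<^sup>2 * ip n f f \<le> ip n (mv n c f) (mv n c f)" by (rule eigenbasis_mv_ge[OF sym U k U0])
  also have "\<dots> \<le> (ev' k)\<^sup>2 * ip n f f" by (rule eigenbasis_mv_le[OF sym V k V0])
  finally show ?thesis using pos by (simp add: abs_le_square_iff)
qed

text \<open>Some nontrivial combination of the \<open>k\<close> test vectors is orthogonal to the
  first \<open>k - 1\<close> eigenvectors, and there \<open>c\<close> stretches by at most the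
  \<open>k\<close>-th absolute value. Since \<open>big\<close> assumes only a nonzero coefficient,
  its positivity clause includes linear independence of the \<open>F i\<close>.\<close>

lemma eigenbasis_value_ge:
  assumes sym: "\<And>i j. i < n \<Longrightarrow> j < n \<Longrightarrow> c i j = c j i" and U: "eigenbasis_values n c U ev"
    and k: "k \<in> {1..n}" and t: "t \<ge> 0"
    and big: "\<And>a i. i < k \<Longrightarrow> a i \<noteq> 0 \<Longrightarrow>
      ip n (\<lambda>x. \<Sum>i<k. a i * F i x) (\<lambda>x. \<Sum>i<k. a i * F i x) > 0 \<and>
      t\<^sup>2 * ip n (\<lambda>x. \<Sum>i<k. a i * F i x) (\<lambda>x. \<Sum>i<k. a i * F i x) \<le>
      ip n (mv n c (\<lambda>x. \<Sum>i<k. a i * F i x)) (mv n c (\<lambda>x. \<Sum>i<k. a i * F i x))"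
  shows "t \<le> \<bar>ev k\<bar>"
proof -
  have "k - 1 < k" using k by simp
  then obtain a i where a: "i < k" "a i \<noteq> 0"
    "\<forall>j<k - 1. (\<Sum>i<k. ip n (F i) (U (Suc j)) * a i) = 0"
    using underdetermined_system[where c = "\<lambda>j i. ip n (F i) (U (Suc j))"] by metis
  define f where "f = (\<lambda>x. \<Sum>i<k. a i * F i x)"
  have U0: "ip n f (U j) = 0" if "1 \<le> j" "j < k" for j
    using a(3)[rule_format, of "j - 1"] that by (simp add: f_def ip_sum_left mult.commute)
  have f: "ip n f f > 0" "t\<^sup>2 * ip n f f \<le> ip n (mv n c f) (mv n c f)"
    using big[of i a, OF a(1,2)] by (simp_all add: f_def)
  note f(2)
  also have "ip n (mv n c f) (mv n c f) \<le> (ev k)\<^sup>2 * ip n f f" by (rule eigenbasis_mv_le[OF sym U k U0])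
  finally have "t\<^sup>2 \<le> \<bar>ev k\<bar>\<^sup>2" using f(1) by simp
  then show ?thesis by (rule power2_le_imp_le) simp
qed


text \<open>In the basis of a Schur decomposition the first \<open>k\<close> coordinates form an invariant subspace on
  which the matrix is triangular with large diagonal. The weights \<open>K ^ i\<close> make the off-diagonal
  entries negligible.\<close>

lemma weighted_triangular_growth:
  fixes T :: "nat \<Rightarrow> nat \<Rightarrow> real"
  assumes upper: "\<And>i j. j < i \<Longrightarrow> i < k \<Longrightarrow> T i j = 0"
    and diag: "\<And>i. i < k \<Longrightarrow> \<bar>T i i\<bar> \<ge> \<rho> + \<delta>" and \<delta>: "\<delta> > 0"
    and bound: "\<And>i j. i < k \<Longrightarrow> j < k \<Longrightarrow> \<bar>T i j\<bar> \<le> B" and K: "K \<ge> 2 * B / \<delta>" "K \<ge> 2"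
  shows "\<rho> * (\<Sum>i<k. K ^ i * \<bar>a i\<bar>) \<le> (\<Sum>i<k. K ^ i * \<bar>\<Sum>j<k. T i j * a j\<bar>)"
proof -
  \<comment> \<open>A geometric sum: since \<open>K - 1 \<ge> K / 2\<close>, the powers below
    \<open>j\<close> add up to at most \<open>K ^ j / (K / 2)\<close>, and
    \<open>B \<le> \<delta> * (K / 2)\<close>.\<close>
  have small: "(\<Sum>i<j. K ^ i * B) \<le> \<delta> * K ^ j" if "B \<ge> 0" for j
  proof -
    have "(\<Sum>i<j. K ^ i) * (K - 1) = K ^ j - 1"
      by (simp add: power_diff_1_eq mult.commute)
    then have "(\<Sum>i<j. K ^ i) * (K - 1) \<le> K ^ j" by simp
    moreover have "(\<Sum>i<j. K ^ i) * (K / 2) \<le> (\<Sum>i<j. K ^ i) * (K - 1)"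
      by (rule mult_left_mono) (use K in \<open>auto intro: sum_nonneg\<close>)
    ultimately have "(\<Sum>i<j. K ^ i) * (K / 2) \<le> K ^ j" by linarith
    then have le: "\<delta> * ((\<Sum>i<j. K ^ i) * (K / 2)) \<le> \<delta> * K ^ j" using \<delta> by simp
    have "B \<le> \<delta> * (K / 2)" using K(1) \<delta> by (simp add: field_simps)
    then have "(\<Sum>i<j. K ^ i) * B \<le> (\<Sum>i<j. K ^ i) * (\<delta> * (K / 2))"
      by (rule mult_left_mono) (use K in \<open>auto intro: sum_nonneg\<close>)
    also have "\<dots> = \<delta> * ((\<Sum>i<j. K ^ i) * (K / 2))" by simp
    also note le
    finally show ?thesis by (simp add: sum_distrib_right)
  qed
  have B: "B \<ge> 0" if "k > 0" using bound[of 0 0] that by (meson abs_ge_zero order_trans)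
  have "(\<Sum>i<k. K ^ i * \<bar>\<Sum>j<k. T i j * a j\<bar>) \<ge>
     (\<Sum>i<k. K ^ i * (\<bar>T i i\<bar> * \<bar>a i\<bar>) - (\<Sum>j<k. if i < j then K ^ i * B * \<bar>a j\<bar> else 0))"
  proof (rule sum_mono)
    fix i assume i: "i \<in> {..<k}"
    have "(\<Sum>j<k. T i j * a j) = T i i * a i + (\<Sum>j\<in>{..<k} - {i}. T i j * a j)"
      using i by (subst sum.remove[of _ i]) auto
    then have "\<bar>\<Sum>j<k. T i j * a j\<bar> \<ge> \<bar>T i i * a i\<bar> - \<bar>\<Sum>j\<in>{..<k} - {i}. T i j * a j\<bar>" by linarith
    moreover have "\<bar>\<Sum>j\<in>{..<k} - {i}. T i j * a j\<bar> \<le> (\<Sum>j\<in>{..<k} - {i}. if i < j then B * \<bar>a j\<bar> else 0)"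
      by (rule order_trans[OF sum_abs], rule sum_mono)
         (use i upper bound in \<open>auto simp: abs_mult mult_right_mono not_less\<close>)
    moreover have "(\<Sum>j\<in>{..<k} - {i}. if i < j then B * \<bar>a j\<bar> else 0) = (\<Sum>j<k. if i < j then B * \<bar>a j\<bar> else 0)"
      by (rule sum.mono_neutral_left) auto
    ultimately have "\<bar>T i i\<bar> * \<bar>a i\<bar> - (\<Sum>j<k. if i < j then B * \<bar>a j\<bar> else 0) \<le> \<bar>\<Sum>j<k. T i j * a j\<bar>"
      by (simp add: abs_mult)
    then have "K ^ i * (\<bar>T i i\<bar> * \<bar>a i\<bar> - (\<Sum>j<k. if i < j then B * \<bar>a j\<bar> else 0)) \<le> K ^ i * \<bar>\<Sum>j<k. T i j * a j\<bar>"
      by (rule mult_left_mono) (use K in auto)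
    moreover have "K ^ i * (\<Sum>j<k. if i < j then B * \<bar>a j\<bar> else 0) = (\<Sum>j<k. if i < j then K ^ i * B * \<bar>a j\<bar> else 0)"
      by (simp add: sum_distrib_left if_distrib mult_ac cong: if_cong)
    ultimately show "K ^ i * (\<bar>T i i\<bar> * \<bar>a i\<bar>) - (\<Sum>j<k. if i < j then K ^ i * B * \<bar>a j\<bar> else 0)
      \<le> K ^ i * \<bar>\<Sum>j<k. T i j * a j\<bar>" by (simp add: algebra_simps)
  qed
  \<comment> \<open>Sorted by column \<open>j\<close>, the off-diagonal losses are covered by the
    margin \<delta> of the diagonal entry.\<close>
  moreover have "(\<Sum>i<k. \<Sum>j<k. if i < j then K ^ i * B * \<bar>a j\<bar> else 0) \<le> (\<Sum>j<k. \<delta> * K ^ j * \<bar>a j\<bar>)"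
  proof -
    have "(\<Sum>i<k. \<Sum>j<k. if i < j then K ^ i * B * \<bar>a j\<bar> else 0) =
       (\<Sum>j<k. \<Sum>i<k. if i < j then K ^ i * B * \<bar>a j\<bar> else 0)" by (rule sum.swap)
    also have "\<dots> \<le> (\<Sum>j<k. \<delta> * K ^ j * \<bar>a j\<bar>)"
    proof (rule sum_mono)
      fix j assume j: "j \<in> {..<k}"
      have "(\<Sum>i<k. if i < j then K ^ i * B * \<bar>a j\<bar> else 0) = (\<Sum>i<j. K ^ i * B * \<bar>a j\<bar>)"
        by (subst sum.inter_filter[symmetric]) (use j in \<open>auto intro!: sum.cong\<close>)
      also have "\<dots> = (\<Sum>i<j. K ^ i * B) * \<bar>a j\<bar>" by (simp add: sum_distrib_right)
      also have "\<dots> \<le> \<delta> * K ^ j * \<bar>a j\<bar>" by (rule mult_right_mono[OF small]) (use B j in auto)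
      finally show "(\<Sum>i<k. if i < j then K ^ i * B * \<bar>a j\<bar> else 0) \<le> \<delta> * K ^ j * \<bar>a j\<bar>" .
    qed
    finally show ?thesis .
  qed
  moreover have "(\<Sum>i<k. K ^ i * (\<bar>T i i\<bar> * \<bar>a i\<bar>)) \<ge> (\<Sum>i<k. K ^ i * ((\<rho> + \<delta>) * \<bar>a i\<bar>))"
    by (intro sum_mono mult_left_mono mult_right_mono) (use diag K in auto)
  moreover have "(\<Sum>i<k. K ^ i * ((\<rho> + \<delta>) * \<bar>a i\<bar>)) = \<rho> * (\<Sum>i<k. K ^ i * \<bar>a i\<bar>) + (\<Sum>j<k. \<delta> * K ^ j * \<bar>a j\<bar>)"
    unfolding sum_distrib_left sum.distrib[symmetric] by (rule sum.cong) (simp_all add: algebra_simps)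
  ultimately show ?thesis by (simp add: sum_subtractf)
qed

text \<open>The first \<open>k\<close> columns of \<open>P\<close> in \<open>M = P T Q\<close> span
  an invariant subspace on which \<open>M\<close> acts by the leading block of \<open>T\<close>. The
  weighted norm \<open>N\<close> grows by the factor \<rho> in each step, and the change to sums of
  absolute values costs \<open>CP\<close> and \<open>CQ\<close> only once; so \<open>c\<close> does
  not depend on \<open>l\<close>.\<close>

lemma growth_subspace:
  fixes M :: "real mat"
  assumes M: "M \<in> carrier_mat r r" and \<mu>: "ordered_eigenvalues r M \<mu>" and k: "k \<le> r"
    and \<rho>: "0 < \<rho>" "\<And>i. 1 \<le> i \<Longrightarrow> i \<le> k \<Longrightarrow> \<rho> < \<bar>\<mu> i\<bar>"
  obtains c :: real and e :: "nat \<Rightarrow> nat \<Rightarrow> real" where "c > 0"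
    "\<And>a l. c * \<rho> ^ l * (\<Sum>s<r. \<bar>\<Sum>i<k. a i * e i s\<bar>) \<le>
       (\<Sum>s<r. \<bar>(mv r (\<lambda>i j. M $$ (i, j)) ^^ l) (\<lambda>s. \<Sum>i<k. a i * e i s) s\<bar>)"
    "\<And>a i. i < k \<Longrightarrow> a i \<noteq> 0 \<Longrightarrow> (\<Sum>s<r. \<bar>\<Sum>i<k. a i * e i s\<bar>) > 0"
proof -
  define es where "es = map \<mu> [1..<Suc r]"
  have "char_poly M = (\<Prod>e\<leftarrow>es. [:- e, 1:])"
  proof -
    have "(\<Prod>k\<in>{1..r}. [:- \<mu> k, 1:]) = (\<Prod>k\<leftarrow>[1..<Suc r]. [:- \<mu> k, 1:])"
      by (subst prod.distinct_set_conv_list[symmetric]) (auto intro: prod.cong)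
    then show ?thesis using \<mu> by (simp add: ordered_eigenvalues_def es_def o_def)
  qed
  moreover obtain T P Q where "schur_decomposition M es = (T, P, Q)" by (metis prod_cases3)
  ultimately have S: "similar_mat_wit M T P Q" "upper_triangular T" "diag_mat T = es"
    using schur_decomposition[OF M] by auto
  note D = similar_mat_witD2[OF M S(1)]
  have dimT: "dim_row T = r" using D by auto
  have diagT: "T $$ (i, i) = \<mu> (Suc i)" if "i < r" for i
  proof -
    have "diag_mat T ! i = T $$ (i, i)" using that dimT by (simp add: diag_mat_def)
    moreover have "es ! i = \<mu> (Suc i)" using that by (simp add: es_def del: upt_Suc)
    ultimately show ?thesis using S(3) by simp
  qed
  have upT: "T $$ (i, j) = 0" if "j < i" "i < r" for i j
    using S(2) that dimT by (auto simp: upper_triangular_def)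
  have MP: "M * P = P * T"
  proof -
    have "M * P = P * T * Q * P" using D by simp
    also have "\<dots> = P * T * (Q * P)" using D by (intro assoc_mult_mat) auto
    finally show ?thesis using D by simp
  qed
  define e where "e = (\<lambda>i s. P $$ (s, i))"
  define g where "g = (\<lambda>a s. \<Sum>i<k. a i * e i s)"
  define Top where "Top = (\<lambda>a i. \<Sum>j<k. T $$ (i, j) * a j)"
  have MPent: "(\<Sum>t<r. M $$ (s, t) * P $$ (t, j)) = (\<Sum>i<k. P $$ (s, i) * T $$ (i, j))"
    if "s < r" "j < k" for s j
  proof -
    have "(M * P) $$ (s, j) = (\<Sum>t<r. M $$ (s, t) * P $$ (t, j))"
      using that k M D by (simp add: scalar_prod_def lessThan_atLeast0)
    moreover have "(P * T) $$ (s, j) = (\<Sum>i<r. P $$ (s, i) * T $$ (i, j))"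
      using that k M D by (simp add: scalar_prod_def lessThan_atLeast0)
    moreover have "(\<Sum>i<r. P $$ (s, i) * T $$ (i, j)) = (\<Sum>i<k. P $$ (s, i) * T $$ (i, j))"
      by (rule sum.mono_neutral_right) (use that k upT in auto)
    ultimately show ?thesis using MP by simp
  qed
  have step: "mv r (\<lambda>i j. M $$ (i, j)) (g a) s = g (Top a) s" if "s < r" for a s
  proof -
    have "mv r (\<lambda>i j. M $$ (i, j)) (g a) s = (\<Sum>t<r. \<Sum>j<k. a j * (M $$ (s, t) * P $$ (t, j)))"
      by (simp add: mv_def g_def e_def sum_distrib_left mult_ac)
    also have "\<dots> = (\<Sum>j<k. \<Sum>t<r. a j * (M $$ (s, t) * P $$ (t, j)))" by (rule sum.swap)
    also have "\<dots> = (\<Sum>j<k. a j * (\<Sum>i<k. P $$ (s, i) * T $$ (i, j)))"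
      by (rule sum.cong) (auto simp: sum_distrib_left[symmetric] MPent that)
    also have "\<dots> = (\<Sum>j<k. \<Sum>i<k. a j * (P $$ (s, i) * T $$ (i, j)))" by (simp add: sum_distrib_left)
    also have "\<dots> = (\<Sum>i<k. \<Sum>j<k. a j * (P $$ (s, i) * T $$ (i, j)))" by (rule sum.swap)
    also have "\<dots> = g (Top a) s"
      unfolding g_def Top_def e_def sum_distrib_right by (intro sum.cong refl) (simp add: mult_ac)
    finally show ?thesis .
  qed
  have iter: "(mv r (\<lambda>i j. M $$ (i, j)) ^^ l) (g a) s = g ((Top ^^ l) a) s" if "s < r" for a l s
    using that
  proof (induction l arbitrary: s)
    case (Suc l)
    have "(mv r (\<lambda>i j. M $$ (i, j)) ^^ Suc l) (g a) s = mv r (\<lambda>i j. M $$ (i, j)) (g ((Top ^^ l) a)) s"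
      using Suc.IH by (simp del: funpow.simps add: funpow.simps(2)) (rule mv_cong, simp)
    then show ?case using step[OF Suc.prems] by simp
  qed simp
  \<comment> \<open>The margin between \<rho> and the moduli; \<open>insert 1\<close> keeps the set
    non-empty when \<open>k = 0\<close>.\<close>
  define \<delta> where "\<delta> = Min (insert 1 ((\<lambda>i. \<bar>\<mu> i\<bar> - \<rho>) ` {1..k}))"
  have \<delta>: "\<delta> > 0" unfolding \<delta>_def using \<rho> by (subst Min_gr_iff) auto
  have \<delta>le: "\<bar>\<mu> i\<bar> \<ge> \<rho> + \<delta>" if "1 \<le> i" "i \<le> k" for i
  proof -
    have "\<delta> \<le> \<bar>\<mu> i\<bar> - \<rho>" unfolding \<delta>_def by (rule Min_le) (use that in auto)
    then show ?thesis by simp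
  qed
  define B where "B = (\<Sum>i<r. \<Sum>j<r. \<bar>T $$ (i, j)\<bar>)"
  have B: "\<bar>T $$ (i, j)\<bar> \<le> B" if "i < k" "j < k" for i j
  proof -
    have "\<bar>T $$ (i, j)\<bar> \<le> (\<Sum>j<r. \<bar>T $$ (i, j)\<bar>)" by (rule member_le_sum) (use that k in auto)
    also have "\<dots> \<le> B" unfolding B_def
      by (rule member_le_sum[where f = "\<lambda>i. \<Sum>j<r. \<bar>T $$ (i, j)\<bar>"]) (use that k in \<open>auto intro: sum_nonneg\<close>)
    finally show ?thesis .
  qed
  define K where "K = max 2 (2 * B / \<delta>)"
  have K: "K \<ge> 2 * B / \<delta>" "K \<ge> 2" by (auto simp: K_def)
  define N where "N = (\<lambda>a :: nat \<Rightarrow> real. \<Sum>i<k. K ^ i * \<bar>a i\<bar>)"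
  have Nstep: "\<rho> * N a \<le> N (Top a)" for a
    unfolding N_def Top_def
    by (rule weighted_triangular_growth[OF _ _ \<delta> B K]) (use upT diagT \<delta>le k in auto)
  have Niter: "\<rho> ^ l * N a \<le> N ((Top ^^ l) a)" for a l
  proof (induction l)
    case (Suc l)
    have "\<rho> ^ Suc l * N a \<le> \<rho> * N ((Top ^^ l) a)" using Suc \<rho>(1) by (simp add: mult_left_mono mult.assoc)
    also have "\<dots> \<le> N ((Top ^^ Suc l) a)" using Nstep by simp
    finally show ?case .
  qed simp
  define CP where "CP = 1 + (\<Sum>i<r. \<Sum>s<r. \<bar>P $$ (s, i)\<bar>)"
  define CQ where "CQ = 1 + (\<Sum>i<k. \<Sum>s<r. K ^ i * \<bar>Q $$ (i, s)\<bar>)"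
  have CP: "CP > 0" unfolding CP_def by (intro add_pos_nonneg sum_nonneg) auto
  have CQ: "CQ > 0" unfolding CQ_def using K by (intro add_pos_nonneg sum_nonneg) auto
  have upper: "(\<Sum>s<r. \<bar>g a s\<bar>) \<le> CP * N a" for a
  proof -
    have "(\<Sum>s<r. \<bar>g a s\<bar>) \<le> (\<Sum>s<r. \<Sum>i<k. \<bar>a i\<bar> * \<bar>P $$ (s, i)\<bar>)"
      unfolding g_def e_def by (intro sum_mono order_trans[OF sum_abs]) (simp add: abs_mult)
    also have "\<dots> = (\<Sum>i<k. \<bar>a i\<bar> * (\<Sum>s<r. \<bar>P $$ (s, i)\<bar>))"
      by (subst sum.swap) (simp add: sum_distrib_left)
    also have "\<dots> \<le> (\<Sum>i<k. (K ^ i * \<bar>a i\<bar>) * CP)"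
    proof (intro sum_mono mult_mono)
      fix i assume i: "i \<in> {..<k}"
      show "\<bar>a i\<bar> \<le> K ^ i * \<bar>a i\<bar>" using K(2) one_le_power[of K i] by (simp add: mult_le_cancel_right1)
      have "(\<Sum>s<r. \<bar>P $$ (s, i)\<bar>) \<le> (\<Sum>i<r. \<Sum>s<r. \<bar>P $$ (s, i)\<bar>)"
        by (rule member_le_sum[where f = "\<lambda>i. \<Sum>s<r. \<bar>P $$ (s, i)\<bar>"]) (use i k in \<open>auto intro: sum_nonneg\<close>)
      then show "(\<Sum>s<r. \<bar>P $$ (s, i)\<bar>) \<le> CP" by (simp add: CP_def)
    qed (use K in \<open>auto intro: sum_nonneg\<close>)
    finally show ?thesis by (simp add: N_def sum_distrib_left mult_ac)
  qed
  have lower: "N a \<le> CQ * (\<Sum>s<r. \<bar>g a s\<bar>)" for a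
  proof -
    have inv: "a i = (\<Sum>s<r. Q $$ (i, s) * g a s)" if "i < k" for i
    proof -
      have QP: "(\<Sum>s<r. Q $$ (i, s) * P $$ (s, j)) = (if i = j then 1 else 0)" if "j < k" for j
      proof -
        have "(Q * P) $$ (i, j) = (\<Sum>s<r. Q $$ (i, s) * P $$ (s, j))"
          using that \<open>i < k\<close> k D(6,7) by (simp add: scalar_prod_def lessThan_atLeast0)
        moreover have "(Q * P) $$ (i, j) = (if i = j then 1 else 0)"
          unfolding D(2) using that \<open>i < k\<close> k by simp
        ultimately show ?thesis by simp
      qed
      have "(\<Sum>s<r. Q $$ (i, s) * g a s) = (\<Sum>s<r. \<Sum>j<k. a j * (Q $$ (i, s) * P $$ (s, j)))"
        by (simp add: g_def e_def sum_distrib_left mult_ac)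
      also have "\<dots> = (\<Sum>j<k. a j * (\<Sum>s<r. Q $$ (i, s) * P $$ (s, j)))"
        by (subst sum.swap) (simp add: sum_distrib_left)
      also have "\<dots> = (\<Sum>j<k. a j * (if i = j then 1 else 0))" by (rule sum.cong) (auto simp: QP)
      also have "\<dots> = a i" using that by (simp add: if_distrib cong: if_cong)
      finally show ?thesis ..
    qed
    let ?G = "\<Sum>s<r. \<bar>g a s\<bar>"
    have "N a \<le> (\<Sum>i<k. K ^ i * (\<Sum>s<r. \<bar>Q $$ (i, s)\<bar> * ?G))"
      unfolding N_def
    proof (intro sum_mono mult_left_mono)
      fix i assume i: "i \<in> {..<k}"
      have "\<bar>a i\<bar> \<le> (\<Sum>s<r. \<bar>Q $$ (i, s)\<bar> * \<bar>g a s\<bar>)"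
        using inv[of i] i sum_abs[of "\<lambda>s. Q $$ (i, s) * g a s" "{..<r}"] by (simp add: abs_mult)
      also have "\<dots> \<le> (\<Sum>s<r. \<bar>Q $$ (i, s)\<bar> * ?G)"
        by (intro sum_mono mult_left_mono member_le_sum[where f = "\<lambda>s. \<bar>g a s\<bar>"]) auto
      finally show "\<bar>a i\<bar> \<le> (\<Sum>s<r. \<bar>Q $$ (i, s)\<bar> * ?G)" .
    qed (use K in auto)
    also have "\<dots> = (\<Sum>i<k. \<Sum>s<r. K ^ i * \<bar>Q $$ (i, s)\<bar>) * ?G"
      by (simp add: sum_distrib_left sum_distrib_right mult_ac)
    also have "\<dots> \<le> CQ * ?G" by (rule mult_right_mono) (auto simp: CQ_def intro: sum_nonneg)
    finally show ?thesis .
  qed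
  show thesis
  proof (rule that[of "1 / (CP * CQ)" e])
    show "1 / (CP * CQ) > 0" using CP CQ by simp
    fix a :: "nat \<Rightarrow> real" and l
    have "\<rho> ^ l * (\<Sum>s<r. \<bar>g a s\<bar>) \<le> CP * (\<rho> ^ l * N a)"
      using mult_left_mono[OF upper[of a], of "\<rho> ^ l"] \<rho>(1) by (simp add: mult_ac)
    also have "\<dots> \<le> CP * N ((Top ^^ l) a)" using Niter CP by simp
    also have "\<dots> \<le> CP * (CQ * (\<Sum>s<r. \<bar>g ((Top ^^ l) a) s\<bar>))" using lower CP by simp
    also have "(\<Sum>s<r. \<bar>g ((Top ^^ l) a) s\<bar>) = (\<Sum>s<r. \<bar>(mv r (\<lambda>i j. M $$ (i, j)) ^^ l) (g a) s\<bar>)"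
      by (rule sum.cong) (simp_all add: iter)
    finally have "\<rho> ^ l * (\<Sum>s<r. \<bar>g a s\<bar>) / (CP * CQ) \<le> (\<Sum>s<r. \<bar>(mv r (\<lambda>i j. M $$ (i, j)) ^^ l) (g a) s\<bar>)"
      using CP CQ by (simp add: divide_le_eq mult_ac)
    then show "1 / (CP * CQ) * \<rho> ^ l * (\<Sum>s<r. \<bar>\<Sum>i<k. a i * e i s\<bar>) \<le>
       (\<Sum>s<r. \<bar>(mv r (\<lambda>i j. M $$ (i, j)) ^^ l) (\<lambda>s. \<Sum>i<k. a i * e i s) s\<bar>)"
      by (simp add: g_def)
  next
    fix a :: "nat \<Rightarrow> real" and i assume "i < k" "a i \<noteq> 0"
    then have "0 < K ^ i * \<bar>a i\<bar>" using K by simp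
    also have "\<dots> \<le> N a" unfolding N_def by (rule member_le_sum) (use \<open>i < k\<close> K in auto)
    also have "\<dots> \<le> CQ * (\<Sum>s<r. \<bar>g a s\<bar>)" by (rule lower)
    finally show "(\<Sum>s<r. \<bar>\<Sum>i<k. a i * e i s\<bar>) > 0" using CQ by (simp add: g_def zero_less_mult_iff)
  qed
qed

section \<open>Attaching leaves to a vertex\<close>


lemma ip_scale_right: "ip n f (\<lambda>i. t * g i) = t * ip n f g"
  by (simp add: ip_def sum_distrib_left mult_ac)

lemma ip_scale_self: "ip n (\<lambda>i. t * f i) (\<lambda>i. t * f i) = t\<^sup>2 * ip n f f"
  by (simp add: ip_def sum_distrib_left power2_eq_square mult_ac)

lemma distance_matrix_carrier: "distance_matrix n E l \<in> carrier_mat n n"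
  by (simp add: distance_matrix_def)

lemma distance_matrix_index:
  "i < n \<Longrightarrow> j < n \<Longrightarrow> distance_matrix n E l $$ (i, j) = of_bool (graph_dist E i j = enat l)"
  by (simp add: distance_matrix_def)

lemma distance_matrix_sym:
  "i < n \<Longrightarrow> j < n \<Longrightarrow> distance_matrix n E l $$ (i, j) = distance_matrix n E l $$ (j, i)"
  by (simp add: distance_matrix_index graph_dist_commute)

locale pendant =
  fixes n :: nat and E :: "nat set set" and v :: nat and L :: "nat set"
  assumes E: "E \<subseteq> pairs n" and v: "v < n" "v \<notin> L" and L: "L \<subseteq> {..<n}"
    and isolated: "\<And>u. u \<in> L \<Longrightarrow> u \<notin> \<Union>E"
begin

definition E' :: "nat set set" where
  "E' = E \<union> (\<lambda>u. {v, u}) ` L"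

lemma edge_at_leaf: "{x, u} \<in> E' \<Longrightarrow> u \<in> L \<Longrightarrow> x = v"
  using isolated[of u] v(2) by (auto simp: E'_def doubleton_eq_iff)

text \<open>Both neighbours of a leaf inside a path would be \<open>v\<close>, the only vertex
  joined to it, but a path visits \<open>v\<close> at most once.\<close>

lemma path_avoids_leaves:
  assumes xs: "path_in E' xs" and ends: "hd xs \<notin> L" "last xs \<notin> L"
  shows "path_in E xs"
proof -
  have d: "distinct xs" "xs \<noteq> []" "edges xs \<subseteq> E'" using xs by (auto simp: path_in_def)
  have "set xs \<inter> L = {}"
  proof (rule ccontr)
    assume "set xs \<inter> L \<noteq> {}"
    then obtain i where i: "i < length xs" "xs ! i \<in> L" by (auto simp: in_set_conv_nth)
    have "i \<noteq> 0" using i ends d by (metis hd_conv_nth)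
    moreover have "i \<noteq> length xs - 1" using i ends d by (metis last_conv_nth)
    ultimately obtain j where j: "i = Suc j" "Suc (Suc j) < length xs" using i by (cases i) auto
    have "{xs ! j, xs ! i} \<in> E'" using edges_nth[of j xs] d j by auto
    then have "xs ! j = v" by (rule edge_at_leaf) (rule i)
    have "{xs ! Suc i, xs ! i} \<in> E'" using edges_nth[of i xs] d j by (auto simp: insert_commute)
    then have "xs ! Suc i = v" by (rule edge_at_leaf) (rule i)
    then have "j = Suc i" using \<open>xs ! j = v\<close> d j by (metis Suc_lessD nth_eq_iff_index_eq)
    then show False using j by simp
  qed
  have "edges xs \<subseteq> E"
  proof
    fix e assume e: "e \<in> edges xs"
    show "e \<in> E"
    proof (rule ccontr)
      assume "e \<notin> E"
      then obtain u where u: "u \<in> L" "e = {v, u}" using e d(3) unfolding E'_def by blast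
      have "u \<in> set xs" using Union_edges[of xs] e u by auto
      then show False using u \<open>set xs \<inter> L = {}\<close> by blast
    qed
  qed
  then show ?thesis using d by (simp add: path_in_def)
qed

lemma graph_dist_outside:
  assumes "i \<notin> L" "j \<notin> L" shows "graph_dist E' i j = graph_dist E i j"
proof (rule antisym)
  show "graph_dist E' i j \<le> graph_dist E i j"
  proof (cases "graph_dist E i j")
    case (enat k)
    then obtain xs where "path_in E xs" "length xs = Suc k" "hd xs = i" "last xs = j" by (rule graph_dist_path)
    then show ?thesis using graph_dist_le[of xs E' k] enat by (auto simp: path_in_def E'_def)
  qed simp
  show "graph_dist E i j \<le> graph_dist E' i j"
  proof (cases "graph_dist E' i j")
    case (enat k)
    then obtain xs where xs: "path_in E' xs" "length xs = Suc k" "hd xs = i" "last xs = j" by (rule graph_dist_path)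
    then have "path_in E xs" using path_avoids_leaves assms by simp
    then show ?thesis using graph_dist_le[of xs E k] enat xs by (auto simp: path_in_def)
  qed simp
qed

text \<open>Every path from a leaf to a non-leaf starts with the edge to \<open>v\<close>, and the
  rest of it avoids the leaves.\<close>

lemma graph_dist_leaf:
  assumes u: "u \<in> L" and j: "j \<notin> L" shows "graph_dist E' u j = eSuc (graph_dist E v j)"
proof (rule antisym)
  show "graph_dist E' u j \<le> eSuc (graph_dist E v j)"
  proof (cases "graph_dist E v j")
    case (enat k)
    then obtain xs where xs: "path_in E xs" "length xs = Suc k" "hd xs = v" "last xs = j" by (rule graph_dist_path)
    obtain ys where ys: "xs = v # ys" using xs by (cases xs) (auto simp: path_in_def)
    have "{u, v} \<in> E'" using u by (auto simp: E'_def insert_commute)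
    then have "edges (u # xs) \<subseteq> E'" using xs by (auto simp: ys path_in_def E'_def)
    then have "graph_dist E' (hd (u # xs)) (last (u # xs)) \<le> enat (Suc k)"
      by (rule graph_dist_le) (use xs in auto)
    then show ?thesis using xs ys enat by (simp add: eSuc_enat)
  qed simp
  show "eSuc (graph_dist E v j) \<le> graph_dist E' u j"
  proof (cases "graph_dist E' u j")
    case (enat k)
    then obtain xs where xs: "path_in E' xs" "length xs = Suc k" "hd xs = u" "last xs = j" by (rule graph_dist_path)
    obtain ys where ys: "xs = u # ys" using xs by (cases xs) (auto simp: path_in_def)
    have "ys \<noteq> []" using xs ys u j by auto
    then obtain y zs where zs: "ys = y # zs" by (cases ys) auto
    have "{y, u} \<in> E'" using xs by (auto simp: ys zs path_in_def insert_commute)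
    then have "y = v" using edge_at_leaf u by blast
    have "path_in E' ys" using xs by (auto simp: ys zs path_in_def)
    then have "path_in E ys" by (rule path_avoids_leaves) (use xs ys zs j v \<open>y = v\<close> in auto)
    then have "graph_dist E (hd ys) (last ys) \<le> enat (k - 1)"
      using graph_dist_le[of ys E "k - 1"] xs ys zs by (auto simp: path_in_def)
    then have "graph_dist E v j \<le> enat (k - 1)" using xs ys zs \<open>y = v\<close> by simp
    then have "eSuc (graph_dist E v j) \<le> eSuc (enat (k - 1))" by simp
    moreover have "k \<noteq> 0" using xs ys zs by auto
    ultimately show ?thesis using enat by (simp add: eSuc_enat)
  qed simp
qed

lemma graph_dist_leaves:
  assumes "u \<in> L" "u' \<in> L" shows "graph_dist E' u u' \<le> enat 2"
proof -
  have "edges [u, v, u'] \<subseteq> E'" using assms by (auto simp: E'_def insert_commute)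
  then show ?thesis using graph_dist_le[of "[u, v, u']" E' 2] by simp
qed

lemma graph_dist_isolated:
  assumes "u \<in> L" "l > 0" shows "graph_dist E u j \<noteq> enat l" "graph_dist E j u \<noteq> enat l"
proof -
  show *: "graph_dist E u j \<noteq> enat l"
  proof
    assume "graph_dist E u j = enat l"
    then obtain xs where xs: "path_in E xs" "length xs = Suc l" "hd xs = u" by (rule graph_dist_path)
    then obtain y zs where "xs = u # y # zs" using assms(2) by (cases xs; cases "tl xs") auto
    then have "{u, y} \<in> E" using xs by (auto simp: path_in_def)
    then show False using isolated[OF assms(1)] by auto
  qed
  then show "graph_dist E j u \<noteq> enat l" by (simp add: graph_dist_commute)
qed

definition S :: "nat \<Rightarrow> nat set" where
  "S m = {x. x < n \<and> graph_dist E v x = enat m}"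

lemma S_disjoint: "m > 0 \<Longrightarrow> S m \<inter> L = {}"
  using graph_dist_isolated by (auto simp: S_def)

lemma finite_S [simp]: "finite (S m)" "finite L"
  using finite_subset[OF L] by (auto simp: S_def)

text \<open>\<open>m \<ge> 2\<close> keeps pairs of leaves, at distance at most 2, out of the matrix
  for \<open>Suc m\<close>. In the old matrix the rows and columns of the leaves are zero, so the
  two new blocks overlap with nothing.\<close>

lemma distance_matrix_pendant:
  assumes m: "m \<ge> 2" and ij: "i < n" "j < n"
  shows "distance_matrix n E' (Suc m) $$ (i, j) = distance_matrix n E (Suc m) $$ (i, j)
     + of_bool (i \<in> L) * of_bool (j \<in> S m) + of_bool (i \<in> S m) * of_bool (j \<in> L)"
proof -
  note disj = S_disjoint[of m]
  have leaf: "graph_dist E' u w = enat (Suc m) \<longleftrightarrow> w \<in> S m" if "u \<in> L" "w \<notin> L" "w < n" for u w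
    using graph_dist_leaf[OF that(1,2)] that(3) by (simp add: S_def eSuc_enat[symmetric])
  consider "i \<in> L" "j \<in> L" | "i \<in> L" "j \<notin> L" | "i \<notin> L" "j \<in> L" | "i \<notin> L" "j \<notin> L" by blast
  then show ?thesis
  proof cases
    case 1
    then have "graph_dist E' i j \<noteq> enat (Suc m)" using graph_dist_leaves[of i j] m by auto
    then show ?thesis using 1 disj m ij graph_dist_isolated[of i "Suc m" j]
      by (auto simp: distance_matrix_index)
  next
    case 2
    then show ?thesis using disj m ij graph_dist_isolated[of i "Suc m" j] leaf[of i j]
      by (auto simp: distance_matrix_index)
  next
    case 3
    then show ?thesis using disj m ij graph_dist_isolated[of j "Suc m" i] leaf[of j i]
      by (auto simp: distance_matrix_index graph_dist_commute[of E' i j])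
  next
    case 4
    then show ?thesis using ij by (simp add: distance_matrix_index graph_dist_outside)
  qed
qed

lemma ip_indicator: "A \<subseteq> {..<n} \<Longrightarrow> ip n (\<lambda>i. of_bool (i \<in> A)) (\<lambda>i. of_bool (i \<in> A)) = real (card A)"
  by (simp add: ip_def of_bool_conj[symmetric] sum.If_cases Int_absorb1 Int_def[symmetric] of_bool_def
      if_distrib cong: if_cong)

text \<open>The overlap bound is stated without division and for all eigenvectors:
  \<open>lam\<close> may be multiple, and lower bounds for \<open>|lam - ev|\<close> and
  \<open>|ev|\<close> become available only later, for the leading eigenvectors.\<close>

lemma pendant_eigenvalue:
  fixes \<eta> :: real
  assumes m: "m \<ge> 2" and ne: "L \<noteq> {}" "S m \<noteq> {}" and \<eta>: "\<eta> \<ge> 0"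
  defines "d \<equiv> \<lambda>i j. distance_matrix n E (Suc m) $$ (i, j)"
    and "s \<equiv> \<lambda>i. of_bool (i \<in> S m)"
    and "\<theta> \<equiv> sqrt (real (card L) * real (card (S m)))"
  assumes Ds: "ip n (mv n d s) (mv n d s) \<le> \<eta>\<^sup>2 * real (card (S m))"
  obtains lam where "\<bar>lam - \<theta>\<bar> \<le> \<eta>" "eigenvalue (distance_matrix n E' (Suc m)) lam"
    "\<And>x u ev. eigenvector (distance_matrix n E' (Suc m)) x lam \<Longrightarrow> scalar_prod x x = 1 \<Longrightarrow>
       ip n u u = 1 \<Longrightarrow> (\<And>i. i < n \<Longrightarrow> mv n d u i = ev * u i) \<Longrightarrow> ev \<noteq> 0 \<Longrightarrow>
       \<bar>lam - ev\<bar> * \<bar>ip n (vec_index x) u\<bar> * \<bar>ev\<bar> \<le> \<eta> * \<theta>"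
proof -
  define d' where "d' = (\<lambda>i j. distance_matrix n E' (Suc m) $$ (i, j))"
  define t where "t = (\<lambda>i. of_bool (i \<in> L) :: real)"
  define a where "a = real (card L)"
  define b where "b = real (card (S m))"
  have a: "a > 0" using ne by (simp add: a_def card_gt_0_iff)
  have b: "b > 0" using ne by (simp add: b_def card_gt_0_iff)
  have S_sub: "S m \<subseteq> {..<n}" by (auto simp: S_def)
  have tt: "ip n t t = a" unfolding t_def a_def by (rule ip_indicator[OF L])
  have ss: "ip n s s = b" unfolding s_def b_def by (rule ip_indicator[OF S_sub])
  have ts: "ip n t s = 0" "ip n s t = 0"
    using S_disjoint[of m] m by (auto simp: ip_def t_def s_def intro!: sum.neutral)
  have d': "mv n d' f i = mv n d f i + t i * ip n s f + s i * ip n t f" if "i < n" for f i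
  proof -
    have "mv n d' f i = (\<Sum>j<n. d i j * f j + t i * (s j * f j) + s i * (t j * f j))"
      unfolding mv_def by (rule sum.cong)
        (use distance_matrix_pendant[OF m that] in \<open>auto simp: d'_def d_def t_def s_def algebra_simps\<close>)
    then show ?thesis by (simp add: mv_def ip_def sum.distrib sum_distrib_left)
  qed
  have dt: "mv n d t i = 0" if "i < n" for i
    unfolding mv_def using that graph_dist_isolated(2)[of _ "Suc m" i]
    by (intro sum.neutral) (auto simp: t_def d_def distance_matrix_index)
  have dsym: "d i j = d j i" "d' i j = d' j i" if "i < n" "j < n" for i j
    using that distance_matrix_sym by (auto simp: d_def d'_def)
  have \<theta>: "\<theta> = sqrt a * sqrt b" by (simp add: \<theta>_def a_def b_def real_sqrt_mult)
  \<comment> \<open>The approximate eigenvector multiplied by \<open>sqrt (a * b)\<close>, which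
    removes the divisions.\<close>
  define z where "z = (\<lambda>i. sqrt b * t i + sqrt a * s i)"
  have zz: "ip n z z = 2 * a * b"
  proof -
    have "z = (\<lambda>i. (\<lambda>i. sqrt b * t i) i + sqrt a * s i)" by (simp add: z_def)
    then have "ip n z z = ip n (\<lambda>i. sqrt b * t i) (\<lambda>i. sqrt b * t i) + 2 * sqrt a * ip n s (\<lambda>i. sqrt b * t i) + (sqrt a)\<^sup>2 * ip n s s"
      by (simp only: ip_add_self)
    then show ?thesis using a b by (simp add: ip_scale_self ip_scale_right tt ss ts)
  qed
  have sz: "ip n s z = sqrt a * b"
  proof -
    have "ip n s z = sqrt b * ip n s t + sqrt a * ip n s s"
      by (simp add: z_def ip_def sum.distrib sum_distrib_left algebra_simps)
    then show ?thesis by (simp add: ts ss)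
  qed
  have tz: "ip n t z = sqrt b * a"
  proof -
    have "ip n t z = sqrt b * ip n t t + sqrt a * ip n t s"
      by (simp add: z_def ip_def sum.distrib sum_distrib_left algebra_simps)
    then show ?thesis by (simp add: ts tt)
  qed
  have res: "mv n d' z i - \<theta> * z i = sqrt a * mv n d s i" if "i < n" for i
  proof -
    have "mv n d z i = sqrt b * mv n d t i + sqrt a * mv n d s i"
      by (simp add: z_def mv_def sum.distrib sum_distrib_left algebra_simps)
    moreover have "sqrt a * b = \<theta> * sqrt b" "sqrt b * a = \<theta> * sqrt a"
      using a b by (simp_all add: \<theta>)
    ultimately show ?thesis using d'[OF that, of z] dt[OF that] unfolding sz tz
      by (simp add: z_def algebra_simps)
  qed
  have "ip n (\<lambda>i. mv n d' z i - \<theta> * z i) (\<lambda>i. mv n d' z i - \<theta> * z i) =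
      ip n (\<lambda>i. sqrt a * mv n d s i) (\<lambda>i. sqrt a * mv n d s i)"
    by (rule ip_cong) (simp_all add: res)
  also have "\<dots> = (sqrt a)\<^sup>2 * ip n (mv n d s) (mv n d s)"
    by (rule ip_scale_self)
  also have "\<dots> = a * ip n (mv n d s) (mv n d s)" using a by simp
  also have "\<dots> \<le> a * (\<eta>\<^sup>2 * b)" using Ds a by (simp add: b_def)
  \<comment> \<open>Here \<open>ip n z z\<close> equals \<open>2 * a * b\<close>, so a factor 2 is
    given away.\<close>
  also have "\<dots> \<le> \<eta>\<^sup>2 * ip n z z" using a b by (simp add: zz mult_left_mono)
  finally have close: "ip n (\<lambda>i. mv n d' z i - \<theta> * z i) (\<lambda>i. mv n d' z i - \<theta> * z i) \<le> \<eta>\<^sup>2 * ip n z z" .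
  have zpos: "ip n z z > 0" using a b by (simp add: zz)
  have "\<exists>lam y. \<bar>lam - \<theta>\<bar> \<le> \<eta> \<and> (\<exists>i<n. y i \<noteq> 0) \<and> (\<forall>i<n. mv n d' y i = lam * y i)"
    by (rule symmetric_near_eigenvalue[OF dsym(2) zpos \<eta> close]) blast+
  then obtain lam y i where lam: "\<bar>lam - \<theta>\<bar> \<le> \<eta>" and y: "i < n" "y i \<noteq> 0"
    "\<forall>i<n. mv n d' y i = lam * y i" by blast
  note car = distance_matrix_carrier[of n E' "Suc m"]
  have "eigenvector (distance_matrix n E' (Suc m)) (Matrix.vec n y) lam"
    unfolding eigenvector_def
  proof (intro conjI)
    show "Matrix.vec n y \<in> carrier_vec (dim_row (distance_matrix n E' (Suc m)))" using car by simp
    have "vec_index (Matrix.vec n y) i \<noteq> vec_index (0\<^sub>v n) i" using y by simp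
    then show "Matrix.vec n y \<noteq> 0\<^sub>v (dim_row (distance_matrix n E' (Suc m)))" using car by auto
    show "distance_matrix n E' (Suc m) *\<^sub>v Matrix.vec n y = lam \<cdot>\<^sub>v Matrix.vec n y"
    proof (rule eq_vecI)
      fix i assume "i < dim_vec (lam \<cdot>\<^sub>v Matrix.vec n y)"
      then have i: "i < n" by simp
      have "vec_index (distance_matrix n E' (Suc m) *\<^sub>v Matrix.vec n y) i = mv n d' (vec_index (Matrix.vec n y)) i"
        unfolding d'_def by (rule mult_mat_vec_mv[OF car _ i]) simp
      also have "\<dots> = mv n d' y i" by (rule mv_cong) simp
      finally show "vec_index (distance_matrix n E' (Suc m) *\<^sub>v Matrix.vec n y) i = vec_index (lam \<cdot>\<^sub>v Matrix.vec n y) i"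
        using y i by simp
    qed (use car in simp)
  qed
  then have ev: "eigenvalue (distance_matrix n E' (Suc m)) lam" by (auto simp: eigenvalue_def)
  show thesis
  proof (rule that[OF lam ev])
    fix x and u :: "nat \<Rightarrow> real" and ev :: real
    assume x: "eigenvector (distance_matrix n E' (Suc m)) x lam" "scalar_prod x x = 1"
      and u: "ip n u u = 1" "\<And>i. i < n \<Longrightarrow> mv n d u i = ev * u i" "ev \<noteq> 0"
    define X where "X = vec_index x"
    have xc: "x \<in> carrier_vec n" "distance_matrix n E' (Suc m) *\<^sub>v x = lam \<cdot>\<^sub>v x"
      using x(1) car by (auto simp: eigenvector_def)
    have XX: "ip n X X = 1" using x(2) xc(1) by (simp add: scalar_prod_ip X_def)
    have X: "mv n d' X i = lam * X i" if "i < n" for i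
      using mult_mat_vec_mv[OF car xc(1) that] xc that by (simp add: d'_def X_def)
    \<comment> \<open>The rows of \<open>D\<close> belonging to leaves vanish, so an eigenvector
      with nonzero eigenvalue is zero on \<open>L\<close>. This removes one of the two rank-one
      terms.\<close>
    have ut: "ip n t u = 0"
    proof -
      have "ev * u i = 0" if "i < n" "i \<in> L" for i
      proof -
        have "mv n d u i = 0"
          unfolding mv_def using that graph_dist_isolated(1)[of i "Suc m"]
          by (intro sum.neutral) (auto simp: d_def distance_matrix_index)
        then show ?thesis using u(2)[OF that(1)] by simp
      qed
      then show ?thesis using u(3) by (auto simp: ip_def t_def intro!: sum.neutral)
    qed
    have "lam * ip n X u = ip n (mv n d' X) u"
      unfolding ip_def sum_distrib_left by (rule sum.cong) (simp_all add: X)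
    also have "\<dots> = ip n (mv n d X) u + ip n s X * ip n t u + ip n t X * ip n s u"
    proof -
      have "ip n (mv n d' X) u = (\<Sum>i<n. mv n d X i * u i + ip n s X * (t i * u i) + ip n t X * (s i * u i))"
        unfolding ip_def[of _ "mv n d' X"] by (rule sum.cong) (simp_all add: d' algebra_simps)
      then show ?thesis by (simp add: sum.distrib sum_distrib_left[symmetric] ip_def)
    qed
    also have "ip n (mv n d X) u = ip n X (mv n d u)" by (rule ip_mv_sym) (rule dsym)
    also have "ip n X (mv n d u) = ev * ip n X u"
      unfolding ip_def sum_distrib_left by (rule sum.cong) (simp_all add: u)
    finally have key: "(lam - ev) * ip n X u = ip n t X * ip n s u" by (simp add: ut algebra_simps)
    have "(ip n t X)\<^sup>2 \<le> a" using ip_Cauchy_Schwarz[of n t X] by (simp add: tt XX)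
    then have tX: "\<bar>ip n t X\<bar> \<le> sqrt a" by (simp add: real_le_rsqrt)
    have "ev * ip n s u = ip n s (mv n d u)"
      unfolding ip_def sum_distrib_left by (rule sum.cong) (simp_all add: u)
    also have "\<dots> = ip n (mv n d s) u" by (rule ip_mv_sym[symmetric]) (rule dsym)
    finally have "(ev * ip n s u)\<^sup>2 \<le> ip n (mv n d s) (mv n d s) * ip n u u" using ip_Cauchy_Schwarz by simp
    also have "\<dots> \<le> (\<eta> * sqrt b)\<^sup>2" using Ds b by (simp add: u b_def power_mult_distrib)
    finally have su: "\<bar>ev * ip n s u\<bar> \<le> \<eta> * sqrt b"
      using \<eta> b by (simp add: abs_le_square_iff[symmetric])
    have "\<bar>lam - ev\<bar> * \<bar>ip n X u\<bar> * \<bar>ev\<bar> = \<bar>ip n t X\<bar> * \<bar>ev * ip n s u\<bar>"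
      using key by (simp add: abs_mult[symmetric] mult_ac)
    also have "\<dots> \<le> sqrt a * (\<eta> * sqrt b)" by (intro mult_mono tX su) (use a in auto)
    finally show "\<bar>lam - ev\<bar> * \<bar>ip n (vec_index x) u\<bar> * \<bar>ev\<bar> \<le> \<eta> * \<theta>" by (simp add: X_def \<theta> mult_ac)
  qed
qed

text \<open>The altered edges have their ends in \<open>L\<close> and in the single vertex
  \<open>v\<close>, whence the \<open>Suc\<close>.\<close>

lemma adversarial_perturbation_pendant:
  assumes "L \<noteq> {}" and "Suc (card L) \<le> g"
  shows "adversarial_perturbation n g E E'"
proof -
  have "is_graph n E'"
    using E v L by (auto simp: is_graph_def E'_def pairs_def card_2_iff)
  moreover have "\<Union> ((E - E') \<union> (E' - E)) \<subseteq> insert v L" by (auto simp: E'_def)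
  then have "card (\<Union> ((E - E') \<union> (E' - E))) \<le> card (insert v L)"
    by (rule card_mono[rotated]) simp
  then have "card (\<Union> ((E - E') \<union> (E' - E))) \<le> g" using assms(2) card_insert_le_m1[of "Suc (card L)" L v]
    by (simp add: card_insert_if v)
  ultimately show ?thesis by (simp add: adversarial_perturbation_def)
qed

end

section \<open>Isolated vertices\<close>


lemma sum_of_bool_delta:
  fixes x :: "nat \<Rightarrow> real"
  assumes "finite A" shows "(\<Sum>s\<in>A. of_bool (s = a) * x s) = (if a \<in> A then x a else 0)"
proof -
  have "(\<Sum>s\<in>A. of_bool (s = a) * x s) = (\<Sum>s\<in>A. if s = a then x s else 0)"
    by (rule sum.cong) auto
  then show ?thesis using assms by simp
qed

lemma sum_of_bool_delta':
  fixes x :: "nat \<Rightarrow> real"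
  assumes "finite A" shows "(\<Sum>s\<in>A. of_bool (a = s) * x s) = (if a \<in> A then x a else 0)"
  using sum_of_bool_delta[OF assms, of a x] by (simp only: eq_commute[of a])

context block_model
begin

definition star :: "nat \<Rightarrow> nat set \<Rightarrow> nat set set" where
  "star v A = (\<lambda>u. {v, u}) ` A"

text \<open>\<open>h\<close> may depend on types outside \<open>A\<close>, in the applications on
  those of one or two fixed vertices; the vertices of \<open>A\<close> are integrated out one by
  one.\<close>

lemma ET_independent_prod:
  assumes "finite A" "A \<subseteq> {..<n}"
    and F: "\<And>u \<sigma> t. u \<in> A \<Longrightarrow> F (\<sigma>(u := t)) = F \<sigma>"
    and h: "\<And>u \<sigma> t s. u \<in> A \<Longrightarrow> h (\<sigma>(u := t)) s = h \<sigma> s"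
  shows "ET (\<lambda>\<sigma>. F \<sigma> * (\<Prod>u\<in>A. h \<sigma> (\<sigma> u))) = ET (\<lambda>\<sigma>. F \<sigma> * ((\<Sum>t<r. h \<sigma> t) / real r) ^ card A)"
  using assms
proof (induction A arbitrary: F rule: finite_induct)
  case (insert u A)
  have u: "u < n" using insert.prems by auto
  have Fu: "F (\<sigma>(u := t)) = F \<sigma>" for \<sigma> t by (rule insert.prems(2)) simp
  have hu: "h (\<sigma>(u := t)) s = h \<sigma> s" for \<sigma> t s by (rule insert.prems(3)) simp
  have "ET (\<lambda>\<sigma>. F \<sigma> * (\<Prod>u\<in>insert u A. h \<sigma> (\<sigma> u))) =
    ET (\<lambda>\<sigma>. F \<sigma> * h \<sigma> (\<sigma> u) * (\<Prod>u\<in>A. h \<sigma> (\<sigma> u)))"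
    using insert.hyps by (simp add: mult_ac)
  also have "\<dots> = ET (\<lambda>\<sigma>. \<Sum>t<r. F \<sigma> * h \<sigma> t * (\<Prod>u\<in>A. h \<sigma> (\<sigma> u)) / real r)"
  proof (subst ET_resample[OF u], rule arg_cong[where f = ET], rule ext, rule sum.cong[OF refl])
    fix \<sigma> t
    have "(\<Prod>x\<in>A. h (\<sigma>(u := t)) ((\<sigma>(u := t)) x)) = (\<Prod>x\<in>A. h \<sigma> (\<sigma> x))"
      by (rule prod.cong[OF refl]) (use insert.hyps hu in auto)
    then show "F (\<sigma>(u := t)) * h (\<sigma>(u := t)) ((\<sigma>(u := t)) u) * (\<Prod>x\<in>A. h (\<sigma>(u := t)) ((\<sigma>(u := t)) x)) / real r
      = F \<sigma> * h \<sigma> t * (\<Prod>x\<in>A. h \<sigma> (\<sigma> x)) / real r"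
      by (simp add: Fu hu del: fun_upd_apply) simp
  qed
  also have "\<dots> = ET (\<lambda>\<sigma>. F \<sigma> * ((\<Sum>t<r. h \<sigma> t) / real r) * (\<Prod>u\<in>A. h \<sigma> (\<sigma> u)))"
    by (simp add: sum_distrib_left sum_distrib_right sum_divide_distrib mult_ac)
  also have "\<dots> = ET (\<lambda>\<sigma>. F \<sigma> * ((\<Sum>t<r. h \<sigma> t) / real r) * ((\<Sum>t<r. h \<sigma> t) / real r) ^ card A)"
  proof (rule insert.IH)
    show "A \<subseteq> {..<n}" using insert.prems(1) by simp
    fix v \<sigma> t s assume "v \<in> A"
    then have v: "v \<in> insert u A" by simp
    show "h (\<sigma>(v := t)) s = h \<sigma> s" by (rule insert.prems(3)[OF v])
    then show "F (\<sigma>(v := t)) * ((\<Sum>s<r. h (\<sigma>(v := t)) s) / real r) = F \<sigma> * ((\<Sum>s<r. h \<sigma> s) / real r)"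
      using insert.prems(2)[OF v] insert.prems(3)[OF v] by (simp del: fun_upd_apply)
  qed
  finally show ?case using insert.hyps by (simp add: mult_ac)
qed simp

lemma prod_star:
  assumes "A \<subseteq> {..<n}" "v < n" "v \<notin> A" "\<And>v. v < n \<Longrightarrow> \<sigma> v < r"
  shows "(\<Prod>e\<in>star v A. 1 - q \<sigma> e) = (\<Prod>u\<in>A. 1 - W $$ (\<sigma> v, \<sigma> u) / real n)"
proof -
  have "inj_on (\<lambda>u. {v, u}) A" by (auto simp: inj_on_def doubleton_eq_iff)
  then have "(\<Prod>e\<in>star v A. 1 - q \<sigma> e) = (\<Prod>u\<in>A. 1 - q \<sigma> {v, u})"
    unfolding star_def by (simp add: prod.reindex)
  also have "\<dots> = (\<Prod>u\<in>A. 1 - W $$ (\<sigma> v, \<sigma> u) / real n)"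
    by (rule prod.cong) (use assms q_doubleton in auto)
  finally show ?thesis .
qed

lemma star_pairs: "A \<subseteq> {..<n} \<Longrightarrow> v < n \<Longrightarrow> v \<notin> A \<Longrightarrow> star v A \<subseteq> pairs n"
  by (auto simp: star_def doubleton_in_pairs)

lemma isolated_iff: "E \<subseteq> pairs n \<Longrightarrow> v < n \<Longrightarrow> v \<notin> \<Union>E \<longleftrightarrow> star v ({..<n} - {v}) \<inter> E = {}"
proof
  assume E: "E \<subseteq> pairs n" "v < n" and d: "star v ({..<n} - {v}) \<inter> E = {}"
  show "v \<notin> \<Union>E"
  proof
    assume "v \<in> \<Union>E"
    then obtain e where e: "e \<in> E" "v \<in> e" by auto
    then have "e \<in> pairs n" using E by auto
    then obtain u where "e = {v, u}" "u < n" "u \<noteq> v"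
      using e by (auto simp: pairs_def card_2_iff)
    then show False using d e by (auto simp: star_def)
  qed
qed (auto simp: star_def)

definition iso_prob :: real where
  "iso_prob = (1 - \<alpha> / real n) ^ (n - 1)"

text \<open>An upper bound for two vertices being isolated, whereas \<open>iso_prob\<close> is
  exact: the edge between the two is ignored, whence \<open>n - 2\<close>, and the product of two
  edge probabilities is bounded by \<open>w\<^sup>2 / (real n)\<^sup>2\<close>.\<close>

definition iso_pair_prob :: real where
  "iso_pair_prob = (1 - 2 * \<alpha> / real n + w\<^sup>2 / (real n)\<^sup>2) ^ (n - 2)"

definition isolated_count :: "nat set set \<Rightarrow> real" where
  "isolated_count E = real (card {v. v < n \<and> v \<notin> \<Union>E})"

lemma isolated_count_sum: "isolated_count E = (\<Sum>v<n. of_bool (v \<notin> \<Union>E))"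
  by (simp add: isolated_count_def of_bool_def sum.If_cases Int_def)

text \<open>Given the type of \<open>v\<close>, the other vertices miss \<open>v\<close>
  independently, each with a probability that equal row sums make the same for all types of
  \<open>v\<close>.\<close>

lemma EJ_isolated:
  assumes v: "v < n" shows "EJ (\<lambda>(\<sigma>, E). of_bool (v \<notin> \<Union>E)) = iso_prob"
proof -
  have "EJ (\<lambda>(\<sigma>, E). of_bool (v \<notin> \<Union>E)) = EJ (\<lambda>(\<sigma>, E). of_bool (star v ({..<n} - {v}) \<inter> E = {}))"
    by (rule EJ_cong) (use isolated_iff v in auto)
  also have "\<dots> = ET (\<lambda>\<sigma>. \<Prod>e\<in>star v ({..<n} - {v}). 1 - q \<sigma> e)"
    by (rule EJ_disjoint, rule star_pairs) (use v in auto)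
  also have "\<dots> = ET (\<lambda>\<sigma>. 1 * (\<Prod>u\<in>{..<n} - {v}. 1 - W $$ (\<sigma> v, \<sigma> u) / real n))"
    by (rule ET_cong) (use prod_star v in auto)
  also have "\<dots> = ET (\<lambda>\<sigma>. 1 * ((\<Sum>t<r. 1 - W $$ (\<sigma> v, t) / real n) / real r) ^ card ({..<n} - {v}))"
    by (rule ET_independent_prod[where h = "\<lambda>\<sigma> t. 1 - W $$ (\<sigma> v, t) / real n"]) auto
  also have "\<dots> = ET (\<lambda>_. iso_prob)"
  proof (rule ET_cong)
    fix \<sigma> assume "\<And>v. v < n \<Longrightarrow> \<sigma> v < r"
    then have "(\<Sum>t<r. 1 - W $$ (\<sigma> v, t) / real n) / real r = 1 - \<alpha> / real n"
      using r_pos v row_sum[of "\<sigma> v"] by (simp add: sum_subtractf sum_divide_distrib[symmetric] diff_divide_distrib)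
    then show "1 * ((\<Sum>t<r. 1 - W $$ (\<sigma> v, t) / real n) / real r) ^ card ({..<n} - {v}) = iso_prob"
      using v by (simp add: iso_prob_def)
  qed
  finally show ?thesis by simp
qed

lemma EJ_isolated_pair:
  assumes v: "v < n" "v' < n" "v \<noteq> v'"
  shows "EJ (\<lambda>(\<sigma>, E). of_bool (v \<notin> \<Union>E) * of_bool (v' \<notin> \<Union>E)) \<le> iso_pair_prob"
proof -
  define A where "A = {..<n} - {v, v'}"
  define h where "h = (\<lambda>\<sigma> t. (1 - W $$ (\<sigma> v, t) / real n) * (1 - W $$ (\<sigma> v', t) / real n))"
  have sub: "star v A \<subseteq> pairs n" "star v' A \<subseteq> pairs n" by (rule star_pairs; use v in \<open>auto simp: A_def\<close>)+
  have disj: "star v A \<inter> star v' A = {}" using v by (auto simp: star_def A_def doubleton_eq_iff)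
  have "EJ (\<lambda>(\<sigma>, E). of_bool (v \<notin> \<Union>E) * of_bool (v' \<notin> \<Union>E)) \<le>
     EJ (\<lambda>(\<sigma>, E). of_bool ((star v A \<union> star v' A) \<inter> E = {}))"
    by (rule EJ_mono) (auto simp: star_def)
  also have "\<dots> = ET (\<lambda>\<sigma>. \<Prod>e\<in>star v A \<union> star v' A. 1 - q \<sigma> e)"
    by (rule EJ_disjoint) (use sub in auto)
  also have "\<dots> = ET (\<lambda>\<sigma>. 1 * (\<Prod>u\<in>A. h \<sigma> (\<sigma> u)))"
  proof (rule ET_cong)
    fix \<sigma> assume \<sigma>: "\<And>v. v < n \<Longrightarrow> \<sigma> v < r"
    have "(\<Prod>e\<in>star v A \<union> star v' A. 1 - q \<sigma> e) = (\<Prod>e\<in>star v A. 1 - q \<sigma> e) * (\<Prod>e\<in>star v' A. 1 - q \<sigma> e)"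
      by (rule prod.union_disjoint[OF _ _ disj]) (auto simp: star_def A_def)
    also have "(\<Prod>e\<in>star v A. 1 - q \<sigma> e) = (\<Prod>u\<in>A. 1 - W $$ (\<sigma> v, \<sigma> u) / real n)"
      by (rule prod_star) (use v \<sigma> in \<open>auto simp: A_def\<close>)
    also have "(\<Prod>e\<in>star v' A. 1 - q \<sigma> e) = (\<Prod>u\<in>A. 1 - W $$ (\<sigma> v', \<sigma> u) / real n)"
      by (rule prod_star) (use v \<sigma> in \<open>auto simp: A_def\<close>)
    finally show "(\<Prod>e\<in>star v A \<union> star v' A. 1 - q \<sigma> e) = 1 * (\<Prod>u\<in>A. h \<sigma> (\<sigma> u))"
      by (simp add: h_def prod.distrib)
  qed
  also have "\<dots> = ET (\<lambda>\<sigma>. 1 * ((\<Sum>t<r. h \<sigma> t) / real r) ^ card A)"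
    by (rule ET_independent_prod) (auto simp: A_def h_def)
  also have "\<dots> \<le> ET (\<lambda>_. iso_pair_prob)"
  proof (rule ET_mono)
    fix \<sigma> assume \<sigma>: "\<And>v. v < n \<Longrightarrow> \<sigma> v < r"
    define x where "x = (\<lambda>t. W $$ (\<sigma> v, t) / real n)"
    define y where "y = (\<lambda>t. W $$ (\<sigma> v', t) / real n)"
    have xy: "0 \<le> x t \<and> x t \<le> w / real n \<and> 0 \<le> y t \<and> y t \<le> w / real n" if "t < r" for t
      using that \<sigma> v W_nonneg W_le n_pos by (auto simp: x_def y_def divide_right_mono)
    have w1: "w / real n \<le> 1" using w_le n_pos by simp
    have h: "h \<sigma> t = 1 - x t - y t + x t * y t" for t by (simp add: h_def x_def y_def algebra_simps)
    have h0: "h \<sigma> t \<ge> 0" if "t < r" for t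
      unfolding h_def x_def[symmetric] y_def[symmetric]
      using xy[OF that] w1 by (intro mult_nonneg_nonneg) (auto simp: x_def y_def)
    have "(\<Sum>t<r. h \<sigma> t) \<le> (\<Sum>t<r. 1 - x t - y t + (w / real n) * (w / real n))"
      unfolding h by (intro sum_mono add_left_mono mult_mono) (use xy w_nonneg in auto)
    also have "\<dots> = real r * (1 - 2 * \<alpha> / real n + w\<^sup>2 / (real n)\<^sup>2)"
      using row_sum[of "\<sigma> v"] row_sum[of "\<sigma> v'"] \<sigma> v
      by (simp add: sum.distrib sum_subtractf x_def y_def sum_divide_distrib[symmetric] power2_eq_square algebra_simps)
    finally have "(\<Sum>t<r. h \<sigma> t) / real r \<le> 1 - 2 * \<alpha> / real n + w\<^sup>2 / (real n)\<^sup>2"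
      using r_pos by (simp add: divide_le_eq mult.commute)
    moreover have "0 \<le> (\<Sum>t<r. h \<sigma> t) / real r" by (intro divide_nonneg_nonneg sum_nonneg) (use h0 in auto)
    ultimately have "((\<Sum>t<r. h \<sigma> t) / real r) ^ (n - 2) \<le> iso_pair_prob"
      unfolding iso_pair_prob_def by (intro power_mono)
    moreover have "card A = n - 2" using v by (simp add: A_def card_Diff_subset)
    ultimately show "1 * ((\<Sum>t<r. h \<sigma> t) / real r) ^ card A \<le> iso_pair_prob" by simp
  qed
  finally show ?thesis by simp
qed

text \<open>The diagonal contributes \<open>n\<close>. Taking the absolute value of
  \<open>iso_pair_prob\<close> allows it to be added on the diagonal as well, so that the double sum
  has a closed form.\<close>

lemma EJ_isolated_count_variance:
  "EJ (\<lambda>(\<sigma>, E). (isolated_count E - real n * iso_prob)\<^sup>2) \<le>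
     real n + (real n)\<^sup>2 * (\<bar>iso_pair_prob\<bar> - iso_prob\<^sup>2)"
proof -
  let ?m = "real n * iso_prob"
  have first: "EJ (\<lambda>(\<sigma>, E). isolated_count E) = ?m"
  proof -
    have "EJ (\<lambda>(\<sigma>, E). isolated_count E) = EJ (\<lambda>\<omega>. \<Sum>v<n. (\<lambda>(\<sigma>, E). of_bool (v \<notin> \<Union>E)) \<omega>)"
      by (simp add: isolated_count_sum case_prod_unfold)
    also have "\<dots> = (\<Sum>v<n. EJ (\<lambda>(\<sigma>, E). of_bool (v \<notin> \<Union>E)))" by (rule EJ_sum) simp
    also have "\<dots> = (\<Sum>v<n. iso_prob)" by (rule sum.cong) (use EJ_isolated in auto)
    finally show ?thesis by simp
  qed
  have second: "EJ (\<lambda>(\<sigma>, E). (isolated_count E)\<^sup>2) \<le> real n + (real n)\<^sup>2 * \<bar>iso_pair_prob\<bar>"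
  proof -
    define f where "f = (\<lambda>(v :: nat) (v' :: nat). \<lambda>(\<sigma> :: nat \<Rightarrow> nat, E). of_bool (v \<notin> \<Union>E) * of_bool (v' \<notin> \<Union>E) :: real)"
    have "EJ (\<lambda>(\<sigma>, E). (isolated_count E)\<^sup>2) = EJ (\<lambda>\<omega>. \<Sum>v<n. \<Sum>v'<n. f v v' \<omega>)"
      by (rule arg_cong[where f = EJ])
        (simp only: fun_eq_iff split_paired_All prod.case f_def isolated_count_sum power2_eq_square sum_product simp_thms)
    also have "\<dots> = (\<Sum>v<n. \<Sum>v'<n. EJ (f v v'))" by (simp add: EJ_sum)
    also have "\<dots> \<le> (\<Sum>v<n. \<Sum>v'<n. (if v' = v then 1 else 0) + \<bar>iso_pair_prob\<bar>)"
    proof (intro sum_mono)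
      fix v v' assume v: "v \<in> {..<n}" "v' \<in> {..<n}"
      show "EJ (f v v') \<le> (if v' = v then 1 else 0) + \<bar>iso_pair_prob\<bar>"
      proof (cases "v' = v")
        case True
        have "EJ (f v v') \<le> EJ (\<lambda>_. 1)" by (rule EJ_mono) (auto simp: f_def)
        then show ?thesis using True by simp
      next
        case False
        then show ?thesis using EJ_isolated_pair[of v v'] v by (simp add: f_def)
      qed
    qed
    also have "\<dots> = real n + (real n)\<^sup>2 * \<bar>iso_pair_prob\<bar>"
      by (simp add: sum.distrib power2_eq_square algebra_simps)
    finally show ?thesis .
  qed
  have "EJ (\<lambda>(\<sigma>, E). (isolated_count E - ?m)\<^sup>2) =
    EJ (\<lambda>\<omega>. (\<lambda>(\<sigma>, E). (isolated_count E)\<^sup>2) \<omega> - (2 * ?m) * (\<lambda>(\<sigma>, E). isolated_count E) \<omega> + ?m\<^sup>2)"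
    by (rule arg_cong[where f = EJ]) (auto simp: fun_eq_iff power2_eq_square algebra_simps)
  also have "\<dots> = EJ (\<lambda>(\<sigma>, E). (isolated_count E)\<^sup>2) - (2 * ?m) * EJ (\<lambda>(\<sigma>, E). isolated_count E) + ?m\<^sup>2"
    by (simp only: EJ_add EJ_diff EJ_cmult EJ_const)
  also have "\<dots> \<le> real n + (real n)\<^sup>2 * \<bar>iso_pair_prob\<bar> - (2 * ?m) * ?m + ?m\<^sup>2"
    using second by (simp add: first)
  finally show ?thesis by (simp add: power2_eq_square algebra_simps)
qed

section \<open>Vertex pairs at distance l, sorted by their types\<close>

definition ind :: "nat \<Rightarrow> nat \<Rightarrow> real" where
  "ind a s = of_bool (s = a)"

definition pair_count :: "(nat \<Rightarrow> nat) \<Rightarrow> nat set set \<Rightarrow> nat \<Rightarrow> nat \<Rightarrow> nat \<Rightarrow> real" where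
  "pair_count \<sigma> E l a b = real (card {(v, w). v < n \<and> w < n \<and> graph_dist E v w = enat l \<and> \<sigma> v = a \<and> \<sigma> w = b})"

text \<open>Rigid paths inject into the pairs at distance \<open>l\<close>, every such pair carries
  a path, and the two path counts differ by the non-rigid paths only.\<close>

lemma pair_count_close:
  assumes E: "E \<subseteq> pairs n" and l: "l > 0"
  shows "\<bar>pair_count \<sigma> E l a b - x\<bar> \<le> \<bar>rigid_sum (ind a) (ind b) l (\<sigma>, E) - x\<bar> +
     real (card {P \<in> saws n l. edges P \<subseteq> E \<and> \<not> rigid E l P})"
proof -
  let ?K = "\<lambda>v w. \<sigma> v = a \<and> \<sigma> w = b"
  let ?R = "{P \<in> saws n l. edges P \<subseteq> E \<and> rigid E l P \<and> ?K (hd P) (last P)}"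
  let ?P = "{P \<in> saws n l. edges P \<subseteq> E \<and> ?K (hd P) (last P)}"
  let ?N = "{P \<in> saws n l. edges P \<subseteq> E \<and> \<not> rigid E l P}"
  have fin: "finite {P \<in> saws n l. C P}" for C by simp
  have "rigid_sum (ind a) (ind b) l (\<sigma>, E) =
     (\<Sum>P\<in>{P \<in> saws n l. edges P \<subseteq> E \<and> rigid E l P}. if ?K (hd P) (last P) then 1 else 0)"
    unfolding rigid_sum_def prod.case by (rule sum.cong) (auto simp: ind_def)
  also have "\<dots> = real (card {P \<in> {P \<in> saws n l. edges P \<subseteq> E \<and> rigid E l P}. ?K (hd P) (last P)})"
    by (simp add: sum.If_cases Int_def)
  also have "{P \<in> {P \<in> saws n l. edges P \<subseteq> E \<and> rigid E l P}. ?K (hd P) (last P)} = ?R" by auto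
  finally have R: "rigid_sum (ind a) (ind b) l (\<sigma>, E) = real (card ?R)" .
  have "?P \<subseteq> ?R \<union> ?N" by auto
  then have "card ?P \<le> card (?R \<union> ?N)" by (rule card_mono[rotated]) simp
  also have "\<dots> \<le> card ?R + card ?N" by (rule card_Un_le)
  finally have "card ?P \<le> card ?R + card ?N" .
  moreover have "card ?R \<le> card {(v, w). v < n \<and> w < n \<and> graph_dist E v w = enat l \<and> ?K v w}"
    by (rule card_dist_pairs_bounds(1)[OF E l, where K = ?K])
  moreover have "card {(v, w). v < n \<and> w < n \<and> graph_dist E v w = enat l \<and> ?K v w} \<le> card ?P"
    by (rule card_dist_pairs_bounds(2)[OF E l, where K = ?K])
  ultimately have "pair_count \<sigma> E l a b \<ge> rigid_sum (ind a) (ind b) l (\<sigma>, E)"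
    "pair_count \<sigma> E l a b \<le> rigid_sum (ind a) (ind b) l (\<sigma>, E) + real (card ?N)"
    unfolding R pair_count_def by linarith+
  then show ?thesis by linarith
qed

text \<open>The number of self-avoiding walks is \<open>n ^ Suc m\<close> up to a relative error
  \<open>(m + 1)\<^sup>2 / n\<close>, and \<open>pair_mean\<close> lies between 0 and
  \<open>\<alpha> ^ m\<close>.\<close>

lemma path_mean_close:
  assumes fg: "\<And>s. s < r \<Longrightarrow> 0 \<le> f s \<and> f s \<le> 1" "\<And>s. s < r \<Longrightarrow> 0 \<le> g s \<and> g s \<le> 1"
  shows "\<bar>path_mean f g m - real n * pair_mean f g m\<bar> \<le> (real m + 1)\<^sup>2 * \<alpha> ^ m"
    "0 \<le> pair_mean f g m" "path_mean f g m \<le> real n * \<alpha> ^ m"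
proof -
  let ?p = "pair_mean f g m"
  have T: "0 \<le> (type_op ^^ m) g s" "(type_op ^^ m) g s \<le> \<alpha> ^ m" if "s < r" for s
    using type_op_pow_nonneg[of g s m] type_op_pow_mono[of g "\<lambda>_. 1" s m] type_op_pow_const[of s m 1] fg that by auto
  show p0: "0 \<le> ?p"
    unfolding pair_mean_def using fg T by (intro divide_nonneg_nonneg sum_nonneg mult_nonneg_nonneg) auto
  have "(\<Sum>s<r. f s * (type_op ^^ m) g s) \<le> (\<Sum>s<r. 1 * \<alpha> ^ m)"
    by (intro sum_mono mult_mono) (use fg T in auto)
  then have p1: "?p \<le> \<alpha> ^ m" using r_pos by (simp add: pair_mean_def divide_le_eq mult.commute)
  define N where "N = real (card (saws n m)) / real n ^ m"
  have pm: "path_mean f g m = N * ?p" by (simp add: path_mean_def N_def)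
  have "real (card (saws n m)) \<le> real (n ^ Suc m)" using card_saws_le by (rule of_nat_mono)
  then have N1: "N \<le> real n" using n_pos by (simp add: N_def divide_le_eq)
  have "real n ^ Suc m * (1 - (real m + 1)\<^sup>2 / real n) = (real n - (real m + 1)\<^sup>2) * real n ^ m"
    using n_pos by (simp add: field_simps)
  then have "(real n - (real m + 1)\<^sup>2) * real n ^ m \<le> real (card (saws n m))"
    using card_saws_ge[OF n_pos, of m] by (simp only:)
  then have N2: "real n - (real m + 1)\<^sup>2 \<le> N"
    using n_pos by (simp add: N_def le_divide_eq)
  have "\<bar>N - real n\<bar> * ?p \<le> (real m + 1)\<^sup>2 * \<alpha> ^ m"
    by (intro mult_mono) (use N1 N2 p0 p1 in auto)
  moreover have "path_mean f g m - real n * ?p = (N - real n) * ?p" by (simp add: pm left_diff_distrib)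
  ultimately show "\<bar>path_mean f g m - real n * ?p\<bar> \<le> (real m + 1)\<^sup>2 * \<alpha> ^ m"
    using p0 by (simp add: abs_mult)
  show "path_mean f g m \<le> real n * \<alpha> ^ m" unfolding pm by (intro mult_mono) (use N1 p0 p1 in auto)
qed

lemma type_op_pow_linear:
  "s < r \<Longrightarrow> (type_op ^^ k) g s = (\<Sum>b<r. (type_op ^^ k) (ind b) s * g b)"
proof (induction k arbitrary: s)
  case 0
  then show ?case by (simp add: ind_def)
next
  case (Suc k)
  have "(type_op ^^ Suc k) g s = (\<Sum>t<r. \<Sum>b<r. W $$ (s, t) / real r * ((type_op ^^ k) (ind b) t * g b))"
    unfolding funpow.simps comp_def type_op_def[of _ s] using Suc.IH by (simp add: sum_distrib_left)
  also have "\<dots> = (\<Sum>b<r. \<Sum>t<r. W $$ (s, t) / real r * ((type_op ^^ k) (ind b) t * g b))" by (rule sum.swap)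
  also have "\<dots> = (\<Sum>b<r. (type_op ^^ Suc k) (ind b) s * g b)"
    unfolding funpow.simps comp_def type_op_def[of _ s] sum_distrib_right
    by (intro sum.cong refl) (simp add: mult_ac)
  finally show ?case .
qed

lemma pair_mean_ind: "a < r \<Longrightarrow> pair_mean (ind a) g m = (type_op ^^ m) g a / real r"
  by (simp add: pair_mean_def ind_def sum_of_bool_delta)

text \<open>The sum \<open>h a\<close> of the image under \<open>D\<close> over the vertices of type
  \<open>a\<close> is a combination of pair counts, close to \<open>n / r\<close> times the
  \<open>l\<close>-th power of \<open>M\<close> applied to \<open>g\<close>; the error may use up
  half of the growth. The estimate works with sums of absolute values, like the growth hypothesis,
  and returns to squares only at the end.\<close>

lemma distance_operator_growth:
  fixes g :: "nat \<Rightarrow> real"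
  defines "d \<equiv> \<lambda>E l i j. distance_matrix n E l $$ (i, j)"
  assumes \<sigma>: "\<And>v. v < n \<Longrightarrow> \<sigma> v < r"
    and close: "\<And>a b. a < r \<Longrightarrow> b < r \<Longrightarrow> \<bar>pair_count \<sigma> E l a b - real n * pair_mean (ind a) (ind b) l\<bar> \<le> err"
    and grow: "c * (\<Sum>s<r. \<bar>g s\<bar>) \<le> (\<Sum>s<r. \<bar>(type_op ^^ l) g s\<bar>)" and c: "c > 0"
    and err: "real r * err \<le> real n * c / (2 * real r)"
    and g: "(\<Sum>s<r. \<bar>g s\<bar>) > 0"
  shows "ip n (\<lambda>v. g (\<sigma> v)) (\<lambda>v. g (\<sigma> v)) > 0 \<and>
    (c / (2 * real r))\<^sup>2 * ip n (\<lambda>v. g (\<sigma> v)) (\<lambda>v. g (\<sigma> v)) \<le>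
      ip n (mv n (d E l) (\<lambda>v. g (\<sigma> v))) (mv n (d E l) (\<lambda>v. g (\<sigma> v)))"
proof -
  define f where "f = (\<lambda>v. g (\<sigma> v))"
  define D where "D = mv n (d E l) f"
  define G where "G = (\<Sum>s<r. \<bar>g s\<bar>)"
  define h where "h = (\<lambda>a. \<Sum>b<r. pair_count \<sigma> E l a b * g b)"
  have pc: "pair_count \<sigma> E l a b = (\<Sum>v<n. \<Sum>w<n. d E l v w * of_bool (\<sigma> v = a) * of_bool (\<sigma> w = b))" for a b
  proof -
    let ?X = "{(v, w). v < n \<and> w < n \<and> graph_dist E v w = enat l \<and> \<sigma> v = a \<and> \<sigma> w = b}"
    have "(\<Sum>v<n. \<Sum>w<n. d E l v w * of_bool (\<sigma> v = a) * of_bool (\<sigma> w = b)) =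
      (\<Sum>vw\<in>{..<n} \<times> {..<n}. if vw \<in> ?X then 1 else 0)"
      unfolding sum.cartesian_product by (rule sum.cong) (auto simp: d_def distance_matrix_index)
    also have "\<dots> = real (card (({..<n} \<times> {..<n}) \<inter> ?X))" by (simp add: sum.If_cases)
    also have "({..<n} \<times> {..<n}) \<inter> ?X = ?X" by auto
    finally show ?thesis by (simp add: pair_count_def)
  qed
  have hD: "h a = (\<Sum>v<n. of_bool (\<sigma> v = a) * D v)" for a
  proof -
    have "h a = (\<Sum>b<r. \<Sum>v<n. \<Sum>w<n. d E l v w * of_bool (\<sigma> v = a) * (of_bool (\<sigma> w = b) * g b))"
      unfolding h_def pc by (simp add: sum_distrib_right mult.assoc)
    also have "\<dots> = (\<Sum>v<n. \<Sum>b<r. \<Sum>w<n. d E l v w * of_bool (\<sigma> v = a) * (of_bool (\<sigma> w = b) * g b))" by (rule sum.swap)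
    also have "\<dots> = (\<Sum>v<n. \<Sum>w<n. \<Sum>b<r. d E l v w * of_bool (\<sigma> v = a) * (of_bool (\<sigma> w = b) * g b))"
      by (rule sum.cong[OF refl], rule sum.swap)
    also have "\<dots> = (\<Sum>v<n. \<Sum>w<n. d E l v w * of_bool (\<sigma> v = a) * f w)"
    proof (intro sum.cong refl)
      fix v w assume "w \<in> {..<n}"
      then have "(\<Sum>b<r. of_bool (\<sigma> w = b) * g b) = f w"
        using \<sigma> by (simp add: f_def sum_of_bool_delta')
      then show "(\<Sum>b<r. d E l v w * of_bool (\<sigma> v = a) * (of_bool (\<sigma> w = b) * g b)) = d E l v w * of_bool (\<sigma> v = a) * f w"
        by (simp only: sum_distrib_left[symmetric])
    qed
    also have "\<dots> = (\<Sum>v<n. of_bool (\<sigma> v = a) * D v)"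
      by (simp add: D_def mv_def sum_distrib_left mult_ac)
    finally show ?thesis .
  qed
  have up: "(\<Sum>a<r. \<bar>h a\<bar>) \<le> (\<Sum>v<n. \<bar>D v\<bar>)"
  proof -
    have "(\<Sum>a<r. \<bar>h a\<bar>) \<le> (\<Sum>a<r. \<Sum>v<n. of_bool (\<sigma> v = a) * \<bar>D v\<bar>)"
      unfolding hD by (intro sum_mono order_trans[OF sum_abs]) (simp add: abs_mult)
    also have "\<dots> = (\<Sum>v<n. \<Sum>a<r. of_bool (\<sigma> v = a) * \<bar>D v\<bar>)" by (rule sum.swap)
    also have "\<dots> = (\<Sum>v<n. \<bar>D v\<bar>)"
    proof (rule sum.cong[OF refl])
      fix v assume "v \<in> {..<n}"
      then show "(\<Sum>a<r. of_bool (\<sigma> v = a) * \<bar>D v\<bar>) = \<bar>D v\<bar>"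
        using \<sigma> by (simp add: sum_of_bool_delta')
    qed
    finally show ?thesis .
  qed
  have low: "(\<Sum>a<r. \<bar>h a\<bar>) \<ge> real n * c / (2 * real r) * G"
  proof -
    have "(\<Sum>a<r. \<bar>h a\<bar>) \<ge> (\<Sum>a<r. real n / real r * \<bar>(type_op ^^ l) g a\<bar> - err * G)"
    proof (rule sum_mono)
      fix a assume a: "a \<in> {..<r}"
      have lin: "real n / real r * (type_op ^^ l) g a = (\<Sum>b<r. real n * pair_mean (ind a) (ind b) l * g b)"
        using a by (simp add: type_op_pow_linear[of a l g] pair_mean_ind sum_distrib_left mult_ac)
      have diff: "real n / real r * (type_op ^^ l) g a - h a =
          (\<Sum>b<r. (real n * pair_mean (ind a) (ind b) l - pair_count \<sigma> E l a b) * g b)"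
        unfolding lin h_def by (simp only: sum_subtractf[symmetric] left_diff_distrib)
      have "\<bar>real n / real r * (type_op ^^ l) g a - h a\<bar> \<le> (\<Sum>b<r. \<bar>(real n * pair_mean (ind a) (ind b) l - pair_count \<sigma> E l a b) * g b\<bar>)"
        unfolding diff by (rule sum_abs)
      also have "\<dots> \<le> (\<Sum>b<r. err * \<bar>g b\<bar>)"
      proof (rule sum_mono)
        fix b assume "b \<in> {..<r}"
        then have "\<bar>real n * pair_mean (ind a) (ind b) l - pair_count \<sigma> E l a b\<bar> \<le> err"
          using close[of a b] a by (subst abs_minus_commute) simp
        then show "\<bar>(real n * pair_mean (ind a) (ind b) l - pair_count \<sigma> E l a b) * g b\<bar> \<le> err * \<bar>g b\<bar>"
          unfolding abs_mult by (rule mult_right_mono) simp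
      qed
      also have "\<dots> = err * G" by (simp add: G_def sum_distrib_left)
      finally have "\<bar>real n / real r * (type_op ^^ l) g a - h a\<bar> \<le> err * G" .
      moreover have "\<bar>real n / real r * (type_op ^^ l) g a\<bar> = real n / real r * \<bar>(type_op ^^ l) g a\<bar>"
        by (simp add: abs_mult)
      moreover have "\<bar>X\<bar> - z \<le> \<bar>y\<bar>" if "\<bar>X - y\<bar> \<le> z" for X y z :: real
        using that by linarith
      ultimately show "real n / real r * \<bar>(type_op ^^ l) g a\<bar> - err * G \<le> \<bar>h a\<bar>" by metis
    qed
    also have "(\<Sum>a<r. real n / real r * \<bar>(type_op ^^ l) g a\<bar> - err * G) =
       real n / real r * (\<Sum>a<r. \<bar>(type_op ^^ l) g a\<bar>) - real r * err * G"
      by (simp add: sum_subtractf sum_distrib_left)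
    finally have "real n / real r * (\<Sum>a<r. \<bar>(type_op ^^ l) g a\<bar>) - real r * err * G \<le> (\<Sum>a<r. \<bar>h a\<bar>)" .
    moreover have "real n / real r * (c * G) \<le> real n / real r * (\<Sum>a<r. \<bar>(type_op ^^ l) g a\<bar>)"
      by (rule mult_left_mono) (use grow in \<open>auto simp: G_def\<close>)
    moreover have "real r * err * G \<le> real n * c / (2 * real r) * G"
      by (rule mult_right_mono[OF err]) (use g in \<open>simp add: G_def\<close>)
    moreover have "real n / real r * (c * G) = real n * c / (2 * real r) * G + real n * c / (2 * real r) * G"
      using r_pos by (simp add: field_simps)
    ultimately show ?thesis by linarith
  qed
  define t where "t = c / (2 * real r)"
  have t: "t > 0" using c r_pos by (simp add: t_def)
  have G: "G > 0" using g by (simp add: G_def)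
  have "real n * t * G \<le> (\<Sum>v<n. \<bar>D v\<bar>)" using low up by (simp add: t_def)
  \<comment> \<open>The factor \<open>n\<close> lost here to Cauchy-Schwarz is recovered from
    \<open>ip n f f \<le> n * G\<^sup>2\<close> below.\<close>
  then have "(real n * t * G)\<^sup>2 \<le> (\<Sum>v<n. \<bar>D v\<bar>)\<^sup>2" by (rule power_mono) (use t G in auto)
  also have "(\<Sum>v<n. \<bar>D v\<bar>)\<^sup>2 \<le> real n * ip n D D"
    using ip_Cauchy_Schwarz[of n "\<lambda>_. 1" "\<lambda>v. \<bar>D v\<bar>"] by (simp add: ip_def)
  finally have DD: "real n * (t * G)\<^sup>2 \<le> ip n D D" using n_pos by (simp add: power2_eq_square mult_ac)
  have "ip n f f \<le> (\<Sum>v<n. G\<^sup>2)"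
    unfolding ip_def
  proof (rule sum_mono)
    fix v assume "v \<in> {..<n}"
    then have "\<bar>f v\<bar> \<le> G" unfolding f_def G_def
      using \<sigma> by (intro member_le_sum[where f = "\<lambda>s. \<bar>g s\<bar>"]) auto
    then have "\<bar>f v\<bar>\<^sup>2 \<le> G\<^sup>2" by (rule power_mono) simp
    then show "f v * f v \<le> G\<^sup>2" by (simp add: power2_eq_square)
  qed
  then have "t\<^sup>2 * ip n f f \<le> t\<^sup>2 * (real n * G\<^sup>2)" by (intro mult_left_mono) auto
  also have "\<dots> \<le> ip n D D" using DD by (simp add: power_mult_distrib mult_ac)
  finally have main: "t\<^sup>2 * ip n f f \<le> ip n D D" .
  \<comment> \<open>If \<open>f\<close> vanished at all vertices, so would \<open>D f\<close>,
    against the lower bound; thus \<open>g\<close> cannot be supported on types that do not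
    occur.\<close>
  have "ip n f f \<noteq> 0"
  proof
    assume "ip n f f = 0"
    then have "D v = 0" for v using ip_self_eq_0[of n f] by (auto simp: D_def mv_def intro!: sum.neutral)
    then have "ip n D D = 0" by (simp add: ip_def)
    then have "real n * (t * G)\<^sup>2 \<le> 0" using DD by simp
    then show False using n_pos t G by (simp add: mult_le_0_iff)
  qed
  then have "ip n f f > 0" using ip_self_nonneg[of n f] by simp
  then show ?thesis using main by (simp add: f_def D_def t_def)
qed

end

section \<open>A good centre\<close>


lemma graph_dist_lt:
  assumes "E \<subseteq> pairs n" "graph_dist E i j = enat k" "k > 0" shows "i < n" "j < n"
proof -
  obtain xs where xs: "path_in E xs" "length xs = Suc k" "hd xs = i" "last xs = j"
    using assms(2) by (rule graph_dist_path)
  have "set xs \<subseteq> {..<n}"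
    by (rule set_subset_if_edges) (use xs assms in \<open>auto simp: path_in_def\<close>)
  moreover have "hd xs \<in> set xs" "last xs \<in> set xs" using xs by (auto simp: path_in_def)
  ultimately show "i < n" "j < n" using xs by auto
qed

definition dist_sphere :: "nat \<Rightarrow> nat set set \<Rightarrow> nat \<Rightarrow> nat \<Rightarrow> nat set" where
  "dist_sphere n E v m = {x. x < n \<and> graph_dist E v x = enat m}"

context block_model
begin

definition nonrigid_count :: "nat set set \<Rightarrow> nat \<Rightarrow> real" where
  "nonrigid_count E l = real (card {P \<in> saws n l. edges P \<subseteq> E \<and> \<not> rigid E l P})"

text \<open>Paths with the same first vertex meet, so this dominates the sum over \<open>v\<close>
  of the squared number of rigid paths from \<open>v\<close>.\<close>

definition meeting_count :: "nat set set \<Rightarrow> nat \<Rightarrow> real" where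
  "meeting_count E m = real (card {(P, P'). P \<in> saws n m \<and> P' \<in> saws n m \<and> set P \<inter> set P' \<noteq> {} \<and>
      edges P \<subseteq> E \<and> edges P' \<subseteq> E \<and> rigid E m P})"

definition nonuniq_count :: "nat set set \<Rightarrow> nat \<Rightarrow> real" where
  "nonuniq_count E R = real (card {v. v < n \<and> \<not> uniq E R v})"

text \<open>The sum, over all \<open>v\<close> with unique paths, of the squared norm of
  \<open>D s\<close>, where \<open>s\<close> is the indicator of the sphere of radius
  \<open>m\<close> about \<open>v\<close>: expanding the square gives pairs \<open>x\<close>,
  \<open>x'\<close> of points of the sphere.\<close>

definition two_step_count :: "nat set set \<Rightarrow> nat \<Rightarrow> nat \<Rightarrow> real" where
  "two_step_count E l m = real (card {(v, w, x, x'). v < n \<and> uniq E (2 * l) v \<and> graph_dist E v x = enat m \<and>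
      graph_dist E v x' = enat m \<and> graph_dist E x w = enat l \<and> graph_dist E x' w = enat l})"

text \<open>A union bound over the length \<open>m\<close> of the path that fails to be rigid
  against competitors with up to \<open>R\<close> edges.\<close>

lemma EJ_nonuniq: "EJ (\<lambda>(\<sigma>, E). nonuniq_count E R) \<le> (real R + 1) ^ 3 * real R * w * \<alpha> ^ (2 * R)"
proof -
  have "EJ (\<lambda>(\<sigma>, E). nonuniq_count E R) \<le>
     EJ (\<lambda>\<omega>. \<Sum>m\<le>R. (\<lambda>(\<sigma>, E). real (card {P \<in> saws n m. edges P \<subseteq> E \<and> \<not> rigid E R P})) \<omega>)"
  proof (rule EJ_mono, unfold prod.case)
    fix E assume E: "E \<subseteq> pairs n"
    let ?N = "\<lambda>m. {P \<in> saws n m. edges P \<subseteq> E \<and> \<not> rigid E R P}"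
    have "{v. v < n \<and> \<not> uniq E R v} \<subseteq> hd ` (\<Union>m\<le>R. ?N m)"
    proof clarify
      fix v assume "v < n" "\<not> uniq E R v"
      then obtain m P where "m \<le> R" "P \<in> saws n m" "hd P = v" "edges P \<subseteq> E" "\<not> rigid E R P"
        by (rule not_uniq_imp_not_rigid[OF E])
      then show "v \<in> hd ` (\<Union>m\<le>R. ?N m)" by (intro image_eqI[of _ _ P]) auto
    qed
    then have "card {v. v < n \<and> \<not> uniq E R v} \<le> card (\<Union>m\<le>R. ?N m)"
      by (rule surj_card_le[rotated]) simp
    also have "\<dots> \<le> (\<Sum>m\<le>R. card (?N m))" by (rule card_UN_le) simp
    finally show "nonuniq_count E R \<le> (\<Sum>m\<le>R. real (card (?N m)))"
      unfolding nonuniq_count_def of_nat_sum[symmetric] by (rule of_nat_mono)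
  qed
  also have "\<dots> = (\<Sum>m\<le>R. EJ (\<lambda>(\<sigma>, E). real (card {P \<in> saws n m. edges P \<subseteq> E \<and> \<not> rigid E R P})))"
    by (rule EJ_sum) simp
  also have "\<dots> \<le> (\<Sum>m\<le>R. (real R + 1)\<^sup>2 * real R * w * \<alpha> ^ (2 * R))"
  proof (rule sum_mono)
    fix m assume m: "m \<in> {..R}"
    have "EJ (\<lambda>(\<sigma>, E). real (card {P \<in> saws n m. edges P \<subseteq> E \<and> \<not> rigid E R P})) \<le>
      (real m + 1)\<^sup>2 * real R * w * \<alpha> ^ (m + R)" by (rule EJ_not_rigid)
    also have "\<dots> \<le> (real R + 1)\<^sup>2 * real R * w * \<alpha> ^ (2 * R)"
      by (intro mult_mono power_mono power_increasing) (use m w_nonneg \<alpha>_ge in auto)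
    finally show "EJ (\<lambda>(\<sigma>, E). real (card {P \<in> saws n m. edges P \<subseteq> E \<and> \<not> rigid E R P})) \<le>
      (real R + 1)\<^sup>2 * real R * w * \<alpha> ^ (2 * R)" .
  qed
  finally show ?thesis by (simp add: power3_eq_cube power2_eq_square algebra_simps)
qed

text \<open>An averaging argument. The numbers \<open>Y v\<close> of rigid \<open>m\<close>-paths
  add up to at least \<open>3 / 4 * n * \<alpha> ^ m\<close>, of which vertices without unique paths
  carry at most \<open>n * \<alpha> ^ m / 4\<close>. If each remaining vertex had \<open>Y v\<close>
  too small or \<open>Z v\<close>, which bounds the squared norm, too large relative to
  \<open>Y v\<close>, the rest would stay below \<open>n * \<alpha> ^ m / 2\<close>. Rigid paths
  from \<open>v\<close> have distinct ends, so the sphere has at least \<open>Y v\<close>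
  points.\<close>

lemma good_centre:
  fixes K :: real
  defines "d \<equiv> \<lambda>E l i j. distance_matrix n E l $$ (i, j)"
  assumes E: "E \<subseteq> pairs n" and l: "l = Suc m" and m: "m > 0" and K: "K > 0"
    and mass: "rigid_sum (\<lambda>_. 1) (\<lambda>_. 1) m (\<sigma>, E) \<ge> 3 / 4 * real n * \<alpha> ^ m"
    and meet: "meeting_count E m \<le> K * real n * \<alpha> ^ (2 * l)"
    and bad: "nonuniq_count E (2 * l) \<le> K * \<alpha> ^ (4 * l)"
    and two: "two_step_count E l m \<le> K * real n * \<alpha> ^ (2 * l)"
    and num: "K * \<alpha> ^ (6 * l) + K * real n \<le> real n * \<alpha> ^ m / 4"
  obtains v where "v < n" "\<alpha> ^ m / 4 \<le> real (card (dist_sphere n E v m))"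
    "ip n (mv n (d E l) (\<lambda>i. of_bool (i \<in> dist_sphere n E v m))) (mv n (d E l) (\<lambda>i. of_bool (i \<in> dist_sphere n E v m)))
      \<le> 4 * K * \<alpha> ^ (l + 1) * real (card (dist_sphere n E v m))"
proof -
  define RP where "RP = (\<lambda>v. {P \<in> saws n m. edges P \<subseteq> E \<and> rigid E m P \<and> hd P = v})"
  define Y where "Y = (\<lambda>v. real (card (RP v)))"
  define U where "U = {v. v < n \<and> uniq E (2 * l) v}"
  define B where "B = {v. v < n \<and> \<not> uniq E (2 * l) v}"
  define Zs where "Zs = (\<lambda>v. {(w, x, x'). graph_dist E v x = enat m \<and>
      graph_dist E v x' = enat m \<and> graph_dist E x w = enat l \<and> graph_dist E x' w = enat l})"
  define Z where "Z = (\<lambda>v. real (card (Zs v)))"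
  have finRP: "finite (RP v)" for v by (simp add: RP_def)
  have UB: "{..<n} = U \<union> B" "U \<inter> B = {}" "finite U" "finite B" by (auto simp: U_def B_def)
  have hdn: "hd P < n" if "P \<in> saws n m" for P
  proof -
    have "P \<noteq> []" using that by (auto simp: saws_def)
    then have "hd P \<in> set P" by simp
    then show ?thesis using that by (auto simp: saws_def)
  qed
  have sumY: "(\<Sum>v<n. Y v) = rigid_sum (\<lambda>_. 1) (\<lambda>_. 1) m (\<sigma>, E)"
  proof -
    have "(\<Sum>v<n. card (RP v)) = card (\<Union>v<n. RP v)"
      by (rule card_UN_disjoint[symmetric]) (use finRP in \<open>auto simp: RP_def\<close>)
    also have "(\<Union>v<n. RP v) = {P. P \<in> saws n m \<and> edges P \<subseteq> E \<and> rigid E m P}"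
      using hdn by (auto simp: RP_def)
    finally have "real (\<Sum>v<n. card (RP v)) = real (card {P. P \<in> saws n m \<and> edges P \<subseteq> E \<and> rigid E m P})" by simp
    then show ?thesis by (simp add: Y_def rigid_sum_def)
  qed
  have sumY2: "(\<Sum>v<n. (Y v)\<^sup>2) \<le> meeting_count E m"
  proof -
    have "(\<Sum>v<n. card (RP v \<times> RP v)) = card (\<Union>v<n. RP v \<times> RP v)"
      by (rule card_UN_disjoint[symmetric]) (use finRP in \<open>auto simp: RP_def\<close>)
    also have "\<dots> \<le> card {(P, P'). P \<in> saws n m \<and> P' \<in> saws n m \<and> set P \<inter> set P' \<noteq> {} \<and>
      edges P \<subseteq> E \<and> edges P' \<subseteq> E \<and> rigid E m P}"
    proof (rule card_mono)
      show "finite {(P, P'). P \<in> saws n m \<and> P' \<in> saws n m \<and> set P \<inter> set P' \<noteq> {} \<and>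
         edges P \<subseteq> E \<and> edges P' \<subseteq> E \<and> rigid E m P}"
        by (rule finite_subset[of _ "saws n m \<times> saws n m"]) auto
      have "set P \<inter> set P' \<noteq> {}" if "P \<in> saws n m" "P' \<in> saws n m" "hd P = hd P'" for P P'
      proof -
        have "P \<noteq> []" "P' \<noteq> []" using that by (auto simp: saws_def)
        then have "hd P \<in> set P \<inter> set P'" using that(3) by (metis IntI hd_in_set)
        then show ?thesis by auto
      qed
      then show "(\<Union>v<n. RP v \<times> RP v) \<subseteq> {(P, P'). P \<in> saws n m \<and> P' \<in> saws n m \<and> set P \<inter> set P' \<noteq> {} \<and>
         edges P \<subseteq> E \<and> edges P' \<subseteq> E \<and> rigid E m P}"
        by (auto simp: RP_def)
    qed
    finally have "real (\<Sum>v<n. card (RP v \<times> RP v)) \<le> meeting_count E m"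
      unfolding meeting_count_def by (rule of_nat_mono)
    then show ?thesis by (simp add: Y_def card_cartesian_product power2_eq_square)
  qed
  have sumB: "(\<Sum>v\<in>B. Y v) \<le> K * \<alpha> ^ (6 * l) + K * real n"
  proof -
    define t where "t = \<alpha> ^ (2 * l)"
    have t: "t > 0" using \<alpha>_ge by (simp add: t_def)
    \<comment> \<open>Truncation at \<open>t = \<alpha> ^ (2 * l)\<close>: smaller values are paid
      for by the number of bad vertices, larger ones by the second moment.\<close>
    have yt: "y \<le> t + y\<^sup>2 / t" for y :: real
    proof (cases "y \<le> t")
      case True
      moreover have "0 \<le> y\<^sup>2 / t" using t by simp
      ultimately show ?thesis by linarith
    next
      case False
      then have "y * t \<le> y\<^sup>2" using t by (simp add: power2_eq_square)
      then have "y \<le> y\<^sup>2 / t" using t by (simp add: le_divide_eq)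
      then show ?thesis using t by linarith
    qed
    have "(\<Sum>v\<in>B. Y v) \<le> (\<Sum>v\<in>B. t + (Y v)\<^sup>2 / t)" by (rule sum_mono) (rule yt)
    also have "\<dots> = real (card B) * t + (\<Sum>v\<in>B. (Y v)\<^sup>2) / t"
      by (simp add: sum.distrib sum_divide_distrib)
    also have "(\<Sum>v\<in>B. (Y v)\<^sup>2) \<le> (\<Sum>v<n. (Y v)\<^sup>2)" by (rule sum_mono2) (auto simp: B_def)
    also have "(\<Sum>v<n. (Y v)\<^sup>2) \<le> K * real n * t" using sumY2 meet by (simp add: t_def)
    also have "real (card B) * t \<le> K * \<alpha> ^ (4 * l) * t"
      by (rule mult_right_mono) (use bad t in \<open>auto simp: nonuniq_count_def B_def\<close>)
    also have "K * \<alpha> ^ (4 * l) * t = K * \<alpha> ^ (6 * l)"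
      unfolding t_def mult.assoc power_add[symmetric] by simp
    finally show ?thesis using t by (simp add: divide_right_mono)
  qed
  have finZ: "finite (Zs v)" for v
  proof (rule finite_subset)
    show "Zs v \<subseteq> {..<n} \<times> {..<n} \<times> {..<n}"
      using graph_dist_lt[OF E] l by (fastforce simp: Zs_def)
  qed simp
  have sumZ: "(\<Sum>v\<in>U. Z v) \<le> K * real n * \<alpha> ^ (2 * l)"
  proof -
    have "(\<Sum>v\<in>U. card (Zs v)) = card (Sigma U Zs)" using UB finZ by simp
    also have "Sigma U Zs = {(v, w, x, x'). v < n \<and> uniq E (2 * l) v \<and> graph_dist E v x = enat m \<and>
      graph_dist E v x' = enat m \<and> graph_dist E x w = enat l \<and> graph_dist E x' w = enat l}"
      by (auto simp: U_def Zs_def)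
    finally have "real (\<Sum>v\<in>U. card (Zs v)) = two_step_count E l m" by (simp only: two_step_count_def)
    then show ?thesis using two by (simp add: Z_def)
  qed
  have half: "(\<Sum>v\<in>U. Y v) \<ge> real n * \<alpha> ^ m / 2"
  proof -
    have "(\<Sum>v<n. Y v) = (\<Sum>v\<in>U. Y v) + (\<Sum>v\<in>B. Y v)"
      unfolding UB(1) by (rule sum.union_disjoint) (use UB in auto)
    then show ?thesis using sumY mass sumB num by (simp add: algebra_simps)
  qed
  have "\<exists>v\<in>U. \<alpha> ^ m / 4 \<le> Y v \<and> Z v \<le> 4 * K * \<alpha> ^ (l + 1) * Y v"
  proof (rule ccontr)
    assume none: "\<not> (\<exists>v\<in>U. \<alpha> ^ m / 4 \<le> Y v \<and> Z v \<le> 4 * K * \<alpha> ^ (l + 1) * Y v)"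
    let ?c = "4 * K * \<alpha> ^ (l + 1)"
    have c: "?c > 0" using K \<alpha>_ge by simp
    have lt: "Y v < \<alpha> ^ m / 4 + Z v / ?c" if "v \<in> U" for v
    proof (cases "\<alpha> ^ m / 4 \<le> Y v")
      case True
      then have "?c * Y v < Z v" using none that by auto
      then have "Y v < Z v / ?c" using c by (simp add: less_divide_eq mult.commute)
      moreover have "0 < \<alpha> ^ m / 4" using \<alpha>_ge by simp
      ultimately show ?thesis by linarith
    next
      case False
      moreover have "0 \<le> Z v / ?c" using c by (intro divide_nonneg_nonneg) (auto simp: Z_def)
      ultimately show ?thesis by linarith
    qed
    have "U \<noteq> {}"
    proof
      assume "U = {}"
      then have "real n * \<alpha> ^ m / 2 \<le> 0" using half by simp
      moreover have "0 < real n * \<alpha> ^ m / 2" using n_pos \<alpha>_ge by simp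
      ultimately show False by linarith
    qed
    then have "(\<Sum>v\<in>U. Y v) < (\<Sum>v\<in>U. \<alpha> ^ m / 4 + Z v / ?c)"
      by (intro sum_strict_mono lt) (use UB in auto)
    also have "\<dots> = real (card U) * (\<alpha> ^ m / 4) + (\<Sum>v\<in>U. Z v) / ?c"
      by (simp add: sum.distrib sum_divide_distrib)
    also have "\<dots> \<le> real n * (\<alpha> ^ m / 4) + (K * real n * \<alpha> ^ (2 * l)) / ?c"
    proof (rule add_mono)
      have "card U \<le> card {..<n}" by (rule card_mono) (auto simp: U_def)
      then show "real (card U) * (\<alpha> ^ m / 4) \<le> real n * (\<alpha> ^ m / 4)" using \<alpha>_ge by (intro mult_right_mono) auto
      show "(\<Sum>v\<in>U. Z v) / ?c \<le> (K * real n * \<alpha> ^ (2 * l)) / ?c"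
        using sumZ c by (intro divide_right_mono) auto
    qed
    \<comment> \<open>The identity \<open>2 * l = m + (l + 1)\<close> is the origin of the exponent
      \<open>l + 1\<close> in the bound on the norm.\<close>
    also have "(K * real n * \<alpha> ^ (2 * l)) / ?c = real n * (\<alpha> ^ m / 4)"
    proof -
      have "2 * l = m + (l + 1)" using l by simp
      then have "\<alpha> ^ (2 * l) = \<alpha> ^ m * \<alpha> ^ (l + 1)" by (simp only: power_add)
      then show ?thesis using K \<alpha>_ge by simp
    qed
    finally show False using half by simp
  qed
  then obtain v where v: "v \<in> U" "\<alpha> ^ m / 4 \<le> Y v" "Z v \<le> 4 * K * \<alpha> ^ (l + 1) * Y v" by blast
  have YS: "Y v \<le> real (card (dist_sphere n E v m))"
  proof -
    have "card {P \<in> saws n m. edges P \<subseteq> E \<and> rigid E m P \<and> hd P = v}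
      \<le> card {(v', w). v' < n \<and> w < n \<and> graph_dist E v' w = enat m \<and> v' = v}"
      by (rule card_dist_pairs_bounds(1)[OF E m, where K = "\<lambda>a b. a = v"])
    also have "{(v', w). v' < n \<and> w < n \<and> graph_dist E v' w = enat m \<and> v' = v} = {v} \<times> dist_sphere n E v m"
      using v(1) by (auto simp: dist_sphere_def U_def)
    finally show ?thesis by (simp add: Y_def RP_def card_cartesian_product)
  qed
  have "ip n (mv n (d E l) (\<lambda>i. of_bool (i \<in> dist_sphere n E v m))) (mv n (d E l) (\<lambda>i. of_bool (i \<in> dist_sphere n E v m))) \<le> Z v"
  proof -
    define C where "C = (\<lambda>w. {x. graph_dist E v x = enat m \<and> graph_dist E x w = enat l})"
    have C_sub: "C w \<subseteq> {..<n}" for w using graph_dist_lt[OF E] l by (auto simp: C_def)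
    have finC: "finite (C w)" for w by (rule finite_subset[OF C_sub]) simp
    have Dw: "mv n (d E l) (\<lambda>i. of_bool (i \<in> dist_sphere n E v m)) w = real (card (C w))" if "w < n" for w
    proof -
      have "mv n (d E l) (\<lambda>i. of_bool (i \<in> dist_sphere n E v m)) w = (\<Sum>x<n. if x \<in> C w then 1 else 0)"
        unfolding mv_def
        by (rule sum.cong) (use that in \<open>auto simp: d_def distance_matrix_index dist_sphere_def C_def graph_dist_commute[of E w]\<close>)
      also have "\<dots> = real (card ({..<n} \<inter> C w))" by (simp add: sum.If_cases)
      finally show ?thesis using C_sub[of w] by (simp add: Int_absorb1)
    qed
    have "ip n (mv n (d E l) (\<lambda>i. of_bool (i \<in> dist_sphere n E v m))) (mv n (d E l) (\<lambda>i. of_bool (i \<in> dist_sphere n E v m))) =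
      (\<Sum>w<n. real (card (C w \<times> C w)))"
      unfolding ip_def by (rule sum.cong) (simp_all add: Dw card_cartesian_product)
    also have "\<dots> = real (card (Sigma {..<n} (\<lambda>w. C w \<times> C w)))" using finC by simp
    also have "card (Sigma {..<n} (\<lambda>w. C w \<times> C w)) \<le> card (Zs v)"
      by (rule card_mono[OF finZ]) (auto simp: Zs_def C_def)
    finally show ?thesis by (simp add: Z_def)
  qed
  also have "Z v \<le> 4 * K * \<alpha> ^ (l + 1) * real (card (dist_sphere n E v m))"
  proof (rule order_trans[OF v(3) mult_left_mono[OF YS]])
    show "0 \<le> 4 * K * \<alpha> ^ (l + 1)" using K \<alpha>_ge by simp
  qed
  finally show thesis using that v(1,2) YS by (force simp: U_def)
qed

section \<open>The good event and its probability\<close>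

definition good_event :: "nat \<Rightarrow> nat \<Rightarrow> real \<Rightarrow> ((nat \<Rightarrow> nat) \<times> nat set set) set" where
  "good_event l m K = {(\<sigma>, E). E \<subseteq> pairs n \<and> (\<forall>v<n. \<sigma> v < r) \<and>
     nonrigid_count E l \<le> K * \<alpha> ^ (2 * l) \<and>
     (\<forall>a<r. \<forall>b<r. (rigid_sum (ind a) (ind b) l (\<sigma>, E) - path_mean (ind a) (ind b) l)\<^sup>2 \<le> K * real n * \<alpha> ^ (3 * l)) \<and>
     (rigid_sum (\<lambda>_. 1) (\<lambda>_. 1) m (\<sigma>, E) - path_mean (\<lambda>_. 1) (\<lambda>_. 1) m)\<^sup>2 \<le> K * real n * \<alpha> ^ (3 * l) \<and>
     meeting_count E m \<le> K * real n * \<alpha> ^ (2 * l) \<and>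
     nonuniq_count E (2 * l) \<le> K * \<alpha> ^ (4 * l) \<and>
     two_step_count E l m \<le> K * real n * \<alpha> ^ (2 * l) \<and>
     isolated_count E \<ge> real n * iso_prob / 2}"

text \<open>As \<open>path_mean\<close> is at most \<open>n * \<alpha> ^ m\<close>, the cross term
  of the second moment is of order \<open>n * \<alpha> ^ (3 * m)\<close> up to powers of
  \<open>m\<close>, which dictates the exponent \<open>3 * l\<close>.\<close>

lemma rigid_sum_variance_le:
  assumes fg: "\<And>s. s < r \<Longrightarrow> 0 \<le> f s \<and> f s \<le> 1" "\<And>s. s < r \<Longrightarrow> 0 \<le> g s \<and> g s \<le> 1" and ml: "m \<le> l"
  shows "EJ (\<lambda>\<omega>. (rigid_sum f g m \<omega> - path_mean f g m)\<^sup>2) \<le> (4 + 4 * w) * (2 * real l + 1) ^ 4 * (real n * \<alpha> ^ (3 * l))"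
proof -
  have a1: "\<alpha> ^ (2 * m) \<le> \<alpha> ^ (3 * l)" "\<alpha> ^ m * \<alpha> ^ (2 * m) \<le> \<alpha> ^ (3 * l)"
    unfolding power_add[symmetric] by (rule power_increasing; use ml \<alpha>_ge in simp)+
  have l3: "(real m + 1) ^ 3 \<le> (2 * real l + 1) ^ 4"
  proof -
    have "(real m + 1) ^ 3 \<le> (2 * real l + 1) ^ 3" by (rule power_mono) (use ml in auto)
    also have "\<dots> \<le> (2 * real l + 1) ^ 4" by (rule power_increasing) auto
    finally show ?thesis .
  qed
  have pm: "path_mean f g m \<le> real n * \<alpha> ^ m" by (rule path_mean_close(3)[OF fg])
  have "0 \<le> pair_mean f g m" by (rule path_mean_close(2)[OF fg])
  then have pm0: "0 \<le> path_mean f g m" by (simp add: path_mean_def)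
  have "EJ (\<lambda>\<omega>. (rigid_sum f g m \<omega> - path_mean f g m)\<^sup>2) \<le>
     2 * (real m + 1) ^ 3 * real n * \<alpha> ^ (2 * m) + 2 * path_mean f g m * ((real m + 1)\<^sup>2 * real m * w * \<alpha> ^ (2 * m))"
    by (rule rigid_sum_second_moment[OF fg])
  also have "2 * path_mean f g m * ((real m + 1)\<^sup>2 * real m * w * \<alpha> ^ (2 * m)) \<le>
     2 * (real n * \<alpha> ^ m) * ((real m + 1)\<^sup>2 * (real m + 1) * w * \<alpha> ^ (2 * m))"
    by (intro mult_mono) (use pm pm0 w_nonneg \<alpha>_ge in auto)
  also have "\<dots> = 2 * w * (real m + 1) ^ 3 * (real n * (\<alpha> ^ m * \<alpha> ^ (2 * m)))"
    by (simp add: power2_eq_square power3_eq_cube)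
  also have "\<dots> \<le> 2 * w * (2 * real l + 1) ^ 4 * (real n * \<alpha> ^ (3 * l))"
    by (intro mult_mono l3 a1) (use w_nonneg \<alpha>_ge in auto)
  also have "2 * (real m + 1) ^ 3 * real n * \<alpha> ^ (2 * m) \<le> 2 * (2 * real l + 1) ^ 4 * (real n * \<alpha> ^ (3 * l))"
    unfolding mult.assoc by (intro mult_mono l3 a1) (use \<alpha>_ge in auto)
  finally have "EJ (\<lambda>\<omega>. (rigid_sum f g m \<omega> - path_mean f g m)\<^sup>2) \<le>
     (2 + 2 * w) * ((2 * real l + 1) ^ 4 * (real n * \<alpha> ^ (3 * l)))" by (simp add: algebra_simps)
  also have "\<dots> \<le> (4 + 4 * w) * ((2 * real l + 1) ^ 4 * (real n * \<alpha> ^ (3 * l)))"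
    by (rule mult_right_mono) (use w_nonneg \<alpha>_ge in auto)
  finally show ?thesis by (simp only: mult.assoc)
qed

text \<open>\<open>K\<close> is \<open>l\<close> times a common factor for all expectations, so
  Markov's inequality charges \<open>1 / l\<close> to each of the \<open>r\<^sup>2\<close> pairs of
  types and to each of five further quantities. The isolated vertices are treated by Chebyshev's
  inequality with half the mean as deviation.\<close>

lemma good_event_prob:
  assumes l: "l = Suc m" and K: "K = real l * ((4 + 4 * w) * (2 * real l + 1) ^ 4)" and iso: "iso_prob > 0"
  shows "measure_pmf.prob joint (good_event l m K) \<ge> 1 - ((real r)\<^sup>2 + 5) / real l -
    4 * (real n + (real n)\<^sup>2 * (\<bar>iso_pair_prob\<bar> - iso_prob\<^sup>2)) / (real n * iso_prob)\<^sup>2"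
proof -
  define Q where "Q = (4 + 4 * w) * (2 * real l + 1) ^ 4"
  have Q: "Q > 0" unfolding Q_def using w_nonneg by (intro mult_pos_pos) auto
  have l0: "real l > 0" using l by simp
  have KQ: "K = real l * Q" by (simp add: K Q_def)
  have K0: "K > 0" using KQ Q l0 by simp
  have n0: "real n > 0" using n_pos by simp
  have L3: "2 * (real m + 1) ^ 3 \<le> Q" "(real l + 1)\<^sup>2 * real l * w \<le> Q" "(2 * real l + 1) ^ 3 * (2 * real l) * w \<le> Q"
  proof -
    have "(real m + 1) ^ 3 \<le> (2 * real l + 1) ^ 3" by (rule power_mono) (use l in auto)
    also have "\<dots> \<le> (2 * real l + 1) ^ 4" by (rule power_increasing) auto
    finally have "2 * (real m + 1) ^ 3 \<le> 2 * (2 * real l + 1) ^ 4" by simp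
    also have "\<dots> \<le> Q" unfolding Q_def by (rule mult_right_mono) (use w_nonneg in auto)
    finally show "2 * (real m + 1) ^ 3 \<le> Q" .
    have p4: "(2 * real l + 1) ^ 4 = (2 * real l + 1) ^ 3 * (2 * real l + 1)" by (simp add: eval_nat_numeral)
    have wQ: "(2 * real l + 1) ^ 4 * w \<le> Q" unfolding Q_def
      by (subst mult.commute, rule mult_right_mono) (use w_nonneg in auto)
    have "(2 * real l + 1) ^ 3 * (2 * real l) * w \<le> (2 * real l + 1) ^ 4 * w"
      unfolding p4 by (intro mult_right_mono mult_left_mono) (use w_nonneg in auto)
    then show 3: "(2 * real l + 1) ^ 3 * (2 * real l) * w \<le> Q" using wQ by linarith
    have "(real l + 1)\<^sup>2 * real l * w \<le> (2 * real l + 1) ^ 3 * (2 * real l) * w"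
    proof (intro mult_mono)
      have "(real l + 1)\<^sup>2 \<le> (2 * real l + 1)\<^sup>2" by (rule power_mono) auto
      also have "\<dots> \<le> (2 * real l + 1) ^ 3" by (rule power_increasing) auto
      finally show "(real l + 1)\<^sup>2 \<le> (2 * real l + 1) ^ 3" .
    qed (use w_nonneg in auto)
    then show "(real l + 1)\<^sup>2 * real l * w \<le> Q" using 3 by linarith
  qed
  define V where "V = (\<lambda>a b \<omega>. (rigid_sum (ind a) (ind b) l \<omega> - path_mean (ind a) (ind b) l)\<^sup>2)"
  define V1 where "V1 = (\<lambda>\<omega>. (rigid_sum (\<lambda>_. 1) (\<lambda>_. 1) m \<omega> - path_mean (\<lambda>_. 1) (\<lambda>_. 1) m)\<^sup>2)"
  define N0 where "N0 = (\<lambda>(\<sigma> :: nat \<Rightarrow> nat, E). (isolated_count E - real n * iso_prob)\<^sup>2)"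
  define x1 where "x1 = K * \<alpha> ^ (2 * l)"
  define x2 where "x2 = K * real n * \<alpha> ^ (3 * l)"
  define x3 where "x3 = K * real n * \<alpha> ^ (2 * l)"
  define x4 where "x4 = K * \<alpha> ^ (4 * l)"
  define x5 where "x5 = (real n * iso_prob)\<^sup>2 / 4"
  have x: "x1 > 0" "x2 > 0" "x3 > 0" "x4 > 0" "x5 > 0"
    using K0 n0 \<alpha>_ge iso by (simp_all add: x1_def x2_def x3_def x4_def x5_def)
  \<comment> \<open>All Markov bounds at once: every summand is nonnegative, and off the good event
    some summand is at least 1.\<close>
  define f where "f = (\<lambda>\<omega>. (1 / x1) * (\<lambda>(\<sigma> :: nat \<Rightarrow> nat, E). nonrigid_count E l) \<omega> + (\<Sum>a<r. \<Sum>b<r. (1 / x2) * V a b \<omega>) +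
     (1 / x2) * V1 \<omega> + (1 / x3) * (\<lambda>(\<sigma> :: nat \<Rightarrow> nat, E). meeting_count E m) \<omega> +
     (1 / x4) * (\<lambda>(\<sigma> :: nat \<Rightarrow> nat, E). nonuniq_count E (2 * l)) \<omega> +
     (1 / x3) * (\<lambda>(\<sigma> :: nat \<Rightarrow> nat, E). two_step_count E l m) \<omega> + (1 / x5) * N0 \<omega>)"
  have "1 - measure_pmf.prob joint (good_event l m K) = measure_pmf.prob joint (- good_event l m K)"
    by (subst measure_pmf.prob_compl[symmetric]) (auto simp: Compl_eq_Diff_UNIV)
  also have "\<dots> = EJ (\<lambda>\<omega>. of_bool (\<omega> \<notin> good_event l m K))"
  proof -
    have "(\<lambda>\<omega>. of_bool (\<omega> \<notin> good_event l m K)) = indicat_real (- good_event l m K)"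
      by (auto simp: fun_eq_iff indicator_def)
    then show ?thesis by (simp add: EJ_def)
  qed
  also have "\<dots> \<le> EJ f"
  proof (rule EJ_mono)
    fix \<sigma> E assume E: "E \<subseteq> pairs n" and \<sigma>: "\<And>v. v < n \<Longrightarrow> \<sigma> v < r"
    have nn: "0 \<le> (1 / x1) * nonrigid_count E l" "0 \<le> (\<Sum>a<r. \<Sum>b<r. (1 / x2) * V a b (\<sigma>, E))"
      "0 \<le> (1 / x2) * V1 (\<sigma>, E)" "0 \<le> (1 / x3) * meeting_count E m" "0 \<le> (1 / x4) * nonuniq_count E (2 * l)"
      "0 \<le> (1 / x3) * two_step_count E l m" "0 \<le> (1 / x5) * N0 (\<sigma>, E)"
      using x by (auto simp: nonrigid_count_def V_def V1_def meeting_count_def nonuniq_count_def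
          two_step_count_def N0_def intro!: sum_nonneg)
    have big: "1 \<le> (1 / x) * y" if "x > 0" "\<not> y \<le> x" for x y :: real
      using that by (simp add: le_divide_eq)
    show "of_bool ((\<sigma>, E) \<notin> good_event l m K) \<le> f (\<sigma>, E)"
    proof (cases "(\<sigma>, E) \<in> good_event l m K")
      case True
      then show ?thesis using nn by (simp add: f_def)
    next
      case False
      then consider "\<not> nonrigid_count E l \<le> x1" | a b where "a < r" "b < r" "\<not> V a b (\<sigma>, E) \<le> x2"
        | "\<not> V1 (\<sigma>, E) \<le> x2" | "\<not> meeting_count E m \<le> x3" | "\<not> nonuniq_count E (2 * l) \<le> x4"
        | "\<not> two_step_count E l m \<le> x3" | "\<not> isolated_count E \<ge> real n * iso_prob / 2"
        using E \<sigma> unfolding good_event_def x1_def x2_def x3_def x4_def V_def V1_def by auto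
      then have "1 \<le> (1 / x1) * nonrigid_count E l + (\<Sum>a<r. \<Sum>b<r. (1 / x2) * V a b (\<sigma>, E)) +
        (1 / x2) * V1 (\<sigma>, E) + (1 / x3) * meeting_count E m + (1 / x4) * nonuniq_count E (2 * l) +
        (1 / x3) * two_step_count E l m + (1 / x5) * N0 (\<sigma>, E)"
      proof cases
        case 1 show ?thesis using big[OF x(1) 1] nn by linarith
      next
        case (2 a b)
        have "1 \<le> (1 / x2) * V a b (\<sigma>, E)" by (rule big[OF x(2) 2(3)])
        also have "\<dots> \<le> (\<Sum>b<r. (1 / x2) * V a b (\<sigma>, E))"
          by (rule member_le_sum) (use 2 x in \<open>auto simp: V_def\<close>)
        also have "\<dots> \<le> (\<Sum>a<r. \<Sum>b<r. (1 / x2) * V a b (\<sigma>, E))"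
          by (rule member_le_sum[where f = "\<lambda>a. \<Sum>b<r. (1 / x2) * V a b (\<sigma>, E)"])
            (use 2 x in \<open>auto simp: V_def intro!: sum_nonneg\<close>)
        finally show ?thesis using nn by linarith
      next
        case 3 show ?thesis using big[OF x(2) 3] nn by linarith
      next
        case 4 show ?thesis using big[OF x(3) 4] nn by linarith
      next
        case 5 show ?thesis using big[OF x(4) 5] nn by linarith
      next
        case 6 show ?thesis using big[OF x(3) 6] nn by linarith
      next
        case 7
        then have "real n * iso_prob / 2 \<le> real n * iso_prob - isolated_count E" by linarith
        then have "(real n * iso_prob / 2)\<^sup>2 \<le> (real n * iso_prob - isolated_count E)\<^sup>2"
          by (rule power_mono) (use iso in auto)
        then have "x5 \<le> N0 (\<sigma>, E)" by (simp add: x5_def N0_def power_divide power2_commute)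
        then have "1 \<le> (1 / x5) * N0 (\<sigma>, E)" using x(5) by (simp add: le_divide_eq)
        then show ?thesis using nn by linarith
      qed
      then show ?thesis using False by (simp add: f_def)
    qed
  qed
  also have "EJ f = (1 / x1) * EJ (\<lambda>(\<sigma>, E). nonrigid_count E l) + (\<Sum>a<r. \<Sum>b<r. (1 / x2) * EJ (V a b)) +
     (1 / x2) * EJ V1 + (1 / x3) * EJ (\<lambda>(\<sigma>, E). meeting_count E m) +
     (1 / x4) * EJ (\<lambda>(\<sigma>, E). nonuniq_count E (2 * l)) +
     (1 / x3) * EJ (\<lambda>(\<sigma>, E). two_step_count E l m) + (1 / x5) * EJ N0"
    unfolding f_def by (simp only: EJ_add EJ_cmult EJ_sum[OF finite_lessThan])
  also have "\<dots> \<le> 1 / real l + (\<Sum>a<r. \<Sum>b<r. 1 / real l) + 1 / real l + 1 / real l + 1 / real l + 1 / real l +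
     4 * (real n + (real n)\<^sup>2 * (\<bar>iso_pair_prob\<bar> - iso_prob\<^sup>2)) / (real n * iso_prob)\<^sup>2"
  proof (intro add_mono sum_mono)
    have frac: "(1 / (K * z)) * y \<le> 1 / real l" if "y \<le> Q * z" "z > 0" for y z
    proof -
      have "(1 / (K * z)) * y \<le> (1 / (K * z)) * (Q * z)" by (rule mult_left_mono) (use that K0 in auto)
      also have "\<dots> = 1 / real l" using that Q by (simp add: KQ)
      finally show ?thesis .
    qed
    have pos: "\<alpha> ^ k > 0" for k using \<alpha>_ge by simp
    have "EJ (\<lambda>(\<sigma>, E). nonrigid_count E l) \<le> (real l + 1)\<^sup>2 * real l * w * \<alpha> ^ (l + l)"
      unfolding nonrigid_count_def by (rule EJ_not_rigid)
    also have "\<dots> \<le> Q * \<alpha> ^ (2 * l)" unfolding mult_2[symmetric] by (rule mult_right_mono[OF L3(2)]) (use pos in \<open>simp add: less_imp_le\<close>)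
    finally show "(1 / x1) * EJ (\<lambda>(\<sigma>, E). nonrigid_count E l) \<le> 1 / real l"
      unfolding x1_def by (rule frac[OF _ pos])
    have npos: "real n * \<alpha> ^ k > 0" for k using pos n0 by simp
    show "(1 / x2) * EJ (V a b) \<le> 1 / real l" for a b
      unfolding x2_def V_def mult.assoc[of K]
      by (rule frac[OF _ npos], unfold Q_def, rule rigid_sum_variance_le) (auto simp: ind_def)
    show "(1 / x2) * EJ V1 \<le> 1 / real l"
      unfolding x2_def V1_def mult.assoc[of K]
      by (rule frac[OF _ npos], unfold Q_def, rule rigid_sum_variance_le) (use l in auto)
    have "EJ (\<lambda>(\<sigma>, E). meeting_count E m) \<le> 2 * (real m + 1) ^ 3 * real n * \<alpha> ^ (2 * m)"
      unfolding meeting_count_def by (rule EJ_intersecting_pairs)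
    also have "\<dots> \<le> Q * real n * \<alpha> ^ (2 * l)"
      by (intro mult_mono power_increasing L3) (use \<alpha>_ge Q l in auto)
    finally show "(1 / x3) * EJ (\<lambda>(\<sigma>, E). meeting_count E m) \<le> 1 / real l"
      unfolding x3_def mult.assoc[of K] mult.assoc[of Q] by (rule frac[OF _ npos])
    have "EJ (\<lambda>(\<sigma>, E). nonuniq_count E (2 * l)) \<le> (real (2 * l) + 1) ^ 3 * real (2 * l) * w * \<alpha> ^ (2 * (2 * l))"
      by (rule EJ_nonuniq)
    also have "\<dots> \<le> Q * \<alpha> ^ (4 * l)" using mult_right_mono[OF L3(3), of "\<alpha> ^ (4 * l)"] pos[of "4 * l"] by simp
    finally show "(1 / x4) * EJ (\<lambda>(\<sigma>, E). nonuniq_count E (2 * l)) \<le> 1 / real l"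
      unfolding x4_def by (rule frac[OF _ pos])
    have "EJ (\<lambda>(\<sigma>, E). two_step_count E l m) \<le> 2 * (real m + 1) ^ 3 * real n * \<alpha> ^ (2 * m + 1)"
      unfolding two_step_count_def by (rule EJ_two_step_pairs[OF l])
    also have "\<dots> \<le> Q * real n * \<alpha> ^ (2 * l)"
      by (intro mult_mono power_increasing L3) (use \<alpha>_ge Q l in auto)
    finally show "(1 / x3) * EJ (\<lambda>(\<sigma>, E). two_step_count E l m) \<le> 1 / real l"
      unfolding x3_def mult.assoc[of K] mult.assoc[of Q] by (rule frac[OF _ npos])
    have "(1 / x5) * EJ N0 \<le> (1 / x5) * (real n + (real n)\<^sup>2 * (\<bar>iso_pair_prob\<bar> - iso_prob\<^sup>2))"
      unfolding N0_def by (rule mult_left_mono[OF EJ_isolated_count_variance]) (use x in auto)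
    then show "(1 / x5) * EJ N0 \<le> 4 * (real n + (real n)\<^sup>2 * (\<bar>iso_pair_prob\<bar> - iso_prob\<^sup>2)) / (real n * iso_prob)\<^sup>2"
      by (simp add: x5_def)
  qed
  also have "(\<Sum>a<r. \<Sum>b<r. 1 / real l) = (real r)\<^sup>2 / real l" by (simp add: power2_eq_square)
  finally show ?thesis by (simp add: add_divide_distrib algebra_simps)
qed

end

section \<open>The perturbation\<close>


text \<open>Pigeonhole with \<open>k + 1\<close> scales and \<open>k\<close> values. Different
  scales differ at least by a factor 2, so no value is within relative distance \<open>1 / 8\<close>
  of two of them, because \<open>9 / 8 < 2 * (7 / 8)\<close>.\<close>

lemma separated_scale:
  fixes b :: "nat \<Rightarrow> real"
  assumes t: "t > 0"
  shows "\<exists>i\<le>k. \<forall>j\<in>{1..k}. 2 ^ i * t / 8 \<le> \<bar>b j - 2 ^ i * t\<bar>"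
proof (rule ccontr)
  assume "\<not> ?thesis"
  then have "\<forall>i\<in>{..k}. \<exists>j. j \<in> {1..k} \<and> \<bar>b j - 2 ^ i * t\<bar> < 2 ^ i * t / 8"
    by (metis (no_types, lifting) atMost_iff not_le_imp_less)
  then obtain f where f: "\<And>i. i \<le> k \<Longrightarrow> f i \<in> {1..k} \<and> \<bar>b (f i) - 2 ^ i * t\<bar> < 2 ^ i * t / 8"
    by (metis atMost_iff)
  have ne: "f i \<noteq> f i'" if "i < i'" "i' \<le> k" for i i'
  proof
    assume eq: "f i = f i'"
    have "2 ^ Suc i * t \<le> 2 ^ i' * t"
      by (rule mult_right_mono[OF power_increasing]) (use that t in auto)
    moreover have "\<bar>b (f i) - 2 ^ i * t\<bar> < 2 ^ i * t / 8" using f[of i] that by simp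
    moreover have "\<bar>b (f i) - 2 ^ i' * t\<bar> < 2 ^ i' * t / 8" using f[of i'] that eq by simp
    moreover have "2 ^ i * t > 0" using t by simp
    ultimately show False unfolding power_Suc mult.assoc by linarith
  qed
  have "inj_on f {..k}"
  proof (rule inj_onI, rule ccontr)
    fix x y assume a: "x \<in> {..k}" "y \<in> {..k}" "f x = f y" "x \<noteq> y"
    then consider "x < y" | "y < x" by linarith
    then show False using ne[of x y] ne[of y x] a by cases auto
  qed
  moreover have "f ` {..k} \<subseteq> {1..k}" using f by blast
  ultimately have "card {..k} \<le> card {1..k}" by (rule card_inj_on_le) simp
  then show False by simp
qed

context block_model
begin

text \<open>The test vectors are the functions \<open>e i\<close> of the types. The three terms in
  \<open>err\<close> stand for the fluctuation of the rigid sums, the non-rigid paths and the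
  replacement of the number of walks by \<open>n ^ Suc l\<close>.\<close>

lemma leading_values_ge:
  fixes e :: "nat \<Rightarrow> nat \<Rightarrow> real"
  assumes G: "(\<sigma>, E) \<in> good_event l m K" and l: "l > 0" and K: "K > 0"
    and c: "c > 0" and k: "1 \<le> k" "k \<le> n"
    and grow: "\<And>a. c * (\<Sum>s<r. \<bar>\<Sum>i<k. a i * e i s\<bar>) \<le> (\<Sum>s<r. \<bar>(type_op ^^ l) (\<lambda>s. \<Sum>i<k. a i * e i s) s\<bar>)"
    and indep: "\<And>a i. i < k \<Longrightarrow> a i \<noteq> 0 \<Longrightarrow> (\<Sum>s<r. \<bar>\<Sum>i<k. a i * e i s\<bar>) > 0"
    and err: "real r * (sqrt (K * real n * \<alpha> ^ (3 * l)) + K * \<alpha> ^ (2 * l) + (real l + 1)\<^sup>2 * \<alpha> ^ l) \<le> real n * c / (2 * real r)"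
    and U: "eigenbasis_values n (\<lambda>i j. distance_matrix n E l $$ (i, j)) U ev"
  shows "c / (2 * real r) \<le> \<bar>ev k\<bar>"
proof -
  have E: "E \<subseteq> pairs n" and \<sigma>: "\<And>v. v < n \<Longrightarrow> \<sigma> v < r" and nr: "nonrigid_count E l \<le> K * \<alpha> ^ (2 * l)"
    and V: "\<And>a b. a < r \<Longrightarrow> b < r \<Longrightarrow>
      (rigid_sum (ind a) (ind b) l (\<sigma>, E) - path_mean (ind a) (ind b) l)\<^sup>2 \<le> K * real n * \<alpha> ^ (3 * l)"
    using G by (auto simp: good_event_def)
  have close: "\<bar>pair_count \<sigma> E l a b - real n * pair_mean (ind a) (ind b) l\<bar> \<le>
      sqrt (K * real n * \<alpha> ^ (3 * l)) + K * \<alpha> ^ (2 * l) + (real l + 1)\<^sup>2 * \<alpha> ^ l" if "a < r" "b < r" for a b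
  proof -
    have "\<bar>rigid_sum (ind a) (ind b) l (\<sigma>, E) - path_mean (ind a) (ind b) l\<bar> \<le> sqrt (K * real n * \<alpha> ^ (3 * l))"
      by (rule real_le_rsqrt) (use V[OF that] in simp)
    moreover have "\<bar>pair_count \<sigma> E l a b - path_mean (ind a) (ind b) l\<bar> \<le>
      \<bar>rigid_sum (ind a) (ind b) l (\<sigma>, E) - path_mean (ind a) (ind b) l\<bar> + nonrigid_count E l"
      unfolding nonrigid_count_def by (rule pair_count_close[OF E l])
    moreover have "\<bar>path_mean (ind a) (ind b) l - real n * pair_mean (ind a) (ind b) l\<bar> \<le> (real l + 1)\<^sup>2 * \<alpha> ^ l"
      by (rule path_mean_close) (auto simp: ind_def)
    ultimately show ?thesis using nr by linarith
  qed
  show ?thesis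
  proof (rule eigenbasis_value_ge[OF distance_matrix_sym U, where F = "\<lambda>i v. e i (\<sigma> v)"])
    fix a :: "nat \<Rightarrow> real" and i assume i: "i < k" "a i \<noteq> 0"
    show "0 < ip n (\<lambda>x. \<Sum>i<k. a i * e i (\<sigma> x)) (\<lambda>x. \<Sum>i<k. a i * e i (\<sigma> x)) \<and>
      (c / (2 * real r))\<^sup>2 * ip n (\<lambda>x. \<Sum>i<k. a i * e i (\<sigma> x)) (\<lambda>x. \<Sum>i<k. a i * e i (\<sigma> x)) \<le>
      ip n (mv n (\<lambda>i j. distance_matrix n E l $$ (i, j)) (\<lambda>x. \<Sum>i<k. a i * e i (\<sigma> x)))
        (mv n (\<lambda>i j. distance_matrix n E l $$ (i, j)) (\<lambda>x. \<Sum>i<k. a i * e i (\<sigma> x)))"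
      by (rule distance_operator_growth[where g = "\<lambda>s. \<Sum>i<k. a i * e i s", OF \<sigma> close grow c err indep[of i a, OF i]])
  qed (use k c r_pos in auto)
qed

text \<open>Deterministic once the good event holds. Taking \<open>4 ^ i * k0\<close> leaves doubles
  \<theta> \<open>i\<close> times; isolated vertices and budget must suffice for the largest choice
  \<open>i = k\<close>, the budget also for the centre. The factor 16 in the overlap arises because
  \<open>lam\<close> stays at distance at least \<open>2 ^ i * \<theta> / 16\<close> from the
  leading eigenvalues.\<close>

lemma perturbation_exists:
  fixes e :: "nat \<Rightarrow> nat \<Rightarrow> real"
  assumes G: "(\<sigma>, E) \<in> good_event l m K" and l: "l = Suc m" and m: "m \<ge> 2" and K: "K > 0"
    and centre: "K * \<alpha> ^ (6 * l) + K * real n \<le> real n * \<alpha> ^ m / 4"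
    and mass: "(real m + 1)\<^sup>2 * \<alpha> ^ m + sqrt (K * real n * \<alpha> ^ (3 * l)) \<le> real n * \<alpha> ^ m / 4"
    and c: "c > 0" and k: "1 \<le> k" "k \<le> n"
    and grow: "\<And>a. c * (\<Sum>s<r. \<bar>\<Sum>i<k. a i * e i s\<bar>) \<le> (\<Sum>s<r. \<bar>(type_op ^^ l) (\<lambda>s. \<Sum>i<k. a i * e i s) s\<bar>)"
    and indep: "\<And>a i. i < k \<Longrightarrow> a i \<noteq> 0 \<Longrightarrow> (\<Sum>s<r. \<bar>\<Sum>i<k. a i * e i s\<bar>) > 0"
    and err: "real r * (sqrt (K * real n * \<alpha> ^ (3 * l)) + K * \<alpha> ^ (2 * l) + (real l + 1)\<^sup>2 * \<alpha> ^ l) \<le> real n * c / (2 * real r)"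
    and k0: "k0 > 0" "real (4 ^ k * k0) \<le> real n * iso_prob / 2" "Suc (4 ^ k * k0) \<le> \<gamma>"
    and \<eta>: "\<eta> \<ge> 0" "4 * K * \<alpha> ^ (l + 1) \<le> \<eta>\<^sup>2" "16 * \<eta> \<le> sqrt (real k0 * \<alpha> ^ m / 4)"
  shows "\<exists>E'. adversarial_perturbation n \<gamma> E E' \<and>
    (\<exists>ev. eigenvalue (distance_matrix n E' l) ev \<and> \<bar>ev\<bar> \<ge> sqrt (real k0 * \<alpha> ^ m / 4) / 2 \<and>
      (\<forall>x u. eigenvector (distance_matrix n E' l) x ev \<longrightarrow> scalar_prod x x = 1 \<longrightarrow>
         ordered_eigenbasis n (distance_matrix n E l) u \<longrightarrow>
         (\<forall>j\<in>{1..k}. \<bar>scalar_prod x (u j)\<bar> \<le> 16 * \<eta> / (c / (2 * real r)))))"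
proof -
  define d where "d = (\<lambda>i j. distance_matrix n E l $$ (i, j))"
  have E: "E \<subseteq> pairs n"
    and V1: "(rigid_sum (\<lambda>_. 1) (\<lambda>_. 1) m (\<sigma>, E) - path_mean (\<lambda>_. 1) (\<lambda>_. 1) m)\<^sup>2 \<le> K * real n * \<alpha> ^ (3 * l)"
    and meet: "meeting_count E m \<le> K * real n * \<alpha> ^ (2 * l)"
    and bad: "nonuniq_count E (2 * l) \<le> K * \<alpha> ^ (4 * l)"
    and two: "two_step_count E l m \<le> K * real n * \<alpha> ^ (2 * l)"
    and iso: "isolated_count E \<ge> real n * iso_prob / 2"
    using G by (auto simp: good_event_def)
  have "rigid_sum (\<lambda>_. 1) (\<lambda>_. 1) m (\<sigma>, E) \<ge> 3 / 4 * real n * \<alpha> ^ m"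
  proof -
    have "\<bar>rigid_sum (\<lambda>_. 1) (\<lambda>_. 1) m (\<sigma>, E) - path_mean (\<lambda>_. 1) (\<lambda>_. 1) m\<bar> \<le> sqrt (K * real n * \<alpha> ^ (3 * l))"
      by (rule real_le_rsqrt) (use V1 in simp)
    moreover have "\<bar>path_mean (\<lambda>_. 1) (\<lambda>_. 1) m - real n * pair_mean (\<lambda>_. 1) (\<lambda>_. 1) m\<bar> \<le> (real m + 1)\<^sup>2 * \<alpha> ^ m"
      by (rule path_mean_close) auto
    moreover have "pair_mean (\<lambda>_. 1) (\<lambda>_. 1) m = \<alpha> ^ m"
      using r_pos by (simp add: pair_mean_def type_op_pow_const)
    ultimately show ?thesis using mass by (simp add: abs_le_iff)
  qed
  from good_centre[OF E l _ K this meet bad two centre] m obtain v where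
    v: "v < n" "\<alpha> ^ m / 4 \<le> real (card (dist_sphere n E v m))"
      "ip n (mv n d (\<lambda>i. of_bool (i \<in> dist_sphere n E v m))) (mv n d (\<lambda>i. of_bool (i \<in> dist_sphere n E v m)))
       \<le> 4 * K * \<alpha> ^ (l + 1) * real (card (dist_sphere n E v m))"
    unfolding d_def by auto
  define b where "b = real (card (dist_sphere n E v m))"
  have "\<alpha> ^ m / 4 > 0" using \<alpha>_ge by simp
  then have b: "b > 0" "\<alpha> ^ m / 4 \<le> b" using v(2) by (auto simp: b_def)
  define \<theta> where "\<theta> = sqrt (real k0 * b)"
  have \<theta>0: "\<theta> > 0" using b k0 by (simp add: \<theta>_def)
  have "real k0 * (\<alpha> ^ m / 4) \<le> real k0 * b" by (rule mult_left_mono[OF b(2)]) simp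
  then have \<theta>ge: "sqrt (real k0 * \<alpha> ^ m / 4) \<le> \<theta>" by (simp add: \<theta>_def)
  have dsym: "d i j = d j i" if "i < n" "j < n" for i j
    using distance_matrix_sym[OF that] by (simp add: d_def)
  \<comment> \<open>The scale is read off from one eigenbasis and serves all of them, as the
    absolute values agree; if there is no eigenbasis, nothing has to be avoided.\<close>
  have "\<exists>i\<le>k. \<forall>U ev. eigenbasis_values n d U ev \<longrightarrow> (\<forall>j\<in>{1..k}. 2 ^ i * \<theta> / 8 \<le> \<bar>\<bar>ev j\<bar> - 2 ^ i * \<theta>\<bar>)"
  proof (cases "\<exists>U ev. eigenbasis_values n d U ev")
    case True
    then obtain U0 ev0 where U0: "eigenbasis_values n d U0 ev0" by blast
    obtain i where i: "i \<le> k" "\<forall>j\<in>{1..k}. 2 ^ i * \<theta> / 8 \<le> \<bar>\<bar>ev0 j\<bar> - 2 ^ i * \<theta>\<bar>"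
      using separated_scale[OF \<theta>0, of k "\<lambda>j. \<bar>ev0 j\<bar>"] by blast
    have "\<bar>ev j\<bar> = \<bar>ev0 j\<bar>" if "eigenbasis_values n d U ev" "j \<in> {1..k}" for U ev j
      using eigenbasis_abs_values_le[OF dsym that(1) U0, of j] eigenbasis_abs_values_le[OF dsym U0 that(1), of j] that(2) k
      by simp
    then show ?thesis using i by metis
  qed auto
  then obtain i where i: "i \<le> k"
    and sep: "\<And>U ev j. eigenbasis_values n d U ev \<Longrightarrow> j \<in> {1..k} \<Longrightarrow> 2 ^ i * \<theta> / 8 \<le> \<bar>\<bar>ev j\<bar> - 2 ^ i * \<theta>\<bar>" by blast
  have card_le: "4 ^ i * k0 \<le> 4 ^ k * k0" using i by (simp add: power_increasing)
  have "4 ^ k * k0 \<le> card {u. u < n \<and> u \<notin> \<Union>E}"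
    using k0(2) iso unfolding isolated_count_def by linarith
  then have "4 ^ i * k0 \<le> card {u. u < n \<and> u \<notin> \<Union>E}" using card_le by linarith
  then obtain L where L: "L \<subseteq> {u. u < n \<and> u \<notin> \<Union>E}" "card L = 4 ^ i * k0"
    by (metis obtain_subset_with_card_n)
  \<comment> \<open>The sphere of radius \<open>m\<close> is not empty, so the centre has a
    neighbour and is not one of the isolated vertices in \<open>L\<close>.\<close>
  have "v \<in> \<Union>E"
  proof -
    have "dist_sphere n E v m \<noteq> {}" using b by (auto simp: b_def)
    then obtain x where "graph_dist E v x = enat m" by (auto simp: dist_sphere_def)
    then obtain xs where xs: "path_in E xs" "length xs = Suc m" "hd xs = v" by (rule graph_dist_path)
    then obtain y zs where "xs = v # y # zs" using m by (cases xs; cases "tl xs") auto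
    then show ?thesis using xs by (auto simp: path_in_def)
  qed
  then interpret P: pendant n E v L
    using E v(1) L by unfold_locales auto
  have PS: "P.S m = dist_sphere n E v m" by (simp add: P.S_def dist_sphere_def)
  have Lne: "L \<noteq> {}" using L(2) k0(1) by auto
  have Sne: "P.S m \<noteq> {}" using b by (auto simp: b_def PS)
  have Ds: "ip n (mv n (\<lambda>i j. distance_matrix n E (Suc m) $$ (i, j)) (\<lambda>i. of_bool (i \<in> P.S m)))
      (mv n (\<lambda>i j. distance_matrix n E (Suc m) $$ (i, j)) (\<lambda>i. of_bool (i \<in> P.S m)))
      \<le> \<eta>\<^sup>2 * real (card (P.S m))"
    using v(3) mult_right_mono[OF \<eta>(2), of b] b unfolding PS d_def l b_def by linarith
  have \<theta>i: "sqrt (real (card L) * real (card (P.S m))) = 2 ^ i * \<theta>"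
  proof -
    have "real (card L) * real (card (P.S m)) = (2 ^ i)\<^sup>2 * (real k0 * b)"
      by (simp add: L PS b_def power_mult[symmetric] mult.commute[of i] power_mult)
    then show ?thesis by (simp add: \<theta>_def real_sqrt_mult)
  qed
  have "\<exists>lam. \<bar>lam - 2 ^ i * \<theta>\<bar> \<le> \<eta> \<and> eigenvalue (distance_matrix n P.E' (Suc m)) lam \<and>
    (\<forall>x u ev. eigenvector (distance_matrix n P.E' (Suc m)) x lam \<longrightarrow> scalar_prod x x = 1 \<longrightarrow>
       ip n u u = 1 \<longrightarrow> (\<forall>i<n. mv n (\<lambda>i j. distance_matrix n E (Suc m) $$ (i, j)) u i = ev * u i) \<longrightarrow> ev \<noteq> 0 \<longrightarrow>
       \<bar>lam - ev\<bar> * \<bar>ip n (vec_index x) u\<bar> * \<bar>ev\<bar> \<le> \<eta> * (2 ^ i * \<theta>))"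
    by (rule P.pendant_eigenvalue[OF m Lne Sne \<eta>(1) Ds, unfolded \<theta>i]) blast
  then obtain lam where lam: "\<bar>lam - 2 ^ i * \<theta>\<bar> \<le> \<eta>" "eigenvalue (distance_matrix n P.E' (Suc m)) lam"
    and overlap: "\<And>x u ev. eigenvector (distance_matrix n P.E' (Suc m)) x lam \<Longrightarrow> scalar_prod x x = 1 \<Longrightarrow>
       ip n u u = 1 \<Longrightarrow> (\<forall>i<n. mv n (\<lambda>i j. distance_matrix n E (Suc m) $$ (i, j)) u i = ev * u i) \<Longrightarrow> ev \<noteq> 0 \<Longrightarrow>
       \<bar>lam - ev\<bar> * \<bar>ip n (vec_index x) u\<bar> * \<bar>ev\<bar> \<le> \<eta> * (2 ^ i * \<theta>)" by blast
  define \<Theta> where "\<Theta> = 2 ^ i * \<theta>"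
  have "1 * \<theta> \<le> \<Theta>" unfolding \<Theta>_def by (rule mult_right_mono) (use \<theta>0 in auto)
  then have \<Theta>: "\<theta> \<le> \<Theta>" "\<Theta> > 0" "16 * \<eta> \<le> \<Theta>" using \<theta>0 \<theta>ge \<eta>(3) by auto
  show ?thesis
  proof (intro exI[of _ P.E'] exI[of _ lam] conjI allI impI ballI)
    have "Suc (card L) \<le> \<gamma>" using L(2) card_le k0(3) by linarith
    then show "adversarial_perturbation n \<gamma> E P.E'" by (rule P.adversarial_perturbation_pendant[OF Lne])
    show "eigenvalue (distance_matrix n P.E' l) lam" using lam(2) l by simp
    show "sqrt (real k0 * \<alpha> ^ m / 4) / 2 \<le> \<bar>lam\<bar>" using lam(1) \<Theta> \<theta>ge \<eta>(1) unfolding \<Theta>_def[symmetric] by linarith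
    fix x u j assume x: "eigenvector (distance_matrix n P.E' l) x lam" "scalar_prod x x = 1"
      and u: "ordered_eigenbasis n (distance_matrix n E l) u" and j: "j \<in> {1..k}"
    from ordered_eigenbasisD[OF u distance_matrix_carrier] obtain ev where
      U: "eigenbasis_values n d (\<lambda>k. vec_index (u k)) ev" and uc: "\<And>k. k \<in> {1..n} \<Longrightarrow> u k \<in> carrier_vec n"
      unfolding d_def by metis
    have jn: "j \<in> {1..n}" using j k by auto
    have "c / (2 * real r) \<le> \<bar>ev k\<bar>"
      by (rule leading_values_ge[OF G _ K c k grow indep err U[unfolded d_def]]) (use l in auto)
    also have "\<bar>ev k\<bar> \<le> \<bar>ev j\<bar>" using U j k by (auto simp: eigenbasis_values_def)
    finally have evj: "c / (2 * real r) \<le> \<bar>ev j\<bar>" .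
    have t: "c / (2 * real r) > 0" using c r_pos by simp
    define y where "y = \<bar>ip n (vec_index x) (vec_index (u j))\<bar>"
    have "\<bar>lam - ev j\<bar> * y * \<bar>ev j\<bar> \<le> \<eta> * (2 ^ i * \<theta>)"
      unfolding y_def
    proof (rule overlap)
      show "ip n (vec_index (u j)) (vec_index (u j)) = 1"
        using U jn by (simp add: eigenbasis_values_def orthonormal_system_def)
      show "\<forall>i<n. mv n (\<lambda>i j. distance_matrix n E (Suc m) $$ (i, j)) (vec_index (u j)) i = ev j * vec_index (u j) i"
        using U jn by (simp add: eigenbasis_values_def d_def l)
    qed (use x l evj t in auto)
    \<comment> \<open>As \<Theta> is positive, separating \<open>|ev j|\<close> from it is enough
      for either sign of \<open>ev j\<close>. Of the gap \<Theta> / 8 at most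
      \<open>\<eta> \<le> \<Theta> / 16\<close> is lost on passing from \<Theta> to
      \<open>lam\<close>.\<close>
    moreover have "\<Theta> / 16 \<le> \<bar>lam - ev j\<bar>"
    proof -
      have "\<Theta> / 8 \<le> \<bar>\<bar>ev j\<bar> - \<Theta>\<bar>" using sep[OF U j] by (simp add: \<Theta>_def)
      also have "\<dots> \<le> \<bar>ev j - \<Theta>\<bar>" using \<Theta>(2) by linarith
      finally show ?thesis using lam(1) \<Theta>(3) unfolding \<Theta>_def[symmetric] by linarith
    qed
    moreover have "y \<ge> 0" by (simp add: y_def)
    ultimately have "\<Theta> / 16 * (y * (c / (2 * real r))) \<le> \<eta> * \<Theta>"
    proof -
      assume 1: "\<bar>lam - ev j\<bar> * y * \<bar>ev j\<bar> \<le> \<eta> * (2 ^ i * \<theta>)" and 2: "\<Theta> / 16 \<le> \<bar>lam - ev j\<bar>" and y: "y \<ge> 0"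
      have "\<Theta> / 16 * (y * (c / (2 * real r))) \<le> \<bar>lam - ev j\<bar> * (y * \<bar>ev j\<bar>)"
        by (rule mult_mono[OF 2 mult_left_mono[OF evj y]]) (use y t in \<open>simp_all del: times_divide_eq_right\<close>)
      then show ?thesis using 1 by (simp add: \<Theta>_def mult_ac)
    qed
    then have "\<Theta> * (y * (c / (2 * real r))) \<le> \<Theta> * (16 * \<eta>)" by (simp add: mult_ac)
    then have "y * (c / (2 * real r)) \<le> 16 * \<eta>" using \<Theta>(2) by (rule mult_left_le_imp_le)
    then have "y \<le> 16 * \<eta> / (c / (2 * real r))" using t by (simp only: pos_le_divide_eq)
    then show "\<bar>scalar_prod x (u j)\<bar> \<le> 16 * \<eta> / (c / (2 * real r))"
      using scalar_prod_ip[OF uc[OF jn], of x] by (simp add: y_def)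
  qed
qed

end

section \<open>Asymptotics\<close>


text \<open>The limits are computed for real exponents; the bases are eventually positive, so
  \<open>powr\<close> agrees with the natural powers.\<close>

lemma isolation_limits:
  fixes a w :: real
  shows "(\<lambda>n. (1 - a / real n) ^ (n - 1)) \<longlonglongrightarrow> exp (- a)"
    and "(\<lambda>n. (1 - 2 * a / real n + w\<^sup>2 / (real n)\<^sup>2) ^ (n - 2)) \<longlonglongrightarrow> exp (- 2 * a)"
proof -
  have "(\<lambda>n. (1 - a / real n) powr (real n - 1)) \<longlonglongrightarrow> exp (- a)" by real_asymp
  moreover have "\<forall>\<^sub>F n in sequentially. (1 - a / real n) powr (real n - 1) = (1 - a / real n) ^ (n - 1)"
  proof -
    have "\<forall>\<^sub>F n in sequentially. 1 - a / real n > 0" by real_asymp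
    then show ?thesis using eventually_ge_at_top[of 1]
    proof eventually_elim
      case (elim n)
      then have "real n - 1 = real (n - 1)" by simp
      then show ?case using elim by (simp only: powr_realpow)
    qed
  qed
  ultimately show "(\<lambda>n. (1 - a / real n) ^ (n - 1)) \<longlonglongrightarrow> exp (- a)" by (rule Lim_transform_eventually)
next
  have "(\<lambda>n. (1 - 2 * a / real n + w\<^sup>2 / (real n)\<^sup>2) powr (real n - 2)) \<longlonglongrightarrow> exp (- 2 * a)" by real_asymp
  moreover have "\<forall>\<^sub>F n in sequentially. (1 - 2 * a / real n + w\<^sup>2 / (real n)\<^sup>2) powr (real n - 2) =
     (1 - 2 * a / real n + w\<^sup>2 / (real n)\<^sup>2) ^ (n - 2)"
  proof -
    have "\<forall>\<^sub>F n in sequentially. 1 - 2 * a / real n + w\<^sup>2 / (real n)\<^sup>2 > 0" by real_asymp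
    then show ?thesis using eventually_ge_at_top[of 2]
    proof eventually_elim
      case (elim n)
      then have "real n - 2 = real (n - 2)" by simp
      then show ?case using elim by (simp only: powr_realpow)
    qed
  qed
  ultimately show "(\<lambda>n. (1 - 2 * a / real n + w\<^sup>2 / (real n)\<^sup>2) ^ (n - 2)) \<longlonglongrightarrow> exp (- 2 * a)"
    by (rule Lim_transform_eventually)
qed

text \<open>\<open>q2\<close> tends to \<open>exp (- 2 * a)\<close>, the square of the limit of
  \<open>q1\<close>, so the leading terms of the relative variance cancel.\<close>

lemma isolation_error_limit:
  fixes a w :: real
  defines "q1 \<equiv> \<lambda>n. (1 - a / real n) ^ (n - 1)"
    and "q2 \<equiv> \<lambda>n. (1 - 2 * a / real n + w\<^sup>2 / (real n)\<^sup>2) ^ (n - 2)"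
  shows "(\<lambda>n. 4 * (real n + (real n)\<^sup>2 * (\<bar>q2 n\<bar> - (q1 n)\<^sup>2)) / (real n * q1 n)\<^sup>2) \<longlonglongrightarrow> 0"
proof -
  have q1: "q1 \<longlonglongrightarrow> exp (- a)" unfolding q1_def by (rule isolation_limits(1))
  have q2: "q2 \<longlonglongrightarrow> exp (- 2 * a)" unfolding q2_def by (rule isolation_limits(2))
  have n: "(\<lambda>n. 1 / real n) \<longlonglongrightarrow> 0" by real_asymp
  have "(\<lambda>n. 4 * (1 / real n + (\<bar>q2 n\<bar> - (q1 n)\<^sup>2)) / (q1 n)\<^sup>2) \<longlonglongrightarrow>
     4 * (0 + (\<bar>exp (- 2 * a)\<bar> - (exp (- a))\<^sup>2)) / (exp (- a))\<^sup>2"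
    by (intro tendsto_intros q1 q2 n) simp
  also have "4 * (0 + (\<bar>exp (- 2 * a)\<bar> - (exp (- a))\<^sup>2)) / (exp (- a))\<^sup>2 = 0"
    by (simp add: power2_eq_square exp_add[symmetric])
  finally show ?thesis
  proof (rule Lim_transform_eventually)
    show "\<forall>\<^sub>F n in sequentially. 4 * (1 / real n + (\<bar>q2 n\<bar> - (q1 n)\<^sup>2)) / (q1 n)\<^sup>2 =
        4 * (real n + (real n)\<^sup>2 * (\<bar>q2 n\<bar> - (q1 n)\<^sup>2)) / (real n * q1 n)\<^sup>2"
      using eventually_gt_at_top[of 0]
    proof eventually_elim
      case (elim n)
      have "4 * (real n + (real n)\<^sup>2 * (\<bar>q2 n\<bar> - (q1 n)\<^sup>2)) =
        (real n)\<^sup>2 * (4 * (1 / real n + (\<bar>q2 n\<bar> - (q1 n)\<^sup>2)))"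
        using elim by (simp add: power2_eq_square algebra_simps)
      then show ?case using elim by (simp add: power_mult_distrib)
    qed
  qed
qed

text \<open>The value of \<open>K\<close> in \<open>good_event_prob\<close>: a polynomial in
  \<open>l\<close> that absorbs the numbers of shapes, with the leading factor \<open>l\<close> as
  slack for Markov's inequality.\<close>

definition moment_factor :: "real \<Rightarrow> nat \<Rightarrow> real" where
  "moment_factor w l = real l * ((4 + 4 * w) * (2 * real l + 1) ^ 4)"

lemma moment_factor_negligible:
  fixes a w :: real
  assumes "a > 1"
  shows "(\<lambda>l. moment_factor w l / a ^ l) \<longlonglongrightarrow> 0"
proof -
  have pow: "(\<lambda>l. real l ^ k / a ^ l) \<longlonglongrightarrow> 0" for k
  proof -
    have "ln a > 0" using assms by simp
    then have "(\<lambda>l. real l ^ k / exp (ln a * real l)) \<longlonglongrightarrow> 0" by real_asymp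
    moreover have "exp (ln a * real l) = a ^ l" for l
      using assms by (simp add: exp_of_nat2_mult[symmetric] mult.commute exp_of_nat_mult)
    ultimately show ?thesis by simp
  qed
  have "(\<lambda>l. (4 + 4 * w) * (16 * (real l ^ 5 / a ^ l) + 32 * (real l ^ 4 / a ^ l) + 24 * (real l ^ 3 / a ^ l) +
     8 * (real l ^ 2 / a ^ l) + real l ^ 1 / a ^ l)) \<longlonglongrightarrow> (4 + 4 * w) * (16 * 0 + 32 * 0 + 24 * 0 + 8 * 0 + 0)"
    by (intro tendsto_intros pow)
  moreover have "moment_factor w l / a ^ l = (4 + 4 * w) * (16 * (real l ^ 5 / a ^ l) + 32 * (real l ^ 4 / a ^ l) + 24 * (real l ^ 3 / a ^ l) +
     8 * (real l ^ 2 / a ^ l) + real l ^ 1 / a ^ l)" for l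
  proof -
    have "moment_factor w l = (4 + 4 * w) * (16 * real l ^ 5 + 32 * real l ^ 4 + 24 * real l ^ 3 + 8 * real l ^ 2 + real l ^ 1)"
      unfolding moment_factor_def by (simp add: eval_nat_numeral algebra_simps)
    then show ?thesis by (simp add: add_divide_distrib algebra_simps)
  qed
  ultimately show ?thesis by simp
qed

lemma moment_factor_ge: "w \<ge> 0 \<Longrightarrow> l \<ge> 1 \<Longrightarrow> (real l + 1)\<^sup>2 \<le> moment_factor w l"
proof -
  assume w: "w \<ge> 0" and l: "l \<ge> 1"
  have "(real l + 1)\<^sup>2 \<le> (2 * real l + 1)\<^sup>2" by (rule power_mono) auto
  also have "\<dots> \<le> (2 * real l + 1) ^ 4" by (rule power_increasing) auto
  also have "\<dots> \<le> (4 + 4 * w) * (2 * real l + 1) ^ 4"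
    using mult_right_mono[of 1 "4 + 4 * w" "(2 * real l + 1) ^ 4"] w by simp
  also have "\<dots> \<le> moment_factor w l"
    unfolding moment_factor_def
    using mult_right_mono[of 1 "real l" "(4 + 4 * w) * (2 * real l + 1) ^ 4"] w l by simp
  finally show ?thesis .
qed

text \<open>From \<open>K \<le> \<beta>\<^sup>2 * \<alpha> ^ l\<close> and
  \<open>\<alpha> ^ (12 * l) \<le> n\<close> follows
  \<open>K * \<alpha> ^ k \<le> \<beta>\<^sup>2 * n\<close> for all \<open>k \<le> 11 * l\<close>;
  the square is there for the term under the root. Only \<open>K * n\<close> is compared with
  \<open>n * \<alpha> ^ m\<close>, at the price of the factor \<alpha> between
  \<open>\<alpha> ^ l\<close> and \<open>\<alpha> ^ m\<close>.\<close>

lemma numeric_conditions: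
  fixes \<alpha> \<beta> K n :: real
  assumes \<alpha>: "\<alpha> > 1" and n: "\<alpha> ^ (12 * l) \<le> n" and K: "K \<le> \<beta>\<^sup>2 * \<alpha> ^ l" "(real l + 1)\<^sup>2 \<le> K"
    and \<beta>: "0 < \<beta>" "\<beta> \<le> 1 / 8" "\<beta> * (1 + \<alpha>) \<le> 1 / 4" and l: "l = Suc m"
  shows "K * \<alpha> ^ (6 * l) + K * n \<le> n * \<alpha> ^ m / 4"
    "(real m + 1)\<^sup>2 * \<alpha> ^ m + sqrt (K * n * \<alpha> ^ (3 * l)) \<le> n * \<alpha> ^ m / 4"
    "sqrt (K * n * \<alpha> ^ (3 * l)) + K * \<alpha> ^ (2 * l) + (real l + 1)\<^sup>2 * \<alpha> ^ l \<le> 3 * \<beta> * n"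
proof -
  have pow: "\<alpha> ^ k \<le> n" if "k \<le> 12 * l" for k
    by (rule order_trans[OF power_increasing[OF that] n]) (use \<alpha> in simp)
  have n1: "1 \<le> n" using pow[of 0] by simp
  have \<alpha>m: "1 \<le> \<alpha> ^ m" using \<alpha> by (simp add: one_le_power)
  have nm: "n \<le> n * \<alpha> ^ m" using mult_left_mono[OF \<alpha>m, of n] n1 by simp
  have \<beta>2: "\<beta>\<^sup>2 \<le> \<beta>" using \<beta> by (simp add: power2_eq_square mult_left_le)
  have K0: "0 \<le> K" using K(2) by (meson order_trans zero_le_power2)
  have Kpow: "K * \<alpha> ^ k \<le> \<beta>\<^sup>2 * n" if "k + l \<le> 12 * l" for k
  proof -
    have "K * \<alpha> ^ k \<le> \<beta>\<^sup>2 * \<alpha> ^ l * \<alpha> ^ k" by (rule mult_right_mono[OF K(1)]) (use \<alpha> in simp)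
    also have "\<dots> = \<beta>\<^sup>2 * \<alpha> ^ (k + l)" by (simp add: power_add)
    also have "\<dots> \<le> \<beta>\<^sup>2 * n" by (rule mult_left_mono[OF pow[OF that]]) simp
    finally show ?thesis .
  qed
  have \<beta>n: "\<beta>\<^sup>2 * n \<le> \<beta> * n" by (rule mult_right_mono[OF \<beta>2]) (use n1 in simp)
  have sq: "sqrt (K * n * \<alpha> ^ (3 * l)) \<le> \<beta> * n"
  proof (rule real_le_lsqrt)
    have "K * n * \<alpha> ^ (3 * l) = (K * \<alpha> ^ (3 * l)) * n" by simp
    also have "\<dots> \<le> (\<beta>\<^sup>2 * n) * n" by (rule mult_right_mono[OF Kpow]) (use n1 in auto)
    finally show "K * n * \<alpha> ^ (3 * l) \<le> (\<beta> * n)\<^sup>2" by (simp add: power2_eq_square mult_ac)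
  qed (use \<beta> n1 in simp)
  have "K * n \<le> \<beta>\<^sup>2 * \<alpha> ^ l * n" by (rule mult_right_mono[OF K(1)]) (use n1 in simp)
  also have "\<dots> = \<beta>\<^sup>2 * \<alpha> * (n * \<alpha> ^ m)" by (simp add: l)
  finally have Kn: "K * n \<le> \<beta>\<^sup>2 * \<alpha> * (n * \<alpha> ^ m)" .
  have "K * \<alpha> ^ (6 * l) \<le> \<beta>\<^sup>2 * n" by (rule Kpow) simp
  also have "\<dots> \<le> \<beta>\<^sup>2 * (n * \<alpha> ^ m)" by (rule mult_left_mono[OF nm]) simp
  finally have "K * \<alpha> ^ (6 * l) + K * n \<le> \<beta>\<^sup>2 * (1 + \<alpha>) * (n * \<alpha> ^ m)" using Kn by (simp add: algebra_simps)
  also have "\<dots> \<le> \<beta> * (1 + \<alpha>) * (n * \<alpha> ^ m)"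
    by (intro mult_right_mono \<beta>2) (use \<alpha> n1 in auto)
  also have "\<dots> \<le> 1 / 4 * (n * \<alpha> ^ m)" by (rule mult_right_mono[OF \<beta>(3)]) (use \<alpha> n1 in auto)
  finally show "K * \<alpha> ^ (6 * l) + K * n \<le> n * \<alpha> ^ m / 4" by simp
  have "(real m + 1)\<^sup>2 \<le> (real l + 1)\<^sup>2" by (rule power_mono) (use l in auto)
  also have "\<dots> \<le> K * \<alpha> ^ 0" using K(2) by simp
  also have "\<dots> \<le> \<beta>\<^sup>2 * n" by (rule Kpow) simp
  finally have "(real m + 1)\<^sup>2 \<le> \<beta> * n" using \<beta>n by linarith
  then have "(real m + 1)\<^sup>2 * \<alpha> ^ m \<le> \<beta> * n * \<alpha> ^ m" by (rule mult_right_mono) (use \<alpha> in simp)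
  moreover have "\<beta> * n \<le> \<beta> * n * \<alpha> ^ m" using mult_left_mono[OF nm, of \<beta>] \<beta> by simp
  moreover have "\<beta> * n * \<alpha> ^ m \<le> 1 / 8 * (n * \<alpha> ^ m)"
    unfolding mult.assoc by (rule mult_right_mono[OF \<beta>(2)]) (use \<alpha> n1 in auto)
  ultimately show "(real m + 1)\<^sup>2 * \<alpha> ^ m + sqrt (K * n * \<alpha> ^ (3 * l)) \<le> n * \<alpha> ^ m / 4" using sq by linarith
  have "(real l + 1)\<^sup>2 * \<alpha> ^ l \<le> K * \<alpha> ^ l" by (rule mult_right_mono[OF K(2)]) (use \<alpha> in simp)
  also have "\<dots> \<le> \<beta>\<^sup>2 * n" by (rule Kpow) simp
  finally have "(real l + 1)\<^sup>2 * \<alpha> ^ l \<le> \<beta> * n" using \<beta>n by linarith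
  moreover have "K * \<alpha> ^ (2 * l) \<le> \<beta>\<^sup>2 * n" by (rule Kpow) simp
  then have "K * \<alpha> ^ (2 * l) \<le> \<beta> * n" using \<beta>n by linarith
  ultimately show "sqrt (K * n * \<alpha> ^ (3 * l)) + K * \<alpha> ^ (2 * l) + (real l + 1)\<^sup>2 * \<alpha> ^ l \<le> 3 * \<beta> * n" using sq by linarith
qed

lemma length_growth:
  fixes l :: "nat \<Rightarrow> nat" and \<alpha> \<kappa> :: real
  assumes \<alpha>: "\<alpha> > 1" and \<kappa>: "0 < \<kappa>" "\<kappa> < 1 / 12"
    and l: "(\<lambda>n. real (l n)) \<sim>[at_top] (\<lambda>n. \<kappa> * log \<alpha> (real n))"
  shows "filterlim l at_top at_top" "\<forall>\<^sub>F n in at_top. \<alpha> ^ (12 * l n) \<le> real n"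
proof -
  have ln\<alpha>: "ln \<alpha> > 0" using \<alpha> by simp
  have "filterlim (\<lambda>n. \<kappa> / ln \<alpha> * ln (real n)) at_top at_top"
    by (rule filterlim_tendsto_pos_mult_at_top[OF tendsto_const])
      (use \<kappa> ln\<alpha> in \<open>auto intro!: filterlim_compose[OF ln_at_top] filterlim_real_sequentially\<close>)
  then have lim: "filterlim (\<lambda>n. \<kappa> * log \<alpha> (real n)) at_top at_top" by (simp add: log_def)
  have "filterlim (\<lambda>n. real (l n)) at_top at_top"
    by (rule asymp_equiv_at_top_transfer[OF asymp_equiv_symI[OF l] lim])
  then show "filterlim l at_top at_top" by (simp add: filterlim_sequentially_iff_filterlim_real)
  \<comment> \<open>Chosen so that \<open>(1 + \<delta>) * \<kappa> = 1 / 12\<close>; it is positive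
    because \<open>\<kappa> < 1 / 12\<close>.\<close>
  define \<delta> where "\<delta> = 1 / (12 * \<kappa>) - 1"
  have \<delta>: "\<delta> > 0" using \<kappa> by (simp add: \<delta>_def field_simps)
  have "(\<lambda>n. real (l n) - \<kappa> * log \<alpha> (real n)) \<in> o(\<lambda>n. \<kappa> * log \<alpha> (real n))"
    by (rule asymp_equiv_imp_diff_smallo[OF l])
  from landau_o.smallD[OF this \<delta>]
  have "\<forall>\<^sub>F n in at_top. norm (real (l n) - \<kappa> * log \<alpha> (real n)) \<le> \<delta> * norm (\<kappa> * log \<alpha> (real n))" .
  then show "\<forall>\<^sub>F n in at_top. \<alpha> ^ (12 * l n) \<le> real n" using eventually_ge_at_top[of 1]
  proof eventually_elim
    case (elim n)
    have lg: "0 \<le> log \<alpha> (real n)" using elim(2) \<alpha> by (simp add: zero_le_log_cancel_iff)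
    then have "real (l n) \<le> \<kappa> * log \<alpha> (real n) + \<delta> * (\<kappa> * log \<alpha> (real n))"
      using elim(1) \<kappa> by (simp add: abs_mult abs_le_iff)
    also have "\<dots> = (1 + \<delta>) * \<kappa> * log \<alpha> (real n)" by (simp add: algebra_simps)
    also have "(1 + \<delta>) * \<kappa> = 1 / 12" using \<kappa> by (simp add: \<delta>_def)
    finally have "real (12 * l n) \<le> log \<alpha> (real n)" by simp
    then have "\<alpha> powr real (12 * l n) \<le> \<alpha> powr log \<alpha> (real n)" by (rule powr_mono) (use \<alpha> in simp)
    also have "\<dots> = real n" using \<alpha> elim(2) by simp
    finally show ?case using \<alpha> by (simp only: powr_realpow)
  qed
qed

text \<open>By its column sums \<open>M\<close> does not increase the sum of absolute values by more
  than \<alpha>; by its row sums the constant vector is an eigenvector, so \<alpha> occurs among the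
  \<mu>. The sign of \<open>\<mu> 1\<close> excludes \<open>- \<alpha>\<close>.\<close>

lemma stochastic_leading_eigenvalue:
  fixes M :: "real mat"
  assumes M: "M \<in> carrier_mat r r" and r: "r > 0"
    and nonneg: "\<And>i j. i < r \<Longrightarrow> j < r \<Longrightarrow> M $$ (i, j) \<ge> 0"
    and cols: "\<And>j. j < r \<Longrightarrow> (\<Sum>i<r. M $$ (i, j)) = \<alpha>"
    and rows: "\<And>i. i < r \<Longrightarrow> (\<Sum>j<r. M $$ (i, j)) = \<alpha>"
    and \<mu>: "ordered_eigenvalues r M \<mu>" "\<mu> 1 > 0"
  shows "\<mu> 1 = \<alpha>"
proof (rule antisym)
  have cp: "poly (char_poly M) x = (\<Prod>k\<in>{1..r}. x - \<mu> k)" for x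
    using \<mu>(1) by (simp add: ordered_eigenvalues_def poly_prod)
  have "poly (char_poly M) (\<mu> 1) = 0" unfolding cp by (rule prod_zero) (use r in auto)
  then have "eigenvalue M (\<mu> 1)" using eigenvalue_root_char_poly[OF M] by simp
  then obtain x where x: "x \<in> carrier_vec r" "x \<noteq> 0\<^sub>v r" "M *\<^sub>v x = \<mu> 1 \<cdot>\<^sub>v x"
    using M by (auto simp: eigenvalue_def eigenvector_def)
  define X where "X = (\<Sum>j<r. \<bar>vec_index x j\<bar>)"
  have "\<exists>i<r. vec_index x i \<noteq> 0"
  proof (rule ccontr)
    assume "\<not> (\<exists>i<r. vec_index x i \<noteq> 0)"
    then have "x = 0\<^sub>v r" using x(1) by (intro eq_vecI) auto
    then show False using x(2) by simp
  qed
  then obtain i where i: "i < r" "vec_index x i \<noteq> 0" by blast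
  then have "0 < \<bar>vec_index x i\<bar>" by simp
  also have "\<dots> \<le> X" unfolding X_def by (rule member_le_sum[where f = "\<lambda>j. \<bar>vec_index x j\<bar>"]) (use i in auto)
  finally have X: "X > 0" .
  have "\<mu> 1 * X = (\<Sum>i<r. \<bar>\<mu> 1 * vec_index x i\<bar>)"
    using \<mu>(2) by (simp add: X_def sum_distrib_left abs_mult)
  also have "\<dots> = (\<Sum>i<r. \<bar>\<Sum>j<r. M $$ (i, j) * vec_index x j\<bar>)"
  proof (rule sum.cong[OF refl])
    fix i assume "i \<in> {..<r}"
    then have "vec_index (M *\<^sub>v x) i = (\<Sum>j<r. M $$ (i, j) * vec_index x j)"
      using mult_mat_vec_mv[OF M x(1), of i] by (simp add: mv_def)
    then show "\<bar>\<mu> 1 * vec_index x i\<bar> = \<bar>\<Sum>j<r. M $$ (i, j) * vec_index x j\<bar>"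
      using x \<open>i \<in> {..<r}\<close> by simp
  qed
  also have "\<dots> \<le> (\<Sum>i<r. \<Sum>j<r. M $$ (i, j) * \<bar>vec_index x j\<bar>)"
    by (intro sum_mono order_trans[OF sum_abs]) (use nonneg in \<open>simp add: abs_mult\<close>)
  also have "\<dots> = (\<Sum>j<r. \<Sum>i<r. M $$ (i, j) * \<bar>vec_index x j\<bar>)" by (rule sum.swap)
  also have "\<dots> = \<alpha> * X" by (simp add: sum_distrib_right[symmetric] cols X_def sum_distrib_left)
  finally show "\<mu> 1 \<le> \<alpha>" using X by simp
  let ?one = "Matrix.vec r (\<lambda>_. 1) :: real vec"
  have "eigenvector M ?one \<alpha>"
    unfolding eigenvector_def
  proof (intro conjI)
    show "?one \<in> carrier_vec (dim_row M)" using M by simp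
    show "?one \<noteq> 0\<^sub>v (dim_row M)"
    proof
      assume eq: "?one = 0\<^sub>v (dim_row M)"
      have "vec_index ?one 0 = vec_index (0\<^sub>v (dim_row M)) 0" by (simp only: eq)
      then show False using M r by simp
    qed
    show "M *\<^sub>v ?one = \<alpha> \<cdot>\<^sub>v ?one"
      by (rule eq_vecI) (use M rows in \<open>auto simp: scalar_prod_def lessThan_atLeast0[symmetric]\<close>)
  qed
  then have "poly (char_poly M) \<alpha> = 0" using eigenvalue_root_char_poly[OF M] by (auto simp: eigenvalue_def)
  then obtain k where k: "k \<in> {1..r}" "\<alpha> = \<mu> k" unfolding cp by auto
  then have "\<bar>\<alpha>\<bar> \<le> \<bar>\<mu> 1\<bar>" using \<mu>(1) by (auto simp: ordered_eigenvalues_def)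
  then show "\<alpha> \<le> \<mu> 1" using \<mu>(2) by linarith
qed


lemma eventually_power_ge:
  fixes x :: real assumes "x > 1" shows "\<forall>\<^sub>F k in sequentially. B \<le> x ^ k"
proof -
  obtain N where N: "B < x ^ N" using real_arch_pow[OF assms] by blast
  have "B \<le> x ^ k" if "k \<ge> N" for k
  proof -
    have "x ^ N \<le> x ^ k" by (rule power_increasing[OF that]) (use assms in simp)
    then show ?thesis using N by linarith
  qed
  then show ?thesis unfolding eventually_sequentially by blast
qed

text \<open>\<open>ev\<close> may be a multiple eigenvalue and eigenbases are not unique, so
  near-orthogonality is claimed for every unit eigenvector and every eigenbasis, with one
  deterministic sequence \<epsilon> for all of them.\<close>

theorem theorem7:
  fixes r r\<^sub>0 :: nat and p :: "nat pmf" and W M :: "real mat"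
    and \<mu> :: "nat \<Rightarrow> real" and \<alpha> \<tau> \<kappa> :: real and l \<gamma> :: "nat \<Rightarrow> nat"
  assumes W_carrier: "W \<in> carrier_mat r r"
    and W_sym: "transpose_mat W = W"
    and W_nonneg: "\<And>i j. i < r \<Longrightarrow> j < r \<Longrightarrow> W $$ (i, j) \<ge> 0"
    and p_types: "set_pmf p \<subseteq> {..<r}"
    and M_def: "M = mean_matrix r p W"
    and M_eigenvalues: "ordered_eigenvalues r M \<mu>"
    and mu1: "\<mu> 1 > 1"
    and M_regular: "positive_regular r M"
    and M_columns: "\<And>j. j < r \<Longrightarrow> (\<Sum>i<r. M $$ (i, j)) = \<alpha>"
    and r0_range: "1 \<le> r\<^sub>0" "r\<^sub>0 \<le> r"
    and r0_above: "\<mu> 1 < (\<mu> r\<^sub>0)\<^sup>2"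
    and r0_below: "r\<^sub>0 < r \<Longrightarrow> (\<mu> (r\<^sub>0 + 1))\<^sup>2 \<le> \<mu> 1"
    and p_uniform: "\<And>i. i < r \<Longrightarrow> pmf p i = 1 / real r"
    and r0_gt_1: "r\<^sub>0 > 1"
    and tau_def: "\<tau> = (\<mu> 2)\<^sup>2 / \<mu> 1"
    and kappa: "0 < \<kappa>" "\<kappa> < 1 / 12"
    and l_asymp: "(\<lambda>n. real (l n)) \<sim>[at_top] (\<lambda>n. \<kappa> * log \<alpha> (real n))"
    and gamma: "(\<lambda>n. real (\<gamma> n)) \<in> \<Omega>(\<lambda>n. \<tau> ^ l n)"
  shows "\<exists>c>0. \<exists>\<epsilon> :: nat \<Rightarrow> real. \<epsilon> \<longlonglongrightarrow> 0 \<and>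
    (\<lambda>n. measure_pmf.prob (sbm n p W)
       {E. \<exists>E'. adversarial_perturbation n (\<gamma> n) E E' \<and>
          (\<exists>ev. eigenvalue (distance_matrix n E' (l n)) ev \<and>
             \<bar>ev\<bar> \<ge> c * \<bar>\<mu> 2\<bar> ^ l n \<and>
             (\<forall>x u. eigenvector (distance_matrix n E' (l n)) x ev \<longrightarrow>
                scalar_prod x x = 1 \<longrightarrow>
                ordered_eigenbasis n (distance_matrix n E (l n)) u \<longrightarrow>
                (\<forall>k\<in>{1..r\<^sub>0}. \<bar>scalar_prod x (u k)\<bar> \<le> \<epsilon> n)))})
      \<longlonglongrightarrow> 1"
proof -
  have r: "r > 0" using r0_range by simp
  have Mc: "M \<in> carrier_mat r r"
    unfolding M_def mean_matrix_def by (rule mult_carrier_mat[OF _ W_carrier]) (simp add: mat_diag_def)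
  have Ment: "M $$ (i, j) = W $$ (i, j) / real r" if "i < r" "j < r" for i j
    using that W_carrier p_uniform by (simp add: M_def mean_matrix_def mat_diag_mult_left[OF W_carrier])
  have Wsym: "W $$ (i, j) = W $$ (j, i)" if "i < r" "j < r" for i j
  proof -
    have "transpose_mat W $$ (i, j) = W $$ (j, i)" using that W_carrier by simp
    then show ?thesis by (simp add: W_sym)
  qed
  have rows: "(\<Sum>j<r. M $$ (i, j)) = \<alpha>" if "i < r" for i
  proof -
    have "(\<Sum>j<r. M $$ (i, j)) = (\<Sum>j<r. M $$ (j, i))"
      by (rule sum.cong) (use that Ment Wsym in auto)
    then show ?thesis using M_columns[OF that] by simp
  qed
  have row_sum: "(\<Sum>j<r. W $$ (i, j)) = real r * \<alpha>" if "i < r" for i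
  proof -
    have "(\<Sum>j<r. M $$ (i, j)) = (\<Sum>j<r. W $$ (i, j)) / real r"
      unfolding sum_divide_distrib by (rule sum.cong) (use that Ment in auto)
    then show ?thesis using rows[OF that] r by (simp add: field_simps)
  qed
  have \<mu>\<alpha>: "\<mu> 1 = \<alpha>"
    by (rule stochastic_leading_eigenvalue[OF Mc r _ M_columns rows M_eigenvalues])
      (use Ment W_nonneg mu1 in auto)
  have \<alpha>: "\<alpha> > 1" using mu1 \<mu>\<alpha> by simp
  have \<mu>_mono: "\<bar>\<mu> k\<bar> \<le> \<bar>\<mu> j\<bar>" if "1 \<le> j" "j \<le> k" "k \<le> r" for j k
    using M_eigenvalues that by (simp add: ordered_eigenvalues_def)
  define w where "w = (\<Sum>i<r. \<Sum>j<r. W $$ (i, j))"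
  have W_le: "W $$ (i, j) \<le> w" if "i < r" "j < r" for i j
  proof -
    have "W $$ (i, j) \<le> (\<Sum>j<r. W $$ (i, j))" by (rule member_le_sum) (use that W_nonneg in auto)
    also have "\<dots> \<le> w" unfolding w_def
      by (rule member_le_sum[where f = "\<lambda>i. \<Sum>j<r. W $$ (i, j)"]) (use that W_nonneg in \<open>auto intro: sum_nonneg\<close>)
    finally show ?thesis .
  qed
  have w0: "w \<ge> 0" using W_nonneg[OF r r] W_le[OF r r] by linarith
  have sqrt\<alpha>: "sqrt \<alpha> < \<bar>\<mu> r\<^sub>0\<bar>"
    using r0_above \<mu>\<alpha> real_sqrt_less_mono[of \<alpha> "(\<mu> r\<^sub>0)\<^sup>2"] by simp
  have sqrt1: "sqrt \<alpha> > 1" using \<alpha> by simp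
  \<comment> \<open>Strictly between the noise level \<open>sqrt \<alpha>\<close> and the smallest
    leading modulus: the lower gap makes the overlaps vanish, the upper gap is required by
    \<open>growth_subspace\<close>.\<close>
  define \<rho> where "\<rho> = (sqrt \<alpha> + \<bar>\<mu> r\<^sub>0\<bar>) / 2"
  have \<rho>: "sqrt \<alpha> < \<rho>" "\<rho> < \<bar>\<mu> r\<^sub>0\<bar>" using sqrt\<alpha> by (auto simp: \<rho>_def)
  have \<rho>1: "\<rho> > 1" using \<rho>(1) sqrt1 by linarith
  have \<rho>2: "\<alpha> < \<rho>\<^sup>2"
  proof -
    have "(sqrt \<alpha>)\<^sup>2 < \<rho>\<^sup>2" by (rule power_strict_mono) (use \<rho> sqrt1 in auto)
    then show ?thesis using \<alpha> by simp
  qed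
  have \<rho>\<mu>: "\<rho> < \<bar>\<mu> i\<bar>" if "1 \<le> i" "i \<le> r\<^sub>0" for i
    using \<mu>_mono[of i r\<^sub>0] that r0_range \<rho>(2) by linarith
  have \<rho>0: "0 < \<rho>" using \<rho>1 by simp
  have "\<exists>(c1 :: real) (e :: nat \<Rightarrow> nat \<Rightarrow> real). c1 > 0 \<and>
    (\<forall>a l. c1 * \<rho> ^ l * (\<Sum>s<r. \<bar>\<Sum>i<r\<^sub>0. a i * e i s\<bar>) \<le>
       (\<Sum>s<r. \<bar>(mv r (\<lambda>i j. M $$ (i, j)) ^^ l) (\<lambda>s. \<Sum>i<r\<^sub>0. a i * e i s) s\<bar>)) \<and>
    (\<forall>a i. i < r\<^sub>0 \<longrightarrow> a i \<noteq> 0 \<longrightarrow> (\<Sum>s<r. \<bar>\<Sum>i<r\<^sub>0. a i * e i s\<bar>) > 0)"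
    by (rule growth_subspace[OF Mc M_eigenvalues r0_range(2) \<rho>0 \<rho>\<mu>]) blast+
  then obtain c1 and e :: "nat \<Rightarrow> nat \<Rightarrow> real" where c1: "c1 > 0"
    and grow: "\<And>a l. c1 * \<rho> ^ l * (\<Sum>s<r. \<bar>\<Sum>i<r\<^sub>0. a i * e i s\<bar>) \<le>
       (\<Sum>s<r. \<bar>(mv r (\<lambda>i j. M $$ (i, j)) ^^ l) (\<lambda>s. \<Sum>i<r\<^sub>0. a i * e i s) s\<bar>)"
    and indep: "\<And>a i. i < r\<^sub>0 \<Longrightarrow> a i \<noteq> 0 \<Longrightarrow> (\<Sum>s<r. \<bar>\<Sum>i<r\<^sub>0. a i * e i s\<bar>) > 0"
    by blast
  have \<mu>2: "\<alpha> < (\<mu> 2)\<^sup>2" "(\<mu> 2)\<^sup>2 \<le> \<alpha>\<^sup>2"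
  proof -
    have "\<bar>\<mu> r\<^sub>0\<bar> \<le> \<bar>\<mu> 2\<bar>" by (rule \<mu>_mono) (use r0_gt_1 r0_range in auto)
    then have "(\<mu> r\<^sub>0)\<^sup>2 \<le> (\<mu> 2)\<^sup>2" by (simp add: abs_le_square_iff)
    then show "\<alpha> < (\<mu> 2)\<^sup>2" using r0_above \<mu>\<alpha> by simp
    have "\<bar>\<mu> 2\<bar> \<le> \<bar>\<mu> 1\<bar>" by (rule \<mu>_mono) (use r0_gt_1 r0_range in auto)
    then show "(\<mu> 2)\<^sup>2 \<le> \<alpha>\<^sup>2" unfolding \<mu>\<alpha> by (simp add: abs_le_square_iff)
  qed
  have tau': "\<tau> = (\<mu> 2)\<^sup>2 / \<alpha>" by (simp only: tau_def \<mu>\<alpha>)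
  have \<tau>: "\<tau> > 1" "\<tau> \<le> \<alpha>" "\<tau> * \<alpha> = (\<mu> 2)\<^sup>2"
    using \<mu>2 \<alpha> unfolding tau' by (simp_all add: divide_le_eq less_divide_eq power2_eq_square)
  obtain c' where c': "c' > 0" "\<forall>\<^sub>F n in at_top. c' * norm (\<tau> ^ l n) \<le> norm (real (\<gamma> n))"
    using landau_omega.bigE[OF gamma] by auto
  \<comment> \<open>Halving leaves room for the centre in the budget \<gamma>; the minimum with 1
    keeps \<open>c0 * \<tau> ^ l\<close> below \<open>\<alpha> ^ l\<close> and thus below the number
    of isolated vertices.\<close>
  define c0 where "c0 = min c' 1 / 2"
  have c0: "c0 > 0" "2 * c0 \<le> c'" "c0 \<le> 1" using c' by (auto simp: c0_def)
  \<comment> \<open>The first two bounds are those of \<open>numeric_conditions\<close>; the third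
    makes \<open>r * (3 * \<beta> * n)\<close> at most \<open>n * c1 / (2 * r)\<close>.\<close>
  define \<beta> where "\<beta> = min (1 / 8) (min (1 / (4 * (1 + \<alpha>))) (c1 / (6 * (real r)\<^sup>2)))"
  have \<beta>: "0 < \<beta>" "\<beta> \<le> 1 / 8" "\<beta> * (1 + \<alpha>) \<le> 1 / 4" "\<beta> * (6 * (real r)\<^sup>2) \<le> c1"
  proof -
    show "0 < \<beta>" using \<alpha> c1 r by (simp add: \<beta>_def)
    show "\<beta> \<le> 1 / 8" by (simp add: \<beta>_def)
    have "\<beta> \<le> 1 / (4 * (1 + \<alpha>))" by (simp add: \<beta>_def)
    moreover have "4 * (1 + \<alpha>) > 0" using \<alpha> by simp
    ultimately have "\<beta> * (4 * (1 + \<alpha>)) \<le> 1" by (simp only: pos_le_divide_eq)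
    then show "\<beta> * (1 + \<alpha>) \<le> 1 / 4" by (simp add: algebra_simps)
    have "\<beta> \<le> c1 / (6 * (real r)\<^sup>2)" by (simp add: \<beta>_def)
    then show "\<beta> * (6 * (real r)\<^sup>2) \<le> c1" using r by (simp add: le_divide_eq)
  qed
  \<comment> \<open>The constant for which
    \<open>1024 * \<alpha> * C2 = c0 / (8 * 4 ^ r\<^sub>0 * \<alpha>)\<close>, so that
    \<open>16 * \<eta>\<close> stays below the smallest scale.\<close>
  define C2 where "C2 = c0 / (8192 * 4 ^ r\<^sub>0 * \<alpha>\<^sup>2)"
  have C2: "C2 > 0" using c0 \<alpha> by (simp add: C2_def)
  define K where "K = moment_factor w"
  define \<eta> where "\<eta> = (\<lambda>n. sqrt (4 * K (l n) * \<alpha> ^ (l n + 1)))"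
  \<comment> \<open>Division by \<open>4 ^ r\<^sub>0\<close> keeps even the largest candidate
    \<open>4 ^ r\<^sub>0 * k0\<close> within the budget.\<close>
  define k0 where "k0 = (\<lambda>n. nat \<lfloor>c0 * \<tau> ^ l n / 4 ^ r\<^sub>0\<rfloor>)"
  define \<epsilon> where "\<epsilon> = (\<lambda>n. 16 * \<eta> n / (c1 * \<rho> ^ l n / (2 * real r)))"
  \<comment> \<open>Under the root, 8 combines a factor 2 for rounding \<open>k0\<close> down with 4
    for the sphere having at least \<open>\<alpha> ^ m / 4\<close> points, and \<alpha> comes from
    \<open>m = l - 1\<close>. The outer 2 is the loss from the scale to the eigenvalue.\<close>
  define cs where "cs = sqrt (c0 / (8 * 4 ^ r\<^sub>0 * \<alpha>)) / 2"
  have cs: "cs > 0" using c0 \<alpha> by (simp add: cs_def)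
  note lim = length_growth[OF \<alpha> kappa l_asymp]
  have K_small: "\<forall>\<^sub>F k in sequentially. K k \<le> b * x ^ k" if "x > 1" "b > 0" for x b
  proof -
    have "\<forall>\<^sub>F k in sequentially. K k / x ^ k < b"
      using order_tendstoD(2)[OF moment_factor_negligible[OF that(1), of w] that(2)] by (simp add: K_def)
    then show ?thesis
    proof eventually_elim
      case (elim k)
      then have "K k < b * x ^ k" using that by (simp add: divide_less_eq)
      then show ?case by simp
    qed
  qed
  have \<beta>2: "\<beta>\<^sup>2 > 0" using \<beta> by simp
  \<comment> \<open>\<open>3 \<le> k\<close> gives \<open>m \<ge> 2\<close>; the last two conditions
    make \<open>k0\<close> positive and leave enough isolated vertices.\<close>
  have "\<forall>\<^sub>F k in sequentially. 3 \<le> k \<and> K k \<le> \<beta>\<^sup>2 * \<alpha> ^ k \<and> K k \<le> C2 * \<tau> ^ k \<and>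
      2 * 4 ^ r\<^sub>0 / c0 \<le> \<tau> ^ k \<and> 4 * exp \<alpha> \<le> \<alpha> ^ k"
    by (intro eventually_conj eventually_ge_at_top K_small[OF \<alpha> \<beta>2] K_small[OF \<tau>(1) C2]
        eventually_power_ge[OF \<tau>(1)] eventually_power_ge[OF \<alpha>])
  then have ev_l: "\<forall>\<^sub>F n in at_top. 3 \<le> l n \<and> K (l n) \<le> \<beta>\<^sup>2 * \<alpha> ^ l n \<and> K (l n) \<le> C2 * \<tau> ^ l n \<and>
      2 * 4 ^ r\<^sub>0 / c0 \<le> \<tau> ^ l n \<and> 4 * exp \<alpha> \<le> \<alpha> ^ l n"
    by (rule eventually_compose_filterlim[OF _ lim(1)])
  have ev_q: "\<forall>\<^sub>F n in at_top. exp (- \<alpha>) / 2 < (1 - \<alpha> / real n) ^ (n - 1)"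
    by (rule order_tendstoD(1)[OF isolation_limits(1)]) simp
  have ev_n: "\<forall>\<^sub>F n in at_top. real n \<ge> w \<and> n \<ge> r\<^sub>0 \<and> n > 0"
  proof -
    have "\<forall>\<^sub>F n in at_top. real n \<ge> w" by real_asymp
    then show ?thesis by (intro eventually_conj eventually_ge_at_top eventually_gt_at_top)
  qed
  define iso_err where "iso_err = (\<lambda>n. 4 * (real n + (real n)\<^sup>2 *
     (\<bar>(1 - 2 * \<alpha> / real n + w\<^sup>2 / (real n)\<^sup>2) ^ (n - 2)\<bar> - ((1 - \<alpha> / real n) ^ (n - 1))\<^sup>2)) /
     (real n * (1 - \<alpha> / real n) ^ (n - 1))\<^sup>2)"
  define X where "X = (\<lambda>n. {E. \<exists>E'. adversarial_perturbation n (\<gamma> n) E E' \<and>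
          (\<exists>ev. eigenvalue (distance_matrix n E' (l n)) ev \<and>
             \<bar>ev\<bar> \<ge> cs * \<bar>\<mu> 2\<bar> ^ l n \<and>
             (\<forall>x u. eigenvector (distance_matrix n E' (l n)) x ev \<longrightarrow>
                scalar_prod x x = 1 \<longrightarrow>
                ordered_eigenbasis n (distance_matrix n E (l n)) u \<longrightarrow>
                (\<forall>k\<in>{1..r\<^sub>0}. \<bar>scalar_prod x (u k)\<bar> \<le> \<epsilon> n)))})"
  have main: "\<forall>\<^sub>F n in at_top. 1 - ((real r)\<^sup>2 + 5) / real (l n) - iso_err n \<le>
      measure_pmf.prob (sbm n p W) (X n)"
    using ev_l ev_q ev_n lim(2) c'(2)
  proof eventually_elim
    case (elim n)
    define m where "m = l n - 1"
    define L where "L = l n"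
    have l: "L = Suc m" and m: "m \<ge> 2" using elim(1) by (auto simp: m_def L_def)
    note ev = elim[folded L_def]
    have KL: "K L = real L * ((4 + 4 * w) * (2 * real L + 1) ^ 4)" by (simp add: K_def moment_factor_def)
    have K2: "(real L + 1)\<^sup>2 \<le> K L" unfolding K_def by (rule moment_factor_ge[OF w0]) (use l in simp)
    have "(real L + 1)\<^sup>2 > 0" by simp
    then have K0: "K L > 0" using K2 by linarith
    interpret B: block_model r n W p \<alpha> w
      using r W_carrier Wsym W_nonneg W_le ev(3) p_types p_uniform row_sum \<alpha>
      by unfold_locales auto
    have iso: "B.iso_prob = (1 - \<alpha> / real n) ^ (n - 1)" by (rule B.iso_prob_def)
    have iso_pos: "B.iso_prob > exp (- \<alpha>) / 2" "B.iso_prob > 0"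
      using ev(2) exp_gt_zero[of "- \<alpha>"] unfolding iso by linarith+
    have good: "1 - ((real r)\<^sup>2 + 5) / real L - iso_err n \<le> measure_pmf.prob B.joint (B.good_event L m (K L))"
      using B.good_event_prob[OF l KL iso_pos(2)] by (simp add: iso_err_def iso B.iso_pair_prob_def)
    have num: "K L * \<alpha> ^ (6 * L) + K L * real n \<le> real n * \<alpha> ^ m / 4"
      "(real m + 1)\<^sup>2 * \<alpha> ^ m + sqrt (K L * real n * \<alpha> ^ (3 * L)) \<le> real n * \<alpha> ^ m / 4"
      "sqrt (K L * real n * \<alpha> ^ (3 * L)) + K L * \<alpha> ^ (2 * L) + (real L + 1)\<^sup>2 * \<alpha> ^ L \<le> 3 * \<beta> * real n"
      by (rule numeric_conditions[OF \<alpha> ev(4) _ K2 \<beta>(1-3) l]; use ev(1) in simp)+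
    \<comment> \<open>On the types below \<open>r\<close>, \<open>type_op\<close> is multiplication
      by \<open>M\<close>, so the growth of powers of \<open>M\<close> carries over.\<close>
    have pow: "(B.type_op ^^ k) g s = (mv r (\<lambda>i j. M $$ (i, j)) ^^ k) g s" if "s < r" for k g s
      using that
    proof (induction k arbitrary: s)
      case (Suc k)
      then show ?case by (simp add: B.type_op_def mv_def Ment)
    qed simp
    have growB: "c1 * \<rho> ^ L * (\<Sum>s<r. \<bar>\<Sum>i<r\<^sub>0. a i * e i s\<bar>) \<le>
       (\<Sum>s<r. \<bar>(B.type_op ^^ L) (\<lambda>s. \<Sum>i<r\<^sub>0. a i * e i s) s\<bar>)" for a
      using grow[of L a] by (simp add: pow)
    have cpos: "c1 * \<rho> ^ L > 0" using c1 \<rho>0 by simp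
    have err: "real r * (sqrt (K L * real n * \<alpha> ^ (3 * L)) + K L * \<alpha> ^ (2 * L) + (real L + 1)\<^sup>2 * \<alpha> ^ L)
       \<le> real n * (c1 * \<rho> ^ L) / (2 * real r)"
    proof -
      have "real r * (sqrt (K L * real n * \<alpha> ^ (3 * L)) + K L * \<alpha> ^ (2 * L) + (real L + 1)\<^sup>2 * \<alpha> ^ L)
        \<le> real r * (3 * \<beta> * real n)" by (rule mult_left_mono[OF num(3)]) simp
      also have "\<dots> = real n * (\<beta> * (6 * (real r)\<^sup>2)) / (2 * real r)"
        using r by (simp add: power2_eq_square)
      also have "\<dots> \<le> real n * (c1 * \<rho> ^ L) / (2 * real r)"
      proof (intro divide_right_mono mult_left_mono)
        have "c1 * 1 \<le> c1 * \<rho> ^ L" by (rule mult_left_mono) (use c1 \<rho>1 in \<open>simp_all add: one_le_power\<close>)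
        then show "\<beta> * (6 * (real r)\<^sup>2) \<le> c1 * \<rho> ^ L" using \<beta>(4) by simp
      qed simp_all
      finally show ?thesis .
    qed
    define z where "z = c0 * \<tau> ^ L / 4 ^ r\<^sub>0"
    have z2: "z \<ge> 2"
    proof -
      have "2 * 4 ^ r\<^sub>0 \<le> c0 * \<tau> ^ L" using ev(1) c0 by (simp add: divide_le_eq mult.commute)
      then show ?thesis by (simp add: z_def le_divide_eq)
    qed
    have k0: "real (k0 n) \<le> z" "z / 2 \<le> real (k0 n)" "k0 n > 0"
    proof -
      have "real (k0 n) = of_int \<lfloor>z\<rfloor>" using z2 by (simp add: k0_def z_def L_def)
      moreover have "of_int \<lfloor>z\<rfloor> \<le> z" "z < of_int \<lfloor>z\<rfloor> + 1" by linarith+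
      ultimately show "real (k0 n) \<le> z" "z / 2 \<le> real (k0 n)" using z2 by linarith+
      then show "k0 n > 0" using z2 by (cases "k0 n") auto
    qed
    have kc: "real (4 ^ r\<^sub>0 * k0 n) \<le> c0 * \<tau> ^ L"
      using mult_left_mono[OF k0(1), of "4 ^ r\<^sub>0"] by (simp add: z_def)
    have kiso: "real (4 ^ r\<^sub>0 * k0 n) \<le> real n * B.iso_prob / 2"
    proof -
      \<comment> \<open>Of \<open>\<alpha> ^ (12 * L) \<le> n\<close>, one factor
        \<open>\<alpha> ^ L\<close> covers the leaves and the remaining
        \<open>\<alpha> ^ (11 * L)\<close> beats the constant
        \<open>4 * exp \<alpha>\<close>.\<close>
      have "c0 * \<tau> ^ L \<le> 1 * \<alpha> ^ L" by (intro mult_mono power_mono) (use c0 \<tau> in auto)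
      also have "\<dots> = \<alpha> ^ L * (4 * exp \<alpha>) * (exp (- \<alpha>) / 4)" by (simp add: exp_minus field_simps)
      also have "\<dots> \<le> \<alpha> ^ L * \<alpha> ^ (11 * L) * (exp (- \<alpha>) / 4)"
      proof (intro mult_right_mono mult_left_mono)
        have "4 * exp \<alpha> \<le> \<alpha> ^ L" using ev(1) by simp
        also have "\<dots> \<le> \<alpha> ^ (11 * L)" by (rule power_increasing) (use \<alpha> in auto)
        finally show "4 * exp \<alpha> \<le> \<alpha> ^ (11 * L)" .
      qed (use \<alpha> in auto)
      also have "\<alpha> ^ L * \<alpha> ^ (11 * L) = \<alpha> ^ (12 * L)" by (simp add: power_add[symmetric])
      also have "\<alpha> ^ (12 * L) * (exp (- \<alpha>) / 4) \<le> real n * (exp (- \<alpha>) / 4)"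
        by (rule mult_right_mono[OF ev(4)]) simp
      also have "\<dots> \<le> real n * (B.iso_prob / 2)" by (rule mult_left_mono) (use iso_pos in auto)
      finally show ?thesis using kc by simp
    qed
    have k\<gamma>: "Suc (4 ^ r\<^sub>0 * k0 n) \<le> \<gamma> n"
    proof -
      have "(1 :: real) \<le> 4 ^ r\<^sub>0" by simp
      then have "z * 1 \<le> z * 4 ^ r\<^sub>0" by (rule mult_left_mono) (use z2 in simp)
      then have "1 \<le> c0 * \<tau> ^ L" using z2 by (simp add: z_def)
      then have "real (4 ^ r\<^sub>0 * k0 n) + 1 \<le> 2 * c0 * \<tau> ^ L" using kc by linarith
      also have "\<dots> \<le> c' * \<tau> ^ L" by (rule mult_right_mono[OF c0(2)]) (use \<tau> in simp)
      also have "\<dots> \<le> real (\<gamma> n)" using ev(5) \<tau> by simp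
      finally show ?thesis by linarith
    qed
    have \<eta>n: "\<eta> n = sqrt (4 * K L * \<alpha> ^ (L + 1))" by (simp add: \<eta>_def L_def)
    have \<eta>sq: "4 * K L * \<alpha> ^ (L + 1) \<ge> 0" using K0 \<alpha> by simp
    have k\<alpha>: "c0 / (8 * 4 ^ r\<^sub>0 * \<alpha>) * (\<tau> * \<alpha>) ^ L \<le> real (k0 n) * \<alpha> ^ m / 4"
    proof -
      have "c0 / (8 * 4 ^ r\<^sub>0 * \<alpha>) * (\<tau> * \<alpha>) ^ L = z / 2 * \<alpha> ^ m / 4"
        using \<alpha> by (simp add: z_def l power_mult_distrib)
      also have "\<dots> \<le> real (k0 n) * \<alpha> ^ m / 4"
        by (intro divide_right_mono mult_right_mono k0) (use \<alpha> in auto)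
      finally show ?thesis .
    qed
    have \<eta>k: "16 * \<eta> n \<le> sqrt (real (k0 n) * \<alpha> ^ m / 4)"
    proof (rule real_le_rsqrt)
      have "(16 * \<eta> n)\<^sup>2 = 1024 * \<alpha> * \<alpha> ^ L * K L"
        using \<eta>sq by (simp add: \<eta>n power_mult_distrib)
      also have "\<dots> \<le> 1024 * \<alpha> * \<alpha> ^ L * (C2 * \<tau> ^ L)"
        by (rule mult_left_mono) (use ev(1) \<alpha> in auto)
      also have "\<dots> = c0 / (8 * 4 ^ r\<^sub>0 * \<alpha>) * (\<tau> * \<alpha>) ^ L"
        using \<alpha> by (simp add: C2_def power_mult_distrib power2_eq_square mult_ac)
      also note k\<alpha>
      finally show "(16 * \<eta> n)\<^sup>2 \<le> real (k0 n) * \<alpha> ^ m / 4" .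
    qed
    have \<mu>k: "cs * \<bar>\<mu> 2\<bar> ^ L \<le> sqrt (real (k0 n) * \<alpha> ^ m / 4) / 2"
    proof -
      have half: "sqrt a / 2 * sqrt b = sqrt (a * b) / 2" for a b :: real by (simp add: real_sqrt_mult)
      have "\<bar>\<mu> 2\<bar> ^ L = sqrt ((\<tau> * \<alpha>) ^ L)"
        by (simp only: \<tau>(3) real_sqrt_power[of "(\<mu> 2)\<^sup>2" L] real_sqrt_abs)
      then have "cs * \<bar>\<mu> 2\<bar> ^ L = sqrt (c0 / (8 * 4 ^ r\<^sub>0 * \<alpha>) * (\<tau> * \<alpha>) ^ L) / 2"
        unfolding cs_def by (simp only: half)
      also have "\<dots> \<le> sqrt (real (k0 n) * \<alpha> ^ m / 4) / 2"
        by (intro divide_right_mono real_sqrt_le_mono k\<alpha>) simp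
      finally show ?thesis .
    qed
    have sub: "B.good_event L m (K L) \<subseteq> snd -` X n"
    proof (rule subsetI, unfold split_paired_all)
      fix \<sigma> E assume G: "(\<sigma>, E) \<in> B.good_event L m (K L)"
      have "\<exists>E'. adversarial_perturbation n (\<gamma> n) E E' \<and>
        (\<exists>ev. eigenvalue (distance_matrix n E' L) ev \<and> \<bar>ev\<bar> \<ge> sqrt (real (k0 n) * \<alpha> ^ m / 4) / 2 \<and>
          (\<forall>x u. eigenvector (distance_matrix n E' L) x ev \<longrightarrow> scalar_prod x x = 1 \<longrightarrow>
             ordered_eigenbasis n (distance_matrix n E L) u \<longrightarrow>
             (\<forall>j\<in>{1..r\<^sub>0}. \<bar>scalar_prod x (u j)\<bar> \<le> 16 * \<eta> n / (c1 * \<rho> ^ L / (2 * real r)))))"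
      proof (rule B.perturbation_exists[OF G l m K0 num(1,2) cpos r0_range(1) _ growB indep err k0(3) kiso k\<gamma> _ _ \<eta>k])
        show "r\<^sub>0 \<le> n" using ev(3) by simp
        show "0 \<le> \<eta> n" using \<eta>sq by (simp add: \<eta>n)
        show "4 * K L * \<alpha> ^ (L + 1) \<le> (\<eta> n)\<^sup>2" using \<eta>sq by (simp add: \<eta>n)
      qed
      then have "E \<in> X n"
        unfolding X_def \<epsilon>_def L_def[symmetric] mem_Collect_eq by (meson order_trans[OF \<mu>k])
      then show "(\<sigma>, E) \<in> snd -` X n" by simp
    qed
    have "measure_pmf.prob B.joint (B.good_event L m (K L)) \<le> measure_pmf.prob B.joint (snd -` X n)"
      by (rule measure_pmf.finite_measure_mono[OF sub]) simp
    also have "\<dots> = measure_pmf.prob (sbm n p W) (X n)" by (simp add: B.sbm_eq_joint measure_map_pmf)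
    finally show ?case using good unfolding L_def by linarith
  qed
  have "(\<lambda>n. 1 - ((real r)\<^sup>2 + 5) / real (l n) - iso_err n) \<longlonglongrightarrow> 1 - 0 - 0"
  proof (intro tendsto_diff tendsto_const)
    have "filterlim (\<lambda>n. real (l n)) at_infinity at_top"
      by (rule filterlim_at_top_imp_at_infinity) (rule filterlim_compose[OF filterlim_real_sequentially lim(1)])
    then show "(\<lambda>n. ((real r)\<^sup>2 + 5) / real (l n)) \<longlonglongrightarrow> 0" by (rule tendsto_divide_0[OF tendsto_const])
    show "iso_err \<longlonglongrightarrow> 0" unfolding iso_err_def by (rule isolation_error_limit)
  qed
  then have low: "(\<lambda>n. 1 - ((real r)\<^sup>2 + 5) / real (l n) - iso_err n) \<longlonglongrightarrow> 1" by simp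
  have prob: "(\<lambda>n. measure_pmf.prob (sbm n p W) (X n)) \<longlonglongrightarrow> 1"
    by (rule tendsto_sandwich[OF main _ low tendsto_const]) (simp add: always_eventually)
  have \<epsilon>0: "\<epsilon> \<longlonglongrightarrow> 0"
  proof -
    \<comment> \<open>Squared growth rate against noise: \<epsilon> is a constant times the square
      root of \<open>K / x ^ l\<close>, and \<open>K\<close> is polynomial in
      \<open>l\<close>.\<close>
    define x where "x = \<rho>\<^sup>2 / \<alpha>"
    have x: "x > 1" using \<rho>2 \<alpha> by (simp add: x_def)
    have "(\<lambda>n. K (l n) / x ^ l n) \<longlonglongrightarrow> 0"
      unfolding K_def using filterlim_compose[OF moment_factor_negligible[OF x] lim(1)] .
    then have "(\<lambda>n. 32 * real r / c1 * sqrt (4 * \<alpha> * (K (l n) / x ^ l n))) \<longlonglongrightarrow> 32 * real r / c1 * sqrt (4 * \<alpha> * 0)"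
      by (intro tendsto_intros)
    moreover have "\<epsilon> = (\<lambda>n. 32 * real r / c1 * sqrt (4 * \<alpha> * (K (l n) / x ^ l n)))"
    proof (rule ext)
      fix n
      have "4 * \<alpha> * (K (l n) / x ^ l n) = 4 * K (l n) * \<alpha> ^ (l n + 1) / (\<rho> ^ l n)\<^sup>2"
        using \<alpha> \<rho>0 by (simp add: x_def power_divide power_mult[symmetric] mult.commute)
      then have "sqrt (4 * \<alpha> * (K (l n) / x ^ l n)) = \<eta> n / \<rho> ^ l n"
        using \<rho>0 by (simp add: real_sqrt_divide \<eta>_def)
      then show "\<epsilon> n = 32 * real r / c1 * sqrt (4 * \<alpha> * (K (l n) / x ^ l n))" by (simp add: \<epsilon>_def)
    qed
    ultimately show ?thesis by simp
  qed
  show ?thesis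
    using cs \<epsilon>0 prob unfolding X_def by (intro exI[of _ cs] conjI exI[of _ \<epsilon>])
qed

end
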